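(* Let $R$ be a local number ring with maximal ideal $\mathfrak m$, residue field $k=R/\mathfrak m$ and normalization $\tilde R$. Then for every ideal $I$ of $R$ we have \[\dim_k \frac{I}{\mathfrak m I}\leq \dim_k \frac{\tilde R}{\mathfrak m\tilde R}.\]
   Context: A number ring is a subring of a number field (a finite extension of $\mathbb{Q}$); its normalization $\tilde R$ is its integral closure in its field of fractions. A local ring is a ring with a unique maximal ideal. *)

theory Defs
  imports "HOL-Computational_Algebra.Polynomial" "HOL-Library.Extended_Nat"
begin

definition is_subring :: "'a::field set \<Rightarrow> bool" where
  "is_subring R \<longleftrightarrow> 0 \<in> R \<and> 1 \<in> R \<and> (\<forall>x\<in>R. \<forall>y\<in>R. x + y \<in> R \<and> x * y \<in> R) \<and> (\<forall>x\<in>R. - x \<in> R)"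

text \<open>A number ring: a subring whose elements lie in a finite-dimensional Q-subspace,
  i.e. a subring of a number field (its fraction field is a finite extension of Q).\<close>
definition number_ring :: "'a::field_char_0 set \<Rightarrow> bool" where
  "number_ring R \<longleftrightarrow> is_subring R \<and>
     (\<exists>B. finite B \<and> (\<forall>x\<in>R. \<exists>c. x = (\<Sum>b\<in>B. of_rat (c b) * b)))"

definition frac_field :: "'a::field set \<Rightarrow> 'a set" where
  "frac_field R = {a / b | a b. a \<in> R \<and> b \<in> R \<and> b \<noteq> 0}"

definition normalization :: "'a::field set \<Rightarrow> 'a set" where
  "normalization R = {x \<in> frac_field R. \<exists>p. lead_coeff p = 1 \<and> (\<forall>i. coeff p i \<in> R) \<and> poly p x = 0}"

definition ideal_of :: "'a::field set \<Rightarrow> 'a set \<Rightarrow> bool" where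
  "ideal_of R I \<longleftrightarrow> I \<subseteq> R \<and> 0 \<in> I \<and> (\<forall>x\<in>I. \<forall>y\<in>I. x + y \<in> I) \<and> (\<forall>r\<in>R. \<forall>x\<in>I. r * x \<in> I)"

definition maximal_ideal :: "'a::field set \<Rightarrow> 'a set \<Rightarrow> bool" where
  "maximal_ideal R m \<longleftrightarrow> ideal_of R m \<and> m \<noteq> R \<and>
     (\<forall>J. ideal_of R J \<and> m \<subseteq> J \<longrightarrow> J = m \<or> J = R)"

definition local_ring :: "'a::field set \<Rightarrow> bool" where
  "local_ring R \<longleftrightarrow> (\<exists>!m. maximal_ideal R m)"

definition ideal_mult_set :: "'a::field set \<Rightarrow> 'a set \<Rightarrow> 'a set" where
  "ideal_mult_set J M = {\<Sum>i<n. a i * b i | (n::nat) a b. \<forall>i<n. a i \<in> J \<and> b i \<in> M}"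

definition R_span :: "'a::field set \<Rightarrow> 'a set \<Rightarrow> 'a set" where
  "R_span R S = {\<Sum>s\<in>S. c s * s | c. \<forall>s\<in>S. c s \<in> R}"

text \<open>dim over k = R/m of M / m M: the minimal size of a finite subset S of M whose
  images span M / m M over k, i.e. M = R-span(S) + m M (infinity if there is none).\<close>
definition residue_dim :: "'a::field set \<Rightarrow> 'a set \<Rightarrow> 'a set \<Rightarrow> enat" where
  "residue_dim R m M = Inf {enat (card S) | S. finite S \<and> S \<subseteq> M \<and>
      M \<subseteq> {x + y | x y. x \<in> R_span R S \<and> y \<in> ideal_mult_set m M}}"

end

theory Submission
  imports Defs "Jordan_Normal_Form.Char_Poly"
begin

text \<open>
  Let \<open>S\<close> be the normalization of \<open>R\<close>, \<open>p\<close> the residue characteristic and \<open>q = |R/m|\<close>, which is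
  finite; it suffices to show \<open>[I : m I] \<le> [S : m S]\<close>. The trace form, together with Kronecker's
  description of the elements of \<open>R\<close> as fractions of algebraic integers with denominators that are
  units of \<open>R\<close>, gives \<open>p^M S \<subseteq> R\<close> for some \<open>M\<close>, so \<open>I\<close> has finite index in \<open>S\<close>. If \<open>m S\<close> had a
  generator \<open>t\<close> in \<open>m\<close>, then \<open>[I : m I] \<le> [I : t I] = [S : t S] = [S : m S]\<close>, because multiplication by
  \<open>t\<close> has the same index on any two commensurable lattices. Such a \<open>t\<close> need not exist over a finite
  residue field. But \<open>m S\<close> is invertible, and for a suitable monic integral polynomial \<open>f\<close> of some
  degree \<open>N\<close> there is \<open>t\<close> with coefficients in \<open>m\<close> that generates \<open>m S[X]/(f)\<close>; the same argument
  modulo \<open>f\<close> yields \<open>[I : m I]^N \<le> [S : m S]^N\<close>. If the residue field has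
  characteristic \<open>0\<close>, then \<open>R\<close> is a field.
\<close>

text \<open>A generator \<open>t\<close> of \<open>m S\<close> inside \<open>m\<close> has to avoid
  \<open>m P\<close> for each of the finitely many maximal ideals \<open>P\<close> of
  \<open>S\<close>. These cut out proper subspaces of \<open>m / m^2\<close>, and finitely many
  proper subspaces can cover a vector space over a finite field; passing to polynomials modulo
  \<open>f\<close> removes this obstruction. The coefficients of \<open>t\<close> are the
  \<open>a i\<close> of a relation \<open>1 = sum a i * b i\<close> with \<open>a i\<close> in
  \<open>m\<close> and \<open>b i\<close> in the inverse of \<open>m S\<close>. The polynomial
  \<open>f\<close> has integer coefficients because reduction modulo it must keep coefficients in
  \<open>I\<close>, which need not be stable under \<open>S\<close>. That \<open>m S\<close> is
  invertible is derived from the finiteness of \<open>S / p S\<close> and the integral closedness of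
  \<open>S\<close>, without factoring ideals. Dimensions become indices because
  \<open>M / m M\<close>, if of finite dimension \<open>d\<close> over \<open>R / m\<close>, has
  \<open>q ^ d\<close> elements; indices multiply along chains and turn into \<open>N\<close>-th
  powers for polynomials of degree less than \<open>N\<close>.\<close>

definition add_group :: "'b::ab_group_add set \<Rightarrow> bool" where
  "add_group A \<longleftrightarrow> 0 \<in> A \<and> (\<forall>x\<in>A. \<forall>y\<in>A. x - y \<in> A)"

lemma add_groupD:
  assumes "add_group A"
  shows "0 \<in> A" "x \<in> A \<Longrightarrow> y \<in> A \<Longrightarrow> x - y \<in> A" "x \<in> A \<Longrightarrow> - x \<in> A"
    "x \<in> A \<Longrightarrow> y \<in> A \<Longrightarrow> x + y \<in> A"
proof -
  show 0: "0 \<in> A" and d: "x \<in> A \<Longrightarrow> y \<in> A \<Longrightarrow> x - y \<in> A" for x y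
    using assms unfolding add_group_def by auto
  show m: "x \<in> A \<Longrightarrow> - x \<in> A" for x using d[OF 0, of x] by simp
  show "x \<in> A \<Longrightarrow> y \<in> A \<Longrightarrow> x + y \<in> A" using d[of x "- y"] m[of y] by simp
qed

lemma add_group_sum:
  assumes "add_group A" "\<And>i. i \<in> I \<Longrightarrow> f i \<in> A"
  shows "sum f I \<in> A"
  using assms(2)
  by (induction I rule: infinite_finite_induct) (auto intro: add_groupD[OF assms(1)])

lemma add_group_of_int_mult:
  fixes A :: "'b::ring_1 set"
  assumes "add_group A" "x \<in> A"
  shows "of_int k * x \<in> A"
proof (induction k rule: int_induct[where k = 0])
  case base
  show ?case using assms by (simp add: add_groupD)
next
  case (step1 i)
  have "of_int (i + 1) * x = of_int i * x + x" by (simp add: algebra_simps)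
  then show ?case using add_groupD(4)[OF assms(1) step1(2) assms(2)] by simp
next
  case (step2 i)
  have "of_int (i - 1) * x = of_int i * x - x" by (simp add: algebra_simps)
  then show ?case using add_groupD(2)[OF assms(1) step2(2) assms(2)] by simp
qed

lemma add_group_mult_image:
  fixes M :: "'b::ring set"
  assumes "add_group M"
  shows "add_group ((\<lambda>x. c * x) ` M)"
  unfolding add_group_def
proof (intro conjI ballI)
  show "0 \<in> (\<lambda>x. c * x) ` M"
    using add_groupD(1)[OF assms] by (intro image_eqI[of _ _ 0]) auto
  fix x y assume "x \<in> (\<lambda>x. c * x) ` M" "y \<in> (\<lambda>x. c * x) ` M"
  then obtain a b where "a \<in> M" "b \<in> M" "x = c * a" "y = c * b" by auto
  then show "x - y \<in> (\<lambda>x. c * x) ` M"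
    using add_groupD(2)[OF assms, of a b]
    by (intro image_eqI[of _ _ "a - b"]) (auto simp: right_diff_distrib)
qed

subsection \<open>Indices of subgroups\<close>

definition transversal :: "'b::ab_group_add set \<Rightarrow> 'b set \<Rightarrow> 'b set \<Rightarrow> bool" where
  "transversal A C T \<longleftrightarrow> T \<subseteq> A \<and> finite T \<and> (\<forall>x\<in>A. \<exists>!t. t \<in> T \<and> x - t \<in> C)"

text \<open>A relation instead of a number: it asserts finiteness together with the value, so an
  infinite index satisfies it for no \<open>n\<close>.\<close>

definition has_index :: "'b::ab_group_add set \<Rightarrow> 'b set \<Rightarrow> nat \<Rightarrow> bool" where
  "has_index A C n \<longleftrightarrow> (\<exists>T. transversal A C T \<and> card T = n)"

text \<open>Weaker than a finite transversal: elements of \<open>F\<close> may lie outside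
  \<open>A\<close> and may be congruent to each other. This passes easily through inclusions and
  chains; \<open>fin_mod_has_index\<close> then chooses genuine representatives.\<close>

definition fin_mod :: "'b::ab_group_add set \<Rightarrow> 'b set \<Rightarrow> bool" where
  "fin_mod A C \<longleftrightarrow> (\<exists>F. finite F \<and> (\<forall>x\<in>A. \<exists>f\<in>F. x - f \<in> C))"

lemma transversal_unique:
  assumes "transversal A C T" "add_group C" "s \<in> T" "t \<in> T" "s - t \<in> C"
  shows "s = t"
proof -
  have "s \<in> A" using assms unfolding transversal_def by auto
  moreover have "s - s \<in> C" using add_groupD(1)[OF assms(2)] by simp
  ultimately show ?thesis using assms unfolding transversal_def by blast
qed

lemma fin_mod_has_index:
  assumes "add_group C" "fin_mod A C"
  obtains n where "has_index A C n"
proof -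
  obtain F where F: "finite F" "\<And>x. x \<in> A \<Longrightarrow> \<exists>f\<in>F. x - f \<in> C"
    using assms(2) unfolding fin_mod_def by auto
  define cos where "cos x = {y \<in> A. x - y \<in> C}" for x
  have cos_eq: "cos x = cos y" if "x - y \<in> C" for x y
  proof -
    have "x - z \<in> C \<longleftrightarrow> y - z \<in> C" for z
      using add_groupD(2)[OF assms(1), of "x - z" "x - y"] that
        add_groupD(4)[OF assms(1), of "y - z" "x - y"] by auto
    then show ?thesis unfolding cos_def by auto
  qed
  have "cos ` A \<subseteq> cos ` F" using F(2) cos_eq by (fastforce intro: imageI)
  then have fin: "finite (cos ` A)" using F(1) finite_surj by blast
  define pick where "pick S = (SOME y. y \<in> S)" for S :: "'a set"
  have pick: "pick (cos x) \<in> A \<and> x - pick (cos x) \<in> C" if "x \<in> A" for x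
  proof -
    have "x \<in> cos x" using that add_groupD(1)[OF assms(1)] by (simp add: cos_def)
    then have "pick (cos x) \<in> cos x" unfolding pick_def by (metis someI)
    then show ?thesis by (simp add: cos_def)
  qed
  have "transversal A C (pick ` cos ` A)"
    unfolding transversal_def
  proof (intro conjI ballI)
    show "pick ` cos ` A \<subseteq> A" using pick by auto
    show "finite (pick ` cos ` A)" using fin by simp
    fix x assume x: "x \<in> A"
    show "\<exists>!t. t \<in> pick ` cos ` A \<and> x - t \<in> C"
    proof (rule ex1I[of _ "pick (cos x)"])
      show "pick (cos x) \<in> pick ` cos ` A \<and> x - pick (cos x) \<in> C" using pick[OF x] x by auto
      fix t assume "t \<in> pick ` cos ` A \<and> x - t \<in> C"
      then obtain y where y: "y \<in> A" "t = pick (cos y)" "x - t \<in> C" by auto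
      have "x - y \<in> C"
        using add_groupD(2)[OF assms(1) y(3), of "y - t"] pick[OF y(1)] y(2) by simp
      then show "t = pick (cos x)" using cos_eq y(2) by simp
    qed
  qed
  then show ?thesis using that unfolding has_index_def by blast
qed

lemma has_index_fin_mod: "has_index A C n \<Longrightarrow> fin_mod A C"
  unfolding has_index_def transversal_def fin_mod_def by (metis (no_types))

text \<open>Both estimates of an index come from this pigeonhole: \<open>T\<close> a transversal and
  \<open>F\<close> a cover bounds the index from above, \<open>T\<close> incongruent and
  \<open>F\<close> a transversal bounds it from below.\<close>

lemma card_incongruent_le:
  assumes "add_group C" "finite F" "\<And>x. x \<in> T \<Longrightarrow> \<exists>f\<in>F. x - f \<in> C"
    and "\<And>s t. s \<in> T \<Longrightarrow> t \<in> T \<Longrightarrow> s - t \<in> C \<Longrightarrow> s = t"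
  shows "finite T \<and> card T \<le> card F"
proof -
  obtain h where h: "\<And>x. x \<in> T \<Longrightarrow> h x \<in> F \<and> x - h x \<in> C" using assms(3) by metis
  have "inj_on h T"
  proof (rule inj_onI)
    fix s t assume st: "s \<in> T" "t \<in> T" "h s = h t"
    have "s - t \<in> C"
      using add_groupD(2)[OF assms(1), of "s - h s" "t - h t"] h[OF st(1)] h[OF st(2)] st(3)
      by simp
    then show "s = t" using assms(4) st by auto
  qed
  moreover have "h ` T \<subseteq> F" using h by auto
  ultimately show ?thesis using assms(2) by (metis card_inj_on_le inj_on_finite)
qed

lemma has_index_le_card:
  assumes "add_group C" "has_index A C n" "finite F" "\<And>x. x \<in> A \<Longrightarrow> \<exists>f\<in>F. x - f \<in> C"
  shows "n \<le> card F"
proof -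
  obtain T where T: "transversal A C T" "card T = n" using assms(2) unfolding has_index_def by auto
  have "card T \<le> card F"
    using card_incongruent_le[OF assms(1,3), of T] assms(4) T(1) transversal_unique[OF T(1) assms(1)]
    unfolding transversal_def by blast
  then show ?thesis using T(2) by simp
qed

lemma card_le_has_index:
  assumes "add_group C" "has_index A C n" "T \<subseteq> A"
    and "\<And>s t. s \<in> T \<Longrightarrow> t \<in> T \<Longrightarrow> s - t \<in> C \<Longrightarrow> s = t"
  shows "card T \<le> n"
proof -
  obtain F where F: "transversal A C F" "card F = n" using assms(2) unfolding has_index_def by auto
  have "card T \<le> card F"
    using card_incongruent_le[OF assms(1), of F T] assms(3,4) F(1)
    unfolding transversal_def by blast
  then show ?thesis using F(2) by simp
qed

lemma has_index_antimono:
  assumes "add_group C'" "has_index A C n" "has_index A C' n'" "C \<subseteq> C'"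
  shows "n' \<le> n"
proof -
  obtain T where T: "transversal A C T" "card T = n" using assms(2) unfolding has_index_def by auto
  show ?thesis
    using has_index_le_card[OF assms(1,3), of T] T assms(4) unfolding transversal_def by blast
qed

lemma has_index_unique:
  assumes "add_group C" "has_index A C n" "has_index A C n'"
  shows "n = n'"
  using has_index_antimono[OF assms(1)] assms(2,3) by (meson le_antisym subset_refl)

lemma has_index_trans:
  assumes "add_group A" "add_group B" "add_group C" "C \<subseteq> B" "B \<subseteq> A"
    and "has_index A B n" "has_index B C k"
  shows "has_index A C (n * k)"
proof -
  obtain T U where T: "transversal A B T" "card T = n" and U: "transversal B C U" "card U = k"
    using assms(6,7) unfolding has_index_def by auto
  have TA: "T \<subseteq> A" "finite T" and UB: "U \<subseteq> B" "finite U"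
    using T U unfolding transversal_def by auto
  define P where "P = (\<lambda>(a, b). a + b) ` (T \<times> U)"
  have key: "a = a' \<and> b = b'"
    if "a \<in> T" "a' \<in> T" "b \<in> U" "b' \<in> U" "(a + b) - (a' + b') \<in> C" for a a' b b'
  proof -
    have "b' - b \<in> B" using that UB by (intro add_groupD(2)[OF assms(2)]) auto
    then have "(a + b) - (a' + b') + (b' - b) \<in> B"
      using that assms(4) by (intro add_groupD(4)[OF assms(2)]) auto
    then have "a - a' \<in> B" by (simp add: algebra_simps)
    then have "a = a'" using transversal_unique[OF T(1) assms(2)] that by blast
    moreover from this have "b = b'"
      using transversal_unique[OF U(1) assms(3)] that by simp
    ultimately show ?thesis by simp
  qed
  have inj: "inj_on (\<lambda>(a, b). a + b) (T \<times> U)"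
  proof (rule inj_onI, clarify)
    fix a b a' b' assume "a \<in> T" "b \<in> U" "a' \<in> T" "b' \<in> U" "a + b = a' + b'"
    then show "a = a' \<and> b = b'" using key[of a a' b b'] add_groupD(1)[OF assms(3)] by simp
  qed
  have "transversal A C P"
    unfolding transversal_def
  proof (intro conjI ballI)
    show "P \<subseteq> A" using TA UB assms(5) unfolding P_def by (auto intro!: add_groupD(4)[OF assms(1)])
    show "finite P" using TA UB unfolding P_def by auto
    fix x assume x: "x \<in> A"
    obtain a where a: "a \<in> T" "x - a \<in> B" using T(1) x unfolding transversal_def by blast
    obtain b where b: "b \<in> U" "x - a - b \<in> C" using U(1) a unfolding transversal_def by blast
    show "\<exists>!t. t \<in> P \<and> x - t \<in> C"
    proof (rule ex1I[of _ "a + b"])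
      show "a + b \<in> P \<and> x - (a + b) \<in> C" using a b unfolding P_def by (auto simp: algebra_simps)
      fix t assume t: "t \<in> P \<and> x - t \<in> C"
      then obtain a' b' where ab: "a' \<in> T" "b' \<in> U" "t = a' + b'" unfolding P_def by auto
      have "(x - a - b) - (x - t) \<in> C" using b t add_groupD(2)[OF assms(3)] by blast
      then have "(a' + b') - (a + b) \<in> C" using ab by (simp add: algebra_simps)
      from key[OF _ _ _ _ this] show "t = a + b" using a b ab by auto
    qed
  qed
  moreover have "card P = n * k" unfolding P_def using card_image[OF inj] T U by (simp add: card_cartesian_product)
  ultimately show ?thesis unfolding has_index_def by blast
qed

lemma has_index_pos: "has_index A C n \<Longrightarrow> 0 \<in> A \<Longrightarrow> 0 < n"
  by (auto simp: has_index_def transversal_def card_gt_0_iff)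

text \<open>Injectivity is asked on \<open>A\<close> only, because multiplication by a fixed
  polynomial modulo \<open>f\<close> is additive but kills the multiples of
  \<open>f\<close>.\<close>

lemma has_index_image:
  assumes "has_index A C n" "inj_on \<phi> A" "C \<subseteq> A" "add_group A"
    and diff: "\<And>x y. x \<in> A \<Longrightarrow> y \<in> A \<Longrightarrow> \<phi> (x - y) = \<phi> x - \<phi> y"
  shows "has_index (\<phi> ` A) (\<phi> ` C) n"
proof -
  obtain T where T: "transversal A C T" "card T = n" using assms(1) unfolding has_index_def by auto
  have TA: "T \<subseteq> A" "finite T" using T unfolding transversal_def by auto
  have iff: "\<phi> x - \<phi> t \<in> \<phi> ` C \<longleftrightarrow> x - t \<in> C" if "x \<in> A" "t \<in> A" for x t
    using diff[OF that] assms(2,3) add_groupD(2)[OF assms(4) that]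
    by (metis inj_on_image_mem_iff)
  have "transversal (\<phi> ` A) (\<phi> ` C) (\<phi> ` T)"
    unfolding transversal_def
  proof (intro conjI ballI)
    show "\<phi> ` T \<subseteq> \<phi> ` A" "finite (\<phi> ` T)" using TA by auto
    fix y assume "y \<in> \<phi> ` A"
    then obtain x where x: "x \<in> A" "y = \<phi> x" by auto
    then obtain t where t: "t \<in> T" "x - t \<in> C" "\<And>s. s \<in> T \<Longrightarrow> x - s \<in> C \<Longrightarrow> s = t"
      using T(1) unfolding transversal_def by blast
    show "\<exists>!t. t \<in> \<phi> ` T \<and> y - t \<in> \<phi> ` C"
    proof (rule ex1I[of _ "\<phi> t"])
      show "\<phi> t \<in> \<phi> ` T \<and> y - \<phi> t \<in> \<phi> ` C" using t(1,2) iff[OF x(1)] TA(1) x(2) by blast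
      show "u = \<phi> t" if "u \<in> \<phi> ` T \<and> y - u \<in> \<phi> ` C" for u
        using that t(3) iff[OF x(1)] TA(1) x(2) by blast
    qed
  qed
  moreover have "card (\<phi> ` T) = n" using T(2) TA(1) assms(2) by (metis card_image inj_on_subset)
  ultimately show ?thesis unfolding has_index_def by blast
qed

lemma fin_mod_mono:
  assumes "fin_mod A C" "A' \<subseteq> A" "C \<subseteq> C'"
  shows "fin_mod A' C'"
proof -
  obtain F where "finite F" "\<And>x. x \<in> A \<Longrightarrow> \<exists>f\<in>F. x - f \<in> C"
    using assms(1) unfolding fin_mod_def by auto
  then show ?thesis using assms(2,3) unfolding fin_mod_def by (intro exI[of _ F]) blast
qed

lemma fin_mod_trans:
  assumes "fin_mod A B" "fin_mod B C"
  shows "fin_mod A C"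
proof -
  obtain F where F: "finite F" "\<And>x. x \<in> A \<Longrightarrow> \<exists>f\<in>F. x - f \<in> B"
    using assms(1) unfolding fin_mod_def by auto
  obtain H where H: "finite H" "\<And>x. x \<in> B \<Longrightarrow> \<exists>f\<in>H. x - f \<in> C"
    using assms(2) unfolding fin_mod_def by auto
  have "\<exists>e\<in>(\<lambda>(f, h). f + h) ` (F \<times> H). x - e \<in> C" if x: "x \<in> A" for x
  proof -
    obtain f where f: "f \<in> F" "x - f \<in> B" using F x by blast
    obtain h where h: "h \<in> H" "x - f - h \<in> C" using H f by blast
    have "x - (f + h) \<in> C" using h by (simp add: algebra_simps)
    then show ?thesis using f h by force
  qed
  then show ?thesis using F H unfolding fin_mod_def
    by (intro exI[of _ "(\<lambda>(f, h). f + h) ` (F \<times> H)"]) auto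
qed

text \<open>Applied to sequences of powers, it yields exponents \<open>i < j\<close> at which a
  power repeats modulo \<open>C\<close>.\<close>

lemma fin_mod_pigeonhole:
  assumes "fin_mod A C" "add_group C" "\<And>j::nat. a j \<in> A"
  obtains i j where "i < j" "a j - a i \<in> C"
proof -
  obtain F where F: "finite F" "\<And>x. x \<in> A \<Longrightarrow> \<exists>f\<in>F. x - f \<in> C"
    using assms(1) unfolding fin_mod_def by auto
  obtain h where h: "\<And>j. h j \<in> F \<and> a j - h j \<in> C" using F(2)[OF assms(3)] by metis
  have "\<not> inj h"
    using h F(1) by (meson finite_subset image_subsetI infinite_UNIV_nat finite_imageD)
  then obtain i j where ij: "i < j" "h i = h j" unfolding inj_def by (metis nat_neq_iff)
  have "a j - a i \<in> C"
    using add_groupD(2)[OF assms(2), of "a j - h j" "a i - h i"] h[of i] h[of j] ij by simp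
  then show ?thesis using that ij by blast
qed

lemma fin_mod_power_multiple:
  fixes M :: "'b::comm_ring_1 set"
  assumes "add_group M" "fin_mod M ((\<lambda>x. c * x) ` M)"
  shows "fin_mod M ((\<lambda>x. c ^ k * x) ` M)"
proof (induction k)
  case 0
  show ?case
    using add_groupD(1)[OF assms(1)] unfolding fin_mod_def by (auto intro!: exI[of _ "{0}"])
next
  case (Suc k)
  let ?P = "\<lambda>k. (\<lambda>x. c ^ k * x) ` M"
  obtain F where F: "finite F" "\<And>x. x \<in> M \<Longrightarrow> \<exists>f\<in>F. x - f \<in> (\<lambda>x. c * x) ` M"
    using assms(2) unfolding fin_mod_def by auto
  \<comment> \<open>Multiplication by \<open>c ^ k\<close> carries representatives of
    \<open>M\<close> modulo \<open>c M\<close> to representatives of this layer.\<close>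
  have "fin_mod (?P k) (?P (Suc k))"
    unfolding fin_mod_def
  proof (intro exI conjI ballI)
    show "finite ((\<lambda>x. c ^ k * x) ` F)" using F(1) by simp
    fix x assume "x \<in> ?P k"
    then obtain r where r: "r \<in> M" "x = c ^ k * r" by auto
    obtain f where f: "f \<in> F" "r - f \<in> (\<lambda>x. c * x) ` M" using F(2)[OF r(1)] by blast
    then obtain s where s: "s \<in> M" "r - f = c * s" by auto
    have "x - c ^ k * f = c ^ k * (r - f)" by (simp add: r(2) right_diff_distrib)
    also have "\<dots> = c ^ Suc k * s" by (simp add: s(2) mult_ac)
    finally have "x - c ^ k * f \<in> ?P (Suc k)" using s(1) by blast
    then show "\<exists>f\<in>(\<lambda>x. c ^ k * x) ` F. x - f \<in> ?P (Suc k)" using f(1) by blast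
  qed
  then show ?case by (rule fin_mod_trans[OF Suc.IH])
qed

subsection \<open>Polynomials with coefficients in a subgroup\<close>

definition coeffs_in :: "'b::zero set \<Rightarrow> 'b poly set" where
  "coeffs_in M = {q. \<forall>i. coeff q i \<in> M}"

text \<open>A copy of \<open>M ^ N\<close>. Polynomials replace tuples so that products and
  remainders modulo \<open>f\<close> act on it.\<close>

definition coeffs_lt :: "nat \<Rightarrow> 'b::zero set \<Rightarrow> 'b poly set" where
  "coeffs_lt N M = {q \<in> coeffs_in M. \<forall>i\<ge>N. coeff q i = 0}"

lemma add_group_coeffs_in:
  assumes "add_group M"
  shows "add_group (coeffs_in M)" "add_group (coeffs_lt N M)"
  using add_groupD(1,2)[OF assms]
  by (simp_all add: add_group_def coeffs_in_def coeffs_lt_def)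

text \<open>Representatives are chosen in each coefficient independently; the induction splits off
  the constant coefficient with \<open>pCons\<close>.\<close>

lemma has_index_coeffs_lt:
  fixes A C :: "'b::ab_group_add set"
  assumes "has_index A C n" "0 \<in> A" "0 \<in> C"
  shows "has_index (coeffs_lt N A) (coeffs_lt N C) (n ^ N)"
proof (induction N)
  case 0
  have zero: "coeffs_lt 0 M = {0}" if "0 \<in> M" for M :: "'b set"
    using that by (auto simp: coeffs_lt_def coeffs_in_def poly_eq_iff)
  have "transversal (coeffs_lt 0 A) (coeffs_lt 0 C) {0}"
    using assms by (auto simp: transversal_def zero)
  then show ?case unfolding has_index_def by (intro exI[of _ "{0}"]) auto
next
  case (Suc N)
  obtain T where T: "transversal A C T" "card T = n" using assms(1) unfolding has_index_def by auto
  obtain U where U: "transversal (coeffs_lt N A) (coeffs_lt N C) U" "card U = n ^ N"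
    using Suc unfolding has_index_def by auto
  have TA: "T \<subseteq> A" "finite T" and UA: "U \<subseteq> coeffs_lt N A" "finite U"
    using T U unfolding transversal_def by auto
  have mem: "pCons a q \<in> coeffs_lt (Suc N) M \<longleftrightarrow> a \<in> M \<and> q \<in> coeffs_lt N M"
    for a q and M :: "'b set"
    unfolding coeffs_lt_def coeffs_in_def
    by (auto simp: coeff_pCons split: nat.splits)
  let ?P = "(\<lambda>(a, q). pCons a q) ` (T \<times> U)"
  have inj: "inj_on (\<lambda>(a, q). pCons a q) (T \<times> U)" by (auto simp: inj_on_def)
  have "transversal (coeffs_lt (Suc N) A) (coeffs_lt (Suc N) C) ?P"
    unfolding transversal_def
  proof (intro conjI ballI)
    show "?P \<subseteq> coeffs_lt (Suc N) A" using TA UA by (auto simp: mem)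
    show "finite ?P" using TA UA by auto
    fix x assume x: "x \<in> coeffs_lt (Suc N) A"
    obtain b r where br: "x = pCons b r" by (metis pCons_cases)
    have b: "b \<in> A" and r: "r \<in> coeffs_lt N A" using x br mem by auto
    have *: "\<exists>!a. a \<in> T \<and> b - a \<in> C" "\<exists>!q. q \<in> U \<and> r - q \<in> coeffs_lt N C"
      using T U b r unfolding transversal_def by auto
    show "\<exists>!t. t \<in> ?P \<and> x - t \<in> coeffs_lt (Suc N) C"
    proof -
      obtain a q where aq: "a \<in> T" "b - a \<in> C" "q \<in> U" "r - q \<in> coeffs_lt N C"
        using * by auto
      show ?thesis
      proof (rule ex1I[of _ "pCons a q"])
        show "pCons a q \<in> ?P \<and> x - pCons a q \<in> coeffs_lt (Suc N) C"
          using aq by (auto simp: br mem)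
        fix t assume "t \<in> ?P \<and> x - t \<in> coeffs_lt (Suc N) C"
        then show "t = pCons a q" using aq * by (auto simp: br mem)
      qed
    qed
  qed
  moreover have "card ?P = n ^ Suc N" using card_image[OF inj] T U by (simp add: card_cartesian_product)
  ultimately show ?case unfolding has_index_def by blast
qed

lemma coeff_sum_monom:
  assumes "finite I"
  shows "coeff (\<Sum>i\<in>I. monom (c i) i) l = (if l \<in> I then c l else 0)"
proof -
  have "coeff (\<Sum>i\<in>I. monom (c i) i) l = (\<Sum>i\<in>I. if i = l then c l else 0)"
    unfolding coeff_sum by (intro sum.cong) auto
  then show ?thesis using assms by simp
qed

lemma poly_mod_root:
  fixes f q :: "'b::field poly"
  assumes "poly f x = 0"
  shows "poly (q mod f) x = poly q x"
proof -
  have "poly q x = poly (q div f) x * poly f x + poly (q mod f) x"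
    by (simp only: poly_mult[symmetric] poly_add[symmetric] div_mult_mod_eq)
  then show ?thesis using assms by simp
qed

lemma sum_int_coeffs_in_subgroup:
  fixes G :: "'b::ring_1 set"
  assumes "add_group G" "q \<in> coeffs_lt N \<int>" "\<And>i. i < N \<Longrightarrow> v i \<in> G"
  shows "(\<Sum>i\<le>degree q. coeff q i * v i) \<in> G"
proof (rule add_group_sum[OF assms(1)])
  fix i
  obtain z where z: "coeff q i = of_int z"
    using assms(2) unfolding coeffs_lt_def coeffs_in_def by (blast elim: Ints_cases)
  show "coeff q i * v i \<in> G"
  proof (cases "i < N")
    case True
    then show ?thesis unfolding z by (intro add_group_of_int_mult assms(1,3))
  next
    case False
    then have "coeff q i = 0" using assms(2) unfolding coeffs_lt_def by auto
    then show ?thesis using add_groupD(1)[OF assms(1)] by simp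
  qed
qed

lemma coeffs_in_mult:
  fixes L M P :: "'b::comm_semiring_0 set"
  assumes "0 \<in> P" "\<And>x y. x \<in> P \<Longrightarrow> y \<in> P \<Longrightarrow> x + y \<in> P" "\<And>x y. x \<in> L \<Longrightarrow> y \<in> M \<Longrightarrow> x * y \<in> P"
    and "q \<in> coeffs_in L" "r \<in> coeffs_in M"
  shows "q * r \<in> coeffs_in P"
proof -
  have "sum f I \<in> P" if "\<And>i. i \<in> I \<Longrightarrow> f i \<in> P" for f and I :: "nat set"
    using that by (induction I rule: infinite_finite_induct) (auto simp: assms(1,2))
  then show ?thesis
    using assms(4,5) by (simp add: coeffs_in_def coeff_mult assms(3))
qed

text \<open>Long division by a monic \<open>f\<close> only subtracts multiples of coefficients of
  \<open>f\<close>, so \<open>M\<close> may be any subgroup stable under those coefficients; it need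
  not be a ring.\<close>

lemma coeffs_in_div_mod:
  fixes f q :: "'b::field poly"
  assumes "lead_coeff f = 1" "add_group M" "\<And>i x. x \<in> M \<Longrightarrow> coeff f i * x \<in> M"
    and "q \<in> coeffs_in M"
  shows "q div f \<in> coeffs_in M \<and> q mod f \<in> coeffs_in M"
  using assms(4)
proof (induction "degree q" arbitrary: q rule: less_induct)
  case less
  have f0: "f \<noteq> 0" using assms(1) by auto
  note sub = add_groupD[OF add_group_coeffs_in(1)[OF assms(2)]]
  show ?case
  proof (cases "degree q < degree f \<or> q = 0")
    case True
    then have "q mod f = q" "q div f = 0" by (auto simp: mod_poly_less div_poly_less)
    then show ?thesis using less.prems sub(1) by simp
  next
    case False
    define d where "d = degree q - degree f"
    define l where "l = monom (lead_coeff q) d"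
    define q' where "q' = q - l * f"
    have lM: "l \<in> coeffs_in M"
      using less.prems add_groupD(1)[OF assms(2)] by (auto simp: l_def coeffs_in_def)
    have "l * f \<in> coeffs_in M"
      using less.prems assms(3)[of "lead_coeff q"] add_groupD(1)[OF assms(2)]
      by (auto simp: l_def coeffs_in_def coeff_monom_mult mult.commute[of "lead_coeff q"])
    then have q': "q' \<in> coeffs_in M" unfolding q'_def using less.prems sub(2) by blast
    have lc: "coeff q' (degree q) = 0"
      using False assms(1) by (simp add: q'_def l_def d_def coeff_monom_mult)
    have "degree (l * f) \<le> d + degree f"
      using degree_mult_le[of l f] degree_monom_le[of "lead_coeff q" d] unfolding l_def by linarith
    then have "degree (l * f) \<le> degree q" using False by (simp add: d_def)
    then have le: "degree q' \<le> degree q" unfolding q'_def by (intro degree_diff_le) auto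
    have q: "q = l * f + q'" by (simp add: q'_def)
    have mod: "q mod f = q' mod f" unfolding q by simp
    have div: "q div f = l + q' div f" unfolding q using f0 by simp
    show ?thesis
    proof (cases "degree q' = degree q")
      case True
      \<comment> \<open>\<open>degree\<close> is 0 for constants and for zero alike, so the degree
        can fail to drop only when nothing is left.\<close>
      then have "q' = 0" using lc by (metis leading_coeff_0_iff)
      then show ?thesis using mod div q' lM by simp
    next
      case False
      then have "q' div f \<in> coeffs_in M \<and> q' mod f \<in> coeffs_in M" using less.hyps[OF _ q'] le by simp
      then show ?thesis using sub(4)[OF lM] mod div by simp
    qed
  qed
qed

subsection \<open>Denominators of traces\<close>

lemma common_denominator:
  fixes S :: "rat set"
  assumes "finite S"
  obtains D :: int where "D > 0" "\<And>x. x \<in> S \<Longrightarrow> of_int D * x \<in> \<int>"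
proof -
  have "\<exists>D::int. D > 0 \<and> (\<forall>x\<in>S. of_int D * x \<in> \<int>)"
    using assms
  proof (induction S)
    case empty
    show ?case by (intro exI[of _ 1]) auto
  next
    case (insert x S)
    obtain D :: int where D: "D > 0" "\<And>y. y \<in> S \<Longrightarrow> of_int D * y \<in> \<int>" using insert.IH by blast
    obtain a b :: int where ab: "b > 0" "x = of_int a / of_int b"
      by (metis quotient_of_denom_pos quotient_of_div surj_pair)
    have "of_int (D * b) * y \<in> \<int>" if "y \<in> insert x S" for y
    proof (cases "y = x")
      case True
      then have "of_int (D * b) * y = of_int (D * a)" using ab by simp
      then show ?thesis by (metis Ints_of_int)
    next
      case False
      then have "of_int b * (of_int D * y) \<in> \<int>" using Ints_mult[OF Ints_of_int D(2)[of y]] that False by auto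
      moreover have "of_int (D * b) * y = of_int b * (of_int D * y)" by simp
      ultimately show ?thesis by metis
    qed
    then show ?case using D(1) ab(1) by (intro exI[of _ "D * b"]) auto
  qed
  then show ?thesis using that by blast
qed

text \<open>In lowest terms \<open>r = a / b\<close>, every power of \<open>b\<close> divides
  \<open>C\<close>, and a nonzero integer has no divisors of unbounded size.\<close>

lemma Ints_if_powers_bounded_denominator:
  fixes r :: rat and C :: int
  assumes "C \<noteq> 0" "\<And>j. of_int C * r ^ j \<in> \<int>"
  shows "r \<in> \<int>"
proof -
  obtain a b :: int where ab: "b > 0" "r = of_int a / of_int b" "coprime a b"
    by (metis quotient_of_denom_pos quotient_of_div quotient_of_coprime surj_pair)
  have dvd: "b ^ j dvd C" for j
  proof -
    obtain z :: int where z: "of_int C * r ^ j = of_int z" using assms(2) Ints_cases by metis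
    have "of_int (C * a ^ j) = (of_int (z * b ^ j) :: rat)"
      using z ab by (simp add: field_simps power_divide)
    then have "C * a ^ j = z * b ^ j" by (simp only: of_int_eq_iff)
    then have "b ^ j dvd C * a ^ j" by simp
    moreover have "coprime (b ^ j) (a ^ j)" using ab(3) by (simp add: coprime_commute)
    ultimately show ?thesis using coprime_dvd_mult_left_iff by blast
  qed
  have "b = 1"
  proof (rule ccontr)
    assume "b \<noteq> 1"
    then have b2: "b \<ge> 2" using ab(1) by simp
    have "\<bar>C\<bar> < 2 ^ nat \<bar>C\<bar>" using less_exp[of "nat \<bar>C\<bar>"]
      by (metis abs_ge_zero int_nat_eq of_nat_less_iff of_nat_numeral of_nat_power)
    also have "\<dots> \<le> b ^ nat \<bar>C\<bar>" using b2 by (intro power_mono) auto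
    also have "\<dots> \<le> \<bar>C\<bar>" using dvd[of "nat \<bar>C\<bar>"] assms(1) dvd_imp_le_int[of C "b ^ nat \<bar>C\<bar>"] b2 by simp
    finally show False by simp
  qed
  then show ?thesis using ab by simp
qed

lemma det_Ints:
  fixes A :: "rat mat"
  assumes "A \<in> carrier_mat n n" "\<And>i j. i < n \<Longrightarrow> j < n \<Longrightarrow> A $$ (i, j) \<in> \<int>"
  shows "det A \<in> \<int>"
proof -
  have "(signof p :: rat) * (\<Prod>i = 0..<n. A $$ (i, p i)) \<in> \<int>" if "p permutes {0..<n}" for p
  proof (intro Ints_mult Ints_prod)
    show "(signof p :: rat) \<in> \<int>" by (cases p rule: sign_cases) auto
    show "A $$ (i, p i) \<in> \<int>" if "i \<in> {0..<n}" for i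
      using assms(2) that \<open>p permutes {0..<n}\<close> permutes_in_image[of p "{0..<n}" i] by auto
  qed
  then show ?thesis unfolding det_def'[OF assms(1)] by (intro Ints_sum) auto
qed

text \<open>The induction for the second highest coefficient needs the highest one and the vanishing
  above it. The guard excludes \<open>n = 0\<close>, where \<open>n - 1\<close> is
  truncated.\<close>

lemma coeff_prod_linear_factors:
  fixes a :: "nat \<Rightarrow> 'b::comm_ring_1"
  shows "coeff (\<Prod>i<n. [:- a i, 1:]) n = 1 \<and> (\<forall>k>n. coeff (\<Prod>i<n. [:- a i, 1:]) k = 0) \<and>
    (0 < n \<longrightarrow> coeff (\<Prod>i<n. [:- a i, 1:]) (n - 1) = - (\<Sum>i<n. a i))"
proof (induction n)
  case 0
  show ?case by simp
next
  case (Suc n)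
  let ?P = "\<Prod>i<n. [:- a i, 1:]"
  have step: "coeff (?P * [:- a n, 1:]) (Suc k) = - a n * coeff ?P (Suc k) + coeff ?P k" for k
    by (simp add: mult.commute[of ?P])
  have "coeff (?P * [:- a n, 1:]) n = - (\<Sum>i<n. a i) - a n"
  proof (cases n)
    case 0
    then show ?thesis by simp
  next
    case (Suc k)
    then show ?thesis using step[of k] Suc.IH by simp
  qed
  moreover have "coeff (?P * [:- a n, 1:]) k = 0" if "k > Suc n" for k
    using step[of "k - 1"] Suc.IH that by simp
  moreover have "coeff (?P * [:- a n, 1:]) (Suc n) = 1" using step[of n] Suc.IH by simp
  ultimately show ?case by simp
qed

text \<open>In the Leibniz expansion a permutation other than the identity moves at least two
  indices, so its product contains at most \<open>n - 2\<close> diagonal entries and has degree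
  below \<open>n - 1\<close>.\<close>

lemma coeff_char_poly_trace:
  fixes A :: "rat mat"
  assumes A: "A \<in> carrier_mat n n" and n: "0 < n"
  shows "coeff (char_poly A) (n - 1) = - (\<Sum>i<n. A $$ (i, i))"
proof -
  let ?B = "char_poly_matrix A"
  have B: "?B \<in> carrier_mat n n" using A by simp
  have entry: "?B $$ (i, j) = (if i = j then [:- A $$ (i, j), 1:] else [:- A $$ (i, j):])"
    if "i < n" "j < n" for i j
    using A that unfolding char_poly_matrix_def by auto
  let ?t = "\<lambda>p. signof p * (\<Prod>i = 0..<n. ?B $$ (i, p i))"
  have zero: "coeff (?t p) (n - 1) = 0" if p: "p permutes {0..<n}" "p \<noteq> id" for p
  proof -
    obtain i where pi: "p i \<noteq> i" using p(2) by (auto simp: fun_eq_iff)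
    have i: "i < n" using p(1) pi by (metis atLeastLessThan_iff permutes_def zero_le)
    have pin: "p i < n" using p(1) i permutes_in_image[of p "{0..<n}" i] by simp
    have ppi: "p (p i) \<noteq> p i" using p(1) pi by (metis permutes_inj injD)
    have "degree (\<Prod>k = 0..<n. ?B $$ (k, p k)) \<le> (\<Sum>k = 0..<n. degree (?B $$ (k, p k)))"
      using degree_prod_sum_le[of "{0..<n}" "\<lambda>k. ?B $$ (k, p k)"] by (simp add: o_def)
    also have "\<dots> \<le> (\<Sum>k = 0..<n. if k \<noteq> i \<and> k \<noteq> p i then 1 else 0)"
    proof (rule sum_mono)
      fix k assume k: "k \<in> {0..<n}"
      have "p k < n" using k p(1) permutes_in_image[of p "{0..<n}" k] by simp
      then show "degree (?B $$ (k, p k)) \<le> (if k \<noteq> i \<and> k \<noteq> p i then 1 else 0)"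
        using entry[of k "p k"] k pi ppi by auto
    qed
    also have "\<dots> = card ({0..<n} - {i, p i})"
      by (simp add: sum.If_cases Int_def set_diff_eq)
    also have "\<dots> = n - 2" using i pin pi by (simp add: card_Diff_subset)
    also have "\<dots> < n - 1" using i pin pi by linarith
    finally have "degree (?t p) < n - 1" by simp
    then show ?thesis by (rule coeff_eq_0)
  qed
  have "char_poly A = (\<Sum>p | p permutes {0..<n}. ?t p)"
    unfolding char_poly_def by (rule det_def'[OF B])
  then have "coeff (char_poly A) (n - 1) = (\<Sum>p | p permutes {0..<n}. coeff (?t p) (n - 1))"
    by (simp add: coeff_sum)
  also have "\<dots> = (\<Sum>p\<in>{id}. coeff (?t p) (n - 1))"
    using zero by (intro sum.mono_neutral_right) (auto simp: finite_permutations permutes_id)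
  also have "\<dots> = coeff (\<Prod>i<n. [:- A $$ (i, i), 1:]) (n - 1)"
    using entry by (simp add: atLeast0LessThan)
  finally show ?thesis using coeff_prod_linear_factors[of "\<lambda>i. A $$ (i, i)" n] n by simp
qed

text \<open>A coefficient is a fixed rational combination of the values at \<open>0, \<dots>, n\<close>, by Lagrange interpolation.\<close>

lemma coeff_from_values:
  obtains l :: "nat \<Rightarrow> rat" where
    "\<And>q :: rat poly. degree q \<le> n \<Longrightarrow> coeff q k = (\<Sum>i\<le>n. l i * poly q (of_nat i))"
proof -
  define L :: "nat \<Rightarrow> rat poly" where
    "L i = (\<Prod>j\<in>{..n} - {i}. Polynomial.smult (1 / (of_nat i - of_nat j)) [:- of_nat j, 1:])" for i
  have L: "poly (L i) (of_nat j) = (if i = j then 1 else 0)" if "i \<le> n" "j \<le> n" for i j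
  proof (cases "i = j")
    case True
    have "poly (L i) (of_nat i) = (\<Prod>j\<in>{..n} - {i}. 1)"
      unfolding L_def poly_prod by (rule prod.cong) (auto simp: diff_divide_distrib[symmetric])
    then show ?thesis using True by simp
  next
    case False
    have "poly (L i) (of_nat j) = 0"
      unfolding L_def poly_prod using False that by (intro prod_zero) auto
    then show ?thesis using False by simp
  qed
  have degL: "degree (L i) \<le> n" if "i \<le> n" for i
  proof -
    have "degree (L i) \<le> (\<Sum>j\<in>{..n} - {i}. 1)"
      unfolding L_def
      by (rule order_trans[OF degree_prod_sum_le]) (auto intro!: sum_mono simp: degree_smult_le)
    then show ?thesis using that by simp
  qed
  have "coeff q k = (\<Sum>i\<le>n. coeff (L i) k * poly q (of_nat i))" if q: "degree q \<le> n" for q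
  proof -
    define r where "r = q - (\<Sum>i\<le>n. Polynomial.smult (poly q (of_nat i)) (L i))"
    have "poly r (of_nat j) = 0" if "j \<le> n" for j
    proof -
      have "(\<Sum>i\<le>n. poly q (of_nat i) * poly (L i) (of_nat j)) =
          (\<Sum>i\<le>n. if i = j then poly q (of_nat j) else 0)"
        using L that by (intro sum.cong) auto
      then show ?thesis using that by (simp add: r_def poly_sum)
    qed
    then have sub: "of_nat ` {..n} \<subseteq> {x. poly r x = 0}" by auto
    have deg: "degree r \<le> n"
      unfolding r_def using q degL
      by (intro degree_diff_le degree_sum_le) (auto intro: order_trans[OF degree_smult_le])
    have "r = 0"
    proof (rule ccontr)
      assume r: "r \<noteq> 0"
      have "card (of_nat ` {..n} :: rat set) \<le> degree r"
        using card_mono[OF poly_roots_finite[OF r] sub] card_poly_roots_bound[OF r] by linarith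
      moreover have "card (of_nat ` {..n} :: rat set) = Suc n"
        by (subst card_image) (auto simp: inj_on_def)
      ultimately show False using deg by simp
    qed
    then have "q = (\<Sum>i\<le>n. Polynomial.smult (poly q (of_nat i)) (L i))" unfolding r_def by simp
    then have "coeff q k = coeff (\<Sum>i\<le>n. Polynomial.smult (poly q (of_nat i)) (L i)) k" by simp
    also have "\<dots> = (\<Sum>i\<le>n. coeff (L i) k * poly q (of_nat i))"
      by (simp add: coeff_sum mult.commute)
    finally show ?thesis .
  qed
  then show ?thesis by (rule that)
qed

text \<open>The trace is, up to sign, a coefficient of the characteristic polynomial, hence a
  combination of its values \<open>det (t - A)\<close> at \<open>t = 0, ..., n\<close>, with
  interpolation weights depending on \<open>n\<close> alone. \<open>D\<close> clears those weights.
  Integrality of determinants thus bounds the denominators of traces without integrality of the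
  characteristic polynomial.\<close>

lemma trace_denominator:
  fixes n :: nat
  obtains D :: int where "D > 0"
    "\<And>A :: rat mat. A \<in> carrier_mat n n \<Longrightarrow> (\<And>t::nat. det (- char_matrix A (of_nat t)) \<in> \<int>) \<Longrightarrow>
      of_int D * (\<Sum>i<n. A $$ (i, i)) \<in> \<int>"
proof -
  obtain l :: "nat \<Rightarrow> rat" where l:
    "\<And>q :: rat poly. degree q \<le> n \<Longrightarrow> coeff q (n - 1) = (\<Sum>i\<le>n. l i * poly q (of_nat i))"
    using coeff_from_values by blast
  obtain D :: int where D: "D > 0" "\<And>x. x \<in> l ` {..n} \<Longrightarrow> of_int D * x \<in> \<int>"
    using common_denominator[of "l ` {..n}"] by auto
  have "of_int D * (\<Sum>i<n. A $$ (i, i)) \<in> \<int>"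
    if A: "A \<in> carrier_mat n n" and det: "\<And>t::nat. det (- char_matrix A (of_nat t)) \<in> \<int>" for A :: "rat mat"
  proof (cases "n = 0")
    case False
    have "(\<Sum>i<n. A $$ (i, i)) = - (\<Sum>i\<le>n. l i * poly (char_poly A) (of_nat i))"
      using coeff_char_poly_trace[OF A] l[of "char_poly A"] degree_monic_char_poly[OF A] False by simp
    then have "of_int D * (\<Sum>i<n. A $$ (i, i)) = - (\<Sum>i\<le>n. (of_int D * l i) * poly (char_poly A) (of_nat i))"
      by (simp add: sum_distrib_left mult_ac)
    also have "\<dots> \<in> \<int>"
      by (intro Ints_minus Ints_sum Ints_mult[OF D(2)]) (use det char_poly_matrix[OF A] in auto)
    finally show ?thesis .
  qed simp
  then show ?thesis using that D(1) by blast
qed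

lemma is_subring_add_group:
  assumes "is_subring W"
  shows "add_group W"
  unfolding add_group_def
proof (intro conjI ballI)
  show "0 \<in> W" using assms unfolding is_subring_def by blast
  fix x y assume "x \<in> W" "y \<in> W"
  then have "x + - y \<in> W" using assms unfolding is_subring_def by blast
  then show "x - y \<in> W" by simp
qed

lemma is_subring_coeffs_in_mult:
  assumes "is_subring W" "q \<in> coeffs_in W" "r \<in> coeffs_in W"
  shows "q * r \<in> coeffs_in W"
  by (rule coeffs_in_mult[OF _ _ _ assms(2,3)]) (use assms(1) in \<open>auto simp: is_subring_def\<close>)

subsection \<open>Lattices in a number field\<close>

text \<open>A constant, since simplification would rewrite a \<open>\<lambda>\<close>-term inside the interpretation.\<close>

definition rat_scale :: "rat \<Rightarrow> 'a::field_char_0 \<Rightarrow> 'a" where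
  "rat_scale c x = of_rat c * x"

interpretation Q: vector_space rat_scale
  by unfold_locales (auto simp: rat_scale_def algebra_simps of_rat_add of_rat_mult)

text \<open>The span is a number field given by a rational basis, so that denominators can be read
  off coordinates.\<close>

locale field_basis =
  fixes Bs :: "'a::field_char_0 set"
  assumes indep: "\<not> Q.dependent Bs"
    and fin: "finite Bs"
    and mult_span: "x \<in> Q.span Bs \<Longrightarrow> y \<in> Q.span Bs \<Longrightarrow> x * y \<in> Q.span Bs"
    and one_span: "1 \<in> Q.span Bs"
    and inverse_span: "x \<in> Q.span Bs \<Longrightarrow> inverse x \<in> Q.span Bs"
begin

abbreviation "K \<equiv> Q.span Bs"
abbreviation "rep \<equiv> Q.representation Bs"

text \<open>For nonzero \<open>C\<close> this is the lattice of integer combinations of the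
  \<open>b / C\<close> with \<open>b\<close> in \<open>Bs\<close>.\<close>

definition lat :: "int \<Rightarrow> 'a set" where
  "lat C = {x \<in> K. \<forall>b. of_int C * rep x b \<in> \<int>}"

text \<open>The algebraic integers of \<open>K\<close>, recognised by a common denominator for all
  their powers. In this form closure under sums follows from the binomial formula, and no minimal
  polynomials occur.\<close>

definition bdd_powers :: "'a set" where
  "bdd_powers = {x. \<exists>C>0. \<forall>k. x ^ k \<in> lat C}"

lemma sum_rep: "x \<in> K \<Longrightarrow> (\<Sum>b\<in>Bs. of_rat (rep x b) * b) = x"
  using Q.sum_representation_eq[OF indep _ fin] by (simp add: rat_scale_def)

lemma rat_mult_in_K: "x \<in> K \<Longrightarrow> of_rat c * x \<in> K"
  using Q.span_scale[of x Bs c] by (simp add: rat_scale_def)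

lemma rep_sum_scaled:
  assumes "\<And>i. i \<in> I \<Longrightarrow> v i \<in> K"
  shows "rep (\<Sum>i\<in>I. of_rat (c i) * v i) b = (\<Sum>i\<in>I. c i * rep (v i) b)"
  unfolding rat_scale_def[symmetric]
  using assms by (simp add: Q.representation_sum[OF indep] Q.span_scale Q.representation_scale[OF indep])

lemma power_in_K: "x \<in> K \<Longrightarrow> x ^ k \<in> K"
  by (induction k) (auto simp: one_span mult_span)

lemma lat_in_K: "x \<in> lat C \<Longrightarrow> x \<in> K"
  unfolding lat_def by blast

lemma lat_rep: "x \<in> lat C \<Longrightarrow> of_int C * rep x b \<in> \<int>"
  unfolding lat_def by blast

lemma add_group_lattice: "add_group (lat C)"
  unfolding add_group_def
proof (intro conjI ballI)
  show "0 \<in> lat C" by (simp add: lat_def Q.span_zero Q.representation_zero)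
  fix x y assume xy: "x \<in> lat C" "y \<in> lat C"
  have "of_int C * rep (x - y) b \<in> \<int>" for b
    using Ints_diff[OF lat_rep[OF xy(1), of b] lat_rep[OF xy(2), of b]]
    by (simp add: Q.representation_diff[OF indep lat_in_K[OF xy(2)] lat_in_K[OF xy(1)]] right_diff_distrib)
  then show "x - y \<in> lat C"
    using Q.span_diff[OF lat_in_K[OF xy(1)] lat_in_K[OF xy(2)]] unfolding lat_def by blast
qed

lemma lattice_mono:
  assumes "C dvd C'"
  shows "lat C \<subseteq> lat C'"
proof
  fix x assume x: "x \<in> lat C"
  obtain e where e: "C' = e * C" using assms by (metis dvdE mult.commute)
  have "of_int C' * rep x b \<in> \<int>" for b
  proof -
    have "of_int e * (of_int C * rep x b) \<in> \<int>"
      using Ints_mult[OF Ints_of_int lat_rep[OF x]] .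
    then show ?thesis by (simp add: e mult.assoc)
  qed
  then show "x \<in> lat C'" using lat_in_K[OF x] unfolding lat_def by blast
qed

lemma in_some_lattice:
  assumes "x \<in> K"
  obtains C where "C > 0" "x \<in> lat C"
proof -
  obtain C :: int where C: "C > 0" "\<And>r. r \<in> rep x ` Bs \<Longrightarrow> of_int C * r \<in> \<int>"
    using common_denominator[of "rep x ` Bs"] fin by auto
  have "of_int C * rep x b \<in> \<int>" for b
    using C(2)[of "rep x b"] Q.representation_ne_zero[of Bs x b] by (cases "rep x b = 0") auto
  then have "x \<in> lat C" using assms unfolding lat_def by blast
  then show ?thesis using that C(1) by blast
qed

lemma finite_in_some_lattice:
  assumes "finite W" "W \<subseteq> K"
  obtains C where "C > 0" "W \<subseteq> lat C"
proof -
  have "\<exists>C>0. W \<subseteq> lat C"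
    using assms
  proof (induction W)
    case empty
    show ?case by (intro exI[of _ 1]) auto
  next
    case (insert x W)
    obtain C where C: "C > 0" "W \<subseteq> lat C" using insert by auto
    obtain D where D: "D > 0" "x \<in> lat D" using in_some_lattice[of x] insert.prems by auto
    have "insert x W \<subseteq> lat (C * D)"
      using C D lattice_mono[of C "C * D"] lattice_mono[of D "C * D"] by auto
    then show ?case using C D by (intro exI[of _ "C * D"]) auto
  qed
  then show ?thesis using that by auto
qed

text \<open>\<open>N\<close> clears the denominators of the structure constants, the coordinates of
  the products of basis elements.\<close>

lemma lattice_mult:
  obtains N where "N > 0"
    "\<And>C D x y. x \<in> lat C \<Longrightarrow> y \<in> lat D \<Longrightarrow> x * y \<in> lat (C * D * N)"
proof -
  let ?P = "(\<lambda>(b, b'). b * b') ` (Bs \<times> Bs)"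
  have basis_mult: "b * b' \<in> K" if "b \<in> Bs" "b' \<in> Bs" for b b'
    by (intro mult_span Q.span_base that)
  then have "?P \<subseteq> K" by auto
  then obtain N where N: "N > 0" "?P \<subseteq> lat N" using finite_in_some_lattice[of ?P] fin by auto
  have "x * y \<in> lat (C * D * N)" if x: "x \<in> lat C" and y: "y \<in> lat D" for C D x y
  proof -
    have K: "x \<in> K" "y \<in> K" using x y lat_in_K by auto
    have "x * y = (\<Sum>b\<in>Bs. of_rat (rep x b) * b) * (\<Sum>b\<in>Bs. of_rat (rep y b) * b)"
      using K by (simp add: sum_rep)
    also have "\<dots> = (\<Sum>p\<in>Bs \<times> Bs. of_rat (rep x (fst p) * rep y (snd p)) * (fst p * snd p))"
      by (simp add: sum_product sum.cartesian_product case_prod_unfold of_rat_mult mult_ac)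
    finally have xy: "x * y = (\<Sum>p\<in>Bs \<times> Bs. of_rat (rep x (fst p) * rep y (snd p)) * (fst p * snd p))" .
    have "rep (x * y) c = (\<Sum>p\<in>Bs \<times> Bs. rep x (fst p) * rep y (snd p) * rep (fst p * snd p) c)" for c
      unfolding xy by (rule rep_sum_scaled) (use basis_mult in force)
    then have "of_int (C * D * N) * rep (x * y) c =
        (\<Sum>p\<in>Bs \<times> Bs. (of_int C * rep x (fst p)) * (of_int D * rep y (snd p)) * (of_int N * rep (fst p * snd p) c))" for c
      by (simp add: sum_distrib_left mult_ac)
    also have "\<dots>c \<in> \<int>" for c
    proof (intro Ints_sum)
      fix p assume p: "p \<in> Bs \<times> Bs"
      have "fst p * snd p \<in> lat N" using p N(2) by force
      then show "(of_int C * rep x (fst p)) * (of_int D * rep y (snd p)) * (of_int N * rep (fst p * snd p) c) \<in> \<int>"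
        using Ints_mult[OF Ints_mult[OF lat_rep[OF x] lat_rep[OF y]] lat_rep] by blast
    qed
    finally show ?thesis using mult_span[OF K] unfolding lat_def by blast
  qed
  then show ?thesis using that N(1) by blast
qed

lemma bdd_powers_in_K:
  assumes "x \<in> bdd_powers"
  shows "x \<in> K"
proof -
  obtain C where "x ^ 1 \<in> lat C" using assms unfolding bdd_powers_def by blast
  then show ?thesis using lat_in_K by simp
qed

lemma is_subring_bdd_powers: "is_subring bdd_powers"
proof -
  obtain N where N: "N > 0"
    "\<And>C D x y. x \<in> lat C \<Longrightarrow> y \<in> lat D \<Longrightarrow> x * y \<in> lat (C * D * N)"
    using lattice_mult by blast
  obtain C1 where C1: "C1 > 0" "1 \<in> lat C1" using in_some_lattice[OF one_span] by auto
  have ints: "of_int z \<in> bdd_powers" for z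
  proof -
    have "of_int z ^ k \<in> lat C1" for k
      using add_group_of_int_mult[OF add_group_lattice C1(2), of "z ^ k"] by simp
    then show ?thesis using C1(1) unfolding bdd_powers_def by auto
  qed
  have add_mult: "x + y \<in> bdd_powers \<and> x * y \<in> bdd_powers"
    if xy: "x \<in> bdd_powers" "y \<in> bdd_powers" for x y
  proof -
    obtain C where C: "C > 0" "\<And>k. x ^ k \<in> lat C"
      using xy(1) unfolding bdd_powers_def by auto
    obtain D where D: "D > 0" "\<And>k. y ^ k \<in> lat D"
      using xy(2) unfolding bdd_powers_def by auto
    have "(x * y) ^ k \<in> lat (C * D * N)" for k
      using N(2)[OF C(2)[of k] D(2)[of k]] by (simp add: power_mult_distrib)
    moreover have "(x + y) ^ k \<in> lat (C * D * N)" for k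
    proof -
      have "of_int (int (k choose i)) * (x ^ i * y ^ (k - i)) \<in> lat (C * D * N)" for i
        by (intro add_group_of_int_mult add_group_lattice N C D)
      then show ?thesis
        unfolding binomial_ring by (intro add_group_sum add_group_lattice) (simp add: mult.assoc)
    qed
    moreover have "C * D * N > 0" using C D N(1) by simp
    ultimately show ?thesis unfolding bdd_powers_def by blast
  qed
  moreover have "- x \<in> bdd_powers" if "x \<in> bdd_powers" for x
    using add_mult[OF ints[of "-1"] that] by simp
  ultimately show ?thesis using ints[of 0] ints[of 1] unfolding is_subring_def by simp
qed

lemma of_int_bdd_powers: "of_int z \<in> bdd_powers"
proof -
  have "1 \<in> bdd_powers" using is_subring_bdd_powers unfolding is_subring_def by blast
  then show ?thesis
    using add_group_of_int_mult[OF is_subring_add_group[OF is_subring_bdd_powers], of 1 z]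
    by simp
qed

text \<open>Each element has its own bound for its powers; here one lattice is found for all
  polynomial expressions in finitely many elements. Adjoining \<open>c\<close> to \<open>W\<close>
  keeps the bound uniform because the products \<open>w * c ^ k\<close> all lie in one lattice,
  whatever \<open>w\<close> and \<open>k\<close>.\<close>

lemma bounded_subring:
  assumes "finite F" "F \<subseteq> bdd_powers"
  obtains W C where "is_subring W" "F \<subseteq> W" "C > 0" "W \<subseteq> lat C"
proof -
  obtain N where N: "N > 0"
    "\<And>C D x y. x \<in> lat C \<Longrightarrow> y \<in> lat D \<Longrightarrow> x * y \<in> lat (C * D * N)"
    using lattice_mult by blast
  have "\<exists>W C. is_subring W \<and> F \<subseteq> W \<and> C > 0 \<and> W \<subseteq> lat C"
    using assms
  proof (induction F)
    case empty
    obtain C where C: "C > 0" "1 \<in> lat C" using in_some_lattice[OF one_span] by auto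
    have "\<int> \<subseteq> lat C"
      using add_group_of_int_mult[OF add_group_lattice C(2)] by (auto elim: Ints_cases)
    then show ?case using C by (intro exI[of _ "\<int>"] exI[of _ C]) (auto simp: is_subring_def)
  next
    case (insert c F)
    obtain W C where W: "is_subring W" "F \<subseteq> W" "C > 0" "W \<subseteq> lat C" using insert by auto
    obtain D where D: "D > 0" "\<And>k. c ^ k \<in> lat D"
      using insert.prems unfolding bdd_powers_def by auto
    let ?W = "{poly q c | q. q \<in> coeffs_in W}"
    have "is_subring ?W"
      unfolding is_subring_def
    proof (intro conjI ballI)
      note sub = add_groupD[OF add_group_coeffs_in(1)[OF is_subring_add_group[OF W(1)]]]
      show "0 \<in> ?W" using sub(1) by (auto intro!: exI[of _ 0])
      have "1 \<in> coeffs_in W" using W(1) by (auto simp: coeffs_in_def is_subring_def)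
      then show "1 \<in> ?W" by (auto intro!: exI[of _ 1])
      fix x y assume xy: "x \<in> ?W" "y \<in> ?W"
      then obtain q r where q: "x = poly q c" "q \<in> coeffs_in W" and r: "y = poly r c" "r \<in> coeffs_in W"
        by auto
      have "x + y = poly (q + r) c" "x * y = poly (q * r) c" using q r by auto
      then show "x + y \<in> ?W" "x * y \<in> ?W"
        using sub(4) is_subring_coeffs_in_mult[OF W(1)] q r by blast+
    next
      fix x assume "x \<in> ?W"
      then obtain q where q: "x = poly q c" "q \<in> coeffs_in W" by auto
      have "- q \<in> coeffs_in W"
        using q(2) W(1) by (auto simp: coeffs_in_def is_subring_def)
      then show "- x \<in> ?W" using q by (auto intro!: exI[of _ "- q"])
    qed
    moreover have "insert c F \<subseteq> ?W"
    proof -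
      have "c = poly [:0, 1:] c" "[:0, 1:] \<in> coeffs_in W"
        using W(1) by (auto simp: coeffs_in_def is_subring_def coeff_pCons split: nat.splits)
      moreover have "w = poly [:w:] c" "[:w:] \<in> coeffs_in W" if "w \<in> W" for w
        using W(1) that by (auto simp: coeffs_in_def is_subring_def coeff_pCons split: nat.splits)
      ultimately show ?thesis using W(2) by blast
    qed
    moreover have "?W \<subseteq> lat (C * D * N)"
    proof -
      have "poly q c \<in> lat (C * D * N)" if "q \<in> coeffs_in W" for q
        unfolding poly_altdef using that W(4) D(2)
        by (intro add_group_sum add_group_lattice N(2)) (auto simp: coeffs_in_def)
      then show ?thesis by auto
    qed
    ultimately show ?case using W(3) D(1) N(1)
      by (intro exI[of _ ?W] exI[of _ "C * D * N"]) auto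
  qed
  then show ?thesis using that by blast
qed

text \<open>Reducing \<open>x ^ k\<close> modulo \<open>f\<close> writes every power of
  \<open>x\<close> through finitely many powers, with coefficients in a subring \<open>W\<close>
  that lies in one lattice.\<close>

lemma bdd_powers_integrally_closed:
  assumes "lead_coeff f = 1" "f \<in> coeffs_in bdd_powers" "poly f x = 0" "x \<in> K"
  shows "x \<in> bdd_powers"
proof -
  have "coeff f ` {..degree f} \<subseteq> bdd_powers" using assms(2) by (auto simp: coeffs_in_def)
  then obtain W C where W: "is_subring W" "coeff f ` {..degree f} \<subseteq> W" "C > 0" "W \<subseteq> lat C"
    using bounded_subring[of "coeff f ` {..degree f}"] by auto
  have fW: "coeff f i \<in> W" for i
    using W(1,2) by (cases "i \<le> degree f") (auto simp: coeff_eq_0 is_subring_def)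
  have deg: "degree f \<noteq> 0"
  proof
    assume "degree f = 0"
    then have "f = 1" using assms(1) by (auto elim!: degree_eq_zeroE)
    then show False using assms(3) by simp
  qed
  obtain D where D: "D > 0" "(\<lambda>i. x ^ i) ` {..degree f} \<subseteq> lat D"
    using finite_in_some_lattice[of "(\<lambda>i. x ^ i) ` {..degree f}"] power_in_K[OF assms(4)] by auto
  obtain N where N: "N > 0"
    "\<And>C D x y. x \<in> lat C \<Longrightarrow> y \<in> lat D \<Longrightarrow> x * y \<in> lat (C * D * N)"
    using lattice_mult by blast
  have "x ^ k \<in> lat (C * D * N)" for k
  proof -
    define q where "q = monom 1 k mod f"
    have "q \<in> coeffs_in W"
      unfolding q_def
      by (rule conjunct2[OF coeffs_in_div_mod[OF assms(1) is_subring_add_group[OF W(1)]]])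
        (use W(1) fW in \<open>auto simp: coeffs_in_def is_subring_def\<close>)
    moreover have "degree q \<le> degree f"
      unfolding q_def using degree_mod_less[of f "monom 1 k"] deg by (metis degree_0 less_or_eq_imp_le zero_le)
    ultimately have "poly q x \<in> lat (C * D * N)"
      unfolding poly_altdef using W(4) D(2)
      by (intro add_group_sum add_group_lattice N(2)) (auto simp: coeffs_in_def)
    moreover have "poly q x = x ^ k"
      unfolding q_def using poly_mod_root[OF assms(3)] by (simp add: poly_monom)
    ultimately show ?thesis by simp
  qed
  then show ?thesis using W(3) D(1) N(1) unfolding bdd_powers_def
    by (intro CollectI conjI exI[of _ "C * D * N"]) simp_all
qed

section \<open>The trace of \<open>K\<close> over the rationals and a lattice containing all
  algebraic integers\<close>

definition tr :: "'a \<Rightarrow> rat" where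
  "tr x = (\<Sum>b\<in>Bs. rep (x * b) b)"

lemma mult_basis_in_K: "x \<in> K \<Longrightarrow> b \<in> Bs \<Longrightarrow> x * b \<in> K"
  by (rule mult_span[OF _ Q.span_base])

lemma tr_sum_scaled:
  assumes "\<And>i. i \<in> I \<Longrightarrow> v i \<in> K"
  shows "tr (\<Sum>i\<in>I. of_rat (c i) * v i) = (\<Sum>i\<in>I. c i * tr (v i))"
proof -
  have "rep ((\<Sum>i\<in>I. of_rat (c i) * v i) * b) b = (\<Sum>i\<in>I. c i * rep (v i * b) b)"
    if "b \<in> Bs" for b
    using rep_sum_scaled[of I "\<lambda>i. v i * b" c b] mult_basis_in_K[OF assms that]
    by (simp add: sum_distrib_right mult.assoc)
  then show ?thesis
    unfolding tr_def by (simp add: sum_distrib_left sum.swap[of _ I])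
qed

lemma tr_one: "tr 1 = of_nat (card Bs)"
proof -
  have "rep (1 * b) b = 1" if "b \<in> Bs" for b
    using Q.representation_basis[OF indep that] by simp
  then show ?thesis unfolding tr_def by simp
qed

lemma card_basis_pos: "card Bs > 0"
proof -
  have "Bs \<noteq> {}" using one_span by auto
  then show ?thesis using fin by (simp add: card_gt_0_iff)
qed

lemma basis_in_lat: "b \<in> Bs \<Longrightarrow> b \<in> lat 1"
  unfolding lat_def using Q.representation_basis[OF indep] by (auto simp: Q.span_base)

lemma basis_list:
  obtains bl n where "set bl = Bs" "distinct bl" "n = length bl" "bij_betw ((!) bl) {..<n} Bs"
proof -
  obtain bl where bl: "set bl = Bs" "distinct bl" using finite_distinct_list[OF fin] by auto
  then have "bij_betw ((!) bl) {..<length bl} Bs" by (intro bij_betw_nth) auto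
  then show ?thesis using that bl by blast
qed

text \<open>For \<open>x\<close> with bounded powers, \<open>det (M x) ^ k\<close> is the
  determinant of \<open>M (x ^ k)\<close>, whose entries share the denominator \<open>C * N\<close>;
  so all powers of the norm have a common denominator and the norm is an integer. Applied to
  \<open>t - x\<close> for natural numbers \<open>t\<close>, this controls the characteristic
  polynomial at enough points.\<close>

lemma tr_bdd_powers:
  obtains D :: int where "D > 0" "\<And>x. x \<in> bdd_powers \<Longrightarrow> of_int D * tr x \<in> \<int>"
proof -
  obtain bl n where bl: "set bl = Bs" "distinct bl" and n_def: "n = length bl"
    and bij: "bij_betw ((!) bl) {..<n} Bs" by (rule basis_list)
  have bi: "bl ! i \<in> Bs" if "i < n" for i using bij_betwE[OF bij] that by blast
  define M where "M x = mat n n (\<lambda>(i, j). rep (x * bl ! i) (bl ! j))" for x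
  have MC [simp]: "M x \<in> carrier_mat n n" for x unfolding M_def by simp
  have M_mult: "M (x * y) = M x * M y" if x: "x \<in> K" and y: "y \<in> K" for x y
  proof (rule eq_matI)
    fix i j assume ij: "i < dim_row (M x * M y)" "j < dim_col (M x * M y)"
    then have i: "i < n" and j: "j < n" by (auto simp: M_def)
    have "x * y * bl ! i = y * (\<Sum>b\<in>Bs. of_rat (rep (x * bl ! i) b) * b)"
      using sum_rep[OF mult_basis_in_K[OF x bi[OF i]]] by (simp add: mult_ac)
    also have "\<dots> = (\<Sum>b\<in>Bs. of_rat (rep (x * bl ! i) b) * (y * b))"
      by (simp add: sum_distrib_left mult_ac)
    finally have "rep (x * y * bl ! i) (bl ! j) = (\<Sum>b\<in>Bs. rep (x * bl ! i) b * rep (y * b) (bl ! j))"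
      using rep_sum_scaled[of Bs "\<lambda>b. y * b" "rep (x * bl ! i)"] mult_basis_in_K[OF y] by simp
    also have "\<dots> = (\<Sum>k<n. rep (x * bl ! i) (bl ! k) * rep (y * bl ! k) (bl ! j))"
      by (rule sum.reindex_bij_betw[OF bij, symmetric])
    also have "\<dots> = (M x * M y) $$ (i, j)"
      using i j by (simp add: M_def scalar_prod_def atLeast0LessThan)
    finally show "M (x * y) $$ (i, j) = (M x * M y) $$ (i, j)" using i j by (simp add: M_def)
  qed (auto simp: M_def)
  have M_one: "M 1 = 1\<^sub>m n"
  proof (rule eq_matI)
    fix i j assume "i < dim_row (1\<^sub>m n)" "j < dim_col (1\<^sub>m n)"
    then have ij: "i < n" "j < n" by auto
    then show "M 1 $$ (i, j) = 1\<^sub>m n $$ (i, j)"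
      using bl(2) by (auto simp: M_def Q.representation_basis[OF indep bi] nth_eq_iff_index_eq n_def)
  qed (auto simp: M_def)
  have det_pow: "det (M (x ^ k)) = det (M x) ^ k" if "x \<in> K" for x k
    by (induction k) (use that in \<open>simp_all add: M_one M_mult power_in_K det_mult[of _ n]\<close>)
  obtain N where N: "N > 0"
    "\<And>C D x y. x \<in> lat C \<Longrightarrow> y \<in> lat D \<Longrightarrow> x * y \<in> lat (C * D * N)"
    using lattice_mult by blast
  have det_int: "det (M x) \<in> \<int>" if x: "x \<in> bdd_powers" for x
  proof -
    obtain C where C: "C > 0" "\<And>k. x ^ k \<in> lat C" using x unfolding bdd_powers_def by auto
    have "of_int ((C * N) ^ n) * det (M x) ^ k \<in> \<int>" for k
    proof -
      have "(of_int (C * N) \<cdot>\<^sub>m M (x ^ k)) $$ (i, j) \<in> \<int>" if "i < n" "j < n" for i j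
      proof -
        have "x ^ k * bl ! i \<in> lat (C * 1 * N)"
          by (rule N(2)[OF C(2) basis_in_lat[OF bi[OF that(1)]]])
        from lat_rep[OF this, of "bl ! j"] show ?thesis using that by (simp add: M_def)
      qed
      then have "det (of_int (C * N) \<cdot>\<^sub>m M (x ^ k)) \<in> \<int>"
        by (intro det_Ints[of _ n]) auto
      moreover have "det (of_int (C * N) \<cdot>\<^sub>m M (x ^ k)) = of_int ((C * N) ^ n) * det (M x) ^ k"
        using det_pow[OF bdd_powers_in_K[OF x]] by (simp add: M_def)
      ultimately show ?thesis by simp
    qed
    moreover have "(C * N) ^ n \<noteq> 0" using C(1) N(1) by simp
    ultimately show ?thesis using Ints_if_powers_bounded_denominator by blast
  qed
  obtain D :: int where D: "D > 0"
    "\<And>A :: rat mat. A \<in> carrier_mat n n \<Longrightarrow> (\<And>t::nat. det (- char_matrix A (of_nat t)) \<in> \<int>) \<Longrightarrow>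
      of_int D * (\<Sum>i<n. A $$ (i, i)) \<in> \<int>"
    using trace_denominator[of n] by metis
  have "of_int D * tr x \<in> \<int>" if x: "x \<in> bdd_powers" for x
  proof -
    have xK: "x \<in> K" using x by (rule bdd_powers_in_K)
    have "det (- char_matrix (M x) (of_nat t)) \<in> \<int>" for t
    proof -
      have "- char_matrix (M x) (of_nat t) = M (of_nat t - x)"
      proof (rule eq_matI)
        fix i j assume "i < dim_row (M (of_nat t - x))" "j < dim_col (M (of_nat t - x))"
        then have i: "i < n" and j: "j < n" by (auto simp: M_def)
        have tb: "of_nat t * bl ! i = rat_scale (of_nat t) (bl ! i)" by (simp add: rat_scale_def)
        have "rep ((of_nat t - x) * bl ! i) (bl ! j) =
            of_nat t * rep (bl ! i) (bl ! j) - rep (x * bl ! i) (bl ! j)"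
          unfolding left_diff_distrib tb
          by (simp add: Q.representation_diff[OF indep mult_basis_in_K[OF xK bi[OF i]]]
              Q.representation_scale[OF indep] Q.span_scale Q.span_base bi[OF i])
        then show "(- char_matrix (M x) (of_nat t)) $$ (i, j) = M (of_nat t - x) $$ (i, j)"
          using i j bl(2)
          by (auto simp: M_def char_matrix_def Q.representation_basis[OF indep bi] nth_eq_iff_index_eq n_def)
      qed (auto simp: M_def char_matrix_def)
      moreover have "of_nat t - x \<in> bdd_powers"
        using add_groupD(2)[OF is_subring_add_group[OF is_subring_bdd_powers]
            of_int_bdd_powers[of "int t"] x] by simp
      ultimately show ?thesis using det_int by simp
    qed
    then have "of_int D * (\<Sum>i<n. M x $$ (i, i)) \<in> \<int>" by (intro D(2)) auto
    moreover have "(\<Sum>i<n. M x $$ (i, i)) = tr x"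
      unfolding tr_def using sum.reindex_bij_betw[OF bij, of "\<lambda>b. rep (x * b) b"] by (simp add: M_def)
    ultimately show ?thesis by simp
  qed
  then show ?thesis using that D(1) by blast
qed

text \<open>The trace form is nondegenerate because \<open>tr (y * inverse y)\<close> is the degree, which is nonzero
  in characteristic zero.\<close>

lemma lat_if_tr_integral:
  fixes D :: int
  assumes "D > 0"
  obtains N where "N > 0"
    "\<And>x. x \<in> K \<Longrightarrow> (\<And>b. b \<in> Bs \<Longrightarrow> of_int D * tr (x * b) \<in> \<int>) \<Longrightarrow> x \<in> lat N"
proof -
  obtain bl n where bl: "set bl = Bs" "distinct bl" and n_def: "n = length bl"
    and bij: "bij_betw ((!) bl) {..<n} Bs" by (rule basis_list)
  have bi: "bl ! i \<in> Bs" if "i < n" for i using bij_betwE[OF bij] that by blast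
  have expand: "(\<Sum>b\<in>Bs. of_rat (c b) * b) = (\<Sum>i<n. of_rat (c (bl ! i)) * bl ! i)" for c
    by (rule sum.reindex_bij_betw[OF bij, symmetric])
  \<comment> \<open>The Gram matrix of the trace form.\<close>
  define G where "G = mat n n (\<lambda>(i, j). tr (bl ! i * bl ! j))"
  have G: "G \<in> carrier_mat n n" unfolding G_def by simp
  have Gv: "(G *\<^sub>v v) $ i = tr (y * bl ! i)"
    if i: "i < n" and v: "v \<in> carrier_vec n" and y: "y = (\<Sum>j<n. of_rat (v $ j) * bl ! j)" for v i y
  proof -
    have "y * bl ! i = (\<Sum>j<n. of_rat (v $ j) * (bl ! i * bl ! j))"
      unfolding y by (simp add: sum_distrib_left mult_ac)
    then have "tr (y * bl ! i) = (\<Sum>j<n. v $ j * tr (bl ! i * bl ! j))"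
      using tr_sum_scaled[of "{..<n}" "\<lambda>j. bl ! i * bl ! j" "\<lambda>j. v $ j"]
        mult_basis_in_K[OF Q.span_base] bi i by simp
    then show ?thesis using i v by (simp add: G_def scalar_prod_def atLeast0LessThan mult.commute)
  qed
  have det: "det G \<noteq> 0"
  proof
    assume "det G = 0"
    then obtain v where v: "v \<in> carrier_vec n" "v \<noteq> 0\<^sub>v n" "G *\<^sub>v v = 0\<^sub>v n"
      using det_0_iff_vec_prod_zero_field[OF G] by auto
    define y where "y = (\<Sum>j<n. of_rat (v $ j) * bl ! j)"
    have yK: "y \<in> K"
      unfolding y_def by (intro Q.span_sum rat_mult_in_K Q.span_base) (simp add: bi)
    obtain i where i: "i < n" "v $ i \<noteq> 0" using v(1,2) by (metis carrier_vecD eq_vecI index_zero_vec)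
    have y0: "y \<noteq> 0"
    proof
      assume "y = 0"
      have "rep y (bl ! i) = (\<Sum>j<n. v $ j * rep (bl ! j) (bl ! i))"
        unfolding y_def by (rule rep_sum_scaled) (simp add: bi Q.span_base)
      also have "\<dots> = (\<Sum>j<n. if j = i then v $ i else 0)"
        using bl(2) i by (intro sum.cong)
          (auto simp: Q.representation_basis[OF indep bi] nth_eq_iff_index_eq n_def)
      finally show False using i \<open>y = 0\<close> by (simp add: Q.representation_zero)
    qed
    have zero: "tr (y * bl ! j) = 0" if "j < n" for j
      using Gv[OF that v(1) y_def] v(3) that by simp
    define z where "z = inverse y"
    have zK: "z \<in> K" unfolding z_def by (rule inverse_span[OF yK])
    have "y * z = y * (\<Sum>j<n. of_rat (rep z (bl ! j)) * bl ! j)"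
      using sum_rep[OF zK] expand[of "rep z"] by simp
    also have "\<dots> = (\<Sum>j<n. of_rat (rep z (bl ! j)) * (y * bl ! j))"
      by (simp add: sum_distrib_left mult_ac)
    finally have "y * z = (\<Sum>j<n. of_rat (rep z (bl ! j)) * (y * bl ! j))" .
    then have "tr (y * z) = 0"
      using tr_sum_scaled[of "{..<n}" "\<lambda>j. y * bl ! j"] mult_basis_in_K[OF yK bi] zero by simp
    then show False using tr_one card_basis_pos y0 by (simp add: z_def)
  qed
  \<comment> \<open>\<open>H / det G\<close> inverts \<open>G\<close>, so the coordinates of
    \<open>x\<close> are fixed rational combinations of the traces \<open>tr (x * b)\<close>;
    \<open>C\<close> clears the weights.\<close>
  define H where "H = adj_mat G"
  have H: "H \<in> carrier_mat n n" "H * G = det G \<cdot>\<^sub>m 1\<^sub>m n" using adj_mat[OF G] unfolding H_def by auto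
  obtain C :: int where C: "C > 0"
    "\<And>r. r \<in> (\<lambda>(i, j). H $$ (i, j) / det G) ` ({..<n} \<times> {..<n}) \<Longrightarrow> of_int C * r \<in> \<int>"
    using common_denominator[of "(\<lambda>(i, j). H $$ (i, j) / det G) ` ({..<n} \<times> {..<n})"] by auto
  have "x \<in> lat (C * D)"
    if x: "x \<in> K" and tr: "\<And>b. b \<in> Bs \<Longrightarrow> of_int D * tr (x * b) \<in> \<int>" for x
  proof -
    define v where "v = vec n (\<lambda>i. rep x (bl ! i))"
    have v: "v \<in> carrier_vec n" unfolding v_def by simp
    have xv: "x = (\<Sum>j<n. of_rat (v $ j) * bl ! j)"
      using sum_rep[OF x] expand[of "rep x"] by (simp add: v_def)
    have "of_int (C * D) * rep x (bl ! i) \<in> \<int>" if i: "i < n" for i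
    proof -
      have "H *\<^sub>v (G *\<^sub>v v) = (det G \<cdot>\<^sub>m 1\<^sub>m n) *\<^sub>v v"
        using H(2) assoc_mult_mat_vec[OF H(1) G v] by simp
      also have "\<dots> = det G \<cdot>\<^sub>v v"
        using v by (intro eq_vecI) (auto simp: smult_scalar_prod_distrib[of _ n])
      finally have "H *\<^sub>v (G *\<^sub>v v) = det G \<cdot>\<^sub>v v" .
      then have "det G * rep x (bl ! i) = (H *\<^sub>v (G *\<^sub>v v)) $ i" using i by (simp add: v_def)
      also have "\<dots> = (\<Sum>j<n. H $$ (i, j) * tr (x * bl ! j))"
        using i H(1) G Gv[OF _ v xv] by (simp add: scalar_prod_def atLeast0LessThan)
      finally have "rep x (bl ! i) = (\<Sum>j<n. H $$ (i, j) / det G * tr (x * bl ! j))"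
        using det by (simp add: sum_divide_distrib[symmetric] field_simps)
      then have "of_int (C * D) * rep x (bl ! i) =
          (\<Sum>j<n. (of_int C * (H $$ (i, j) / det G)) * (of_int D * tr (x * bl ! j)))"
        by (simp add: sum_distrib_left mult_ac)
      also have "\<dots> \<in> \<int>"
        using i by (intro Ints_sum Ints_mult[OF C(2) tr]) (auto simp: bi)
      finally show ?thesis .
    qed
    then have "of_int (C * D) * rep x b \<in> \<int>" for b
    proof (cases "b \<in> Bs")
      case True
      then obtain i where "i < n" "b = bl ! i" using bl unfolding n_def by (metis in_set_conv_nth)
      then show ?thesis using \<open>\<And>i. i < n \<Longrightarrow> of_int (C * D) * rep x (bl ! i) \<in> \<int>\<close> by blast
    next
      case False
      then have "rep x b = 0" using Q.representation_ne_zero[of Bs x b] by blast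
      then show ?thesis by simp
    qed
    then show ?thesis using x unfolding lat_def by blast
  qed
  moreover have "C * D > 0" using C(1) assms by simp
  ultimately show ?thesis using that by blast
qed

text \<open>The classical discriminant argument: if the multiples \<open>c b * b\<close> are
  integral, so are their products with an integral \<open>x\<close>, and all traces
  \<open>tr (x * b)\<close> have a common denominator \<open>E\<close>. The trace form then confines
  \<open>x\<close> to a lattice.\<close>

lemma bdd_powers_in_lat:
  assumes "\<And>b. b \<in> Bs \<Longrightarrow> \<exists>c::int. c \<noteq> 0 \<and> of_int c * b \<in> bdd_powers"
  obtains N where "N > 0" "bdd_powers \<subseteq> lat N"
proof -
  obtain c :: "'a \<Rightarrow> int" where c: "\<And>b. b \<in> Bs \<Longrightarrow> c b \<noteq> 0 \<and> of_int (c b) * b \<in> bdd_powers"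
    using assms by metis
  obtain D :: int where D: "D > 0" "\<And>x. x \<in> bdd_powers \<Longrightarrow> of_int D * tr x \<in> \<int>"
    using tr_bdd_powers by blast
  define E where "E = D * \<bar>\<Prod>b\<in>Bs. c b\<bar>"
  have E: "E > 0" using D(1) c fin by (auto simp: E_def)
  obtain N where N: "N > 0"
    "\<And>x. x \<in> K \<Longrightarrow> (\<And>b. b \<in> Bs \<Longrightarrow> of_int E * tr (x * b) \<in> \<int>) \<Longrightarrow> x \<in> lat N"
    using lat_if_tr_integral[OF E] by metis
  have "x \<in> lat N" if x: "x \<in> bdd_powers" for x
  proof (rule N(2)[OF bdd_powers_in_K[OF x]])
    fix b assume b: "b \<in> Bs"
    obtain e where e: "E = e * (D * c b)"
    proof -
      have "c b dvd \<bar>\<Prod>b\<in>Bs. c b\<bar>" using fin b by (simp add: dvd_prod_eqI)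
      then show ?thesis using that unfolding E_def by (metis dvd_def mult.commute mult.left_commute)
    qed
    have "x * (of_int (c b) * b) \<in> bdd_powers"
      using is_subring_bdd_powers x c[OF b] unfolding is_subring_def by blast
    then have "of_int e * (of_int D * tr (x * (of_int (c b) * b))) \<in> \<int>"
      using Ints_mult[OF Ints_of_int D(2)] by blast
    moreover have "tr (x * (of_int (c b) * b)) = of_int (c b) * tr (x * b)"
      using tr_sum_scaled[of "{b}" "\<lambda>b. x * b" "\<lambda>b. of_int (c b)"]
        mult_basis_in_K[OF bdd_powers_in_K[OF x] b] by (simp add: mult_ac)
    ultimately show "of_int E * tr (x * b) \<in> \<int>" by (simp add: e mult.assoc)
  qed
  then show ?thesis using that N(1) by blast
qed

end

subsection \<open>Ideals and local rings\<close>

text \<open>\<open>ideal_of\<close> speaks about subsets of a field; the argument also needs ideals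
  in the ring of polynomials over the normalization.\<close>

definition ring_ideal :: "'b::comm_ring_1 set \<Rightarrow> 'b set \<Rightarrow> bool" where
  "ring_ideal A J \<longleftrightarrow> J \<subseteq> A \<and> 0 \<in> J \<and> (\<forall>x\<in>J. \<forall>y\<in>J. x + y \<in> J) \<and> (\<forall>r\<in>A. \<forall>x\<in>J. r * x \<in> J)"

lemma ring_ideal_maximal:
  assumes "ring_ideal A J" "1 \<notin> J" "1 \<in> A"
  obtains P where "ring_ideal A P" "J \<subseteq> P" "1 \<notin> P"
    "\<And>J'. ring_ideal A J' \<Longrightarrow> P \<subseteq> J' \<Longrightarrow> 1 \<notin> J' \<Longrightarrow> J' = P"
proof -
  define \<A> where "\<A> = {P. ring_ideal A P \<and> J \<subseteq> P \<and> 1 \<notin> P}"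
  have "\<Union>C \<in> \<A>" if C: "C \<noteq> {}" "subset.chain \<A> C" for C
  proof -
    have id: "ring_ideal A P" "J \<subseteq> P" "1 \<notin> P" if "P \<in> C" for P
      using C(2) that unfolding subset.chain_def \<A>_def by auto
    have "ring_ideal A (\<Union>C)"
      unfolding ring_ideal_def
    proof (intro conjI ballI)
      show "\<Union>C \<subseteq> A" using id(1) unfolding ring_ideal_def by blast
      show "0 \<in> \<Union>C" using C(1) id(1) unfolding ring_ideal_def by blast
      fix r x assume "r \<in> A" "x \<in> \<Union>C"
      then show "r * x \<in> \<Union>C" using id(1) unfolding ring_ideal_def by blast
    next
      fix x y assume "x \<in> \<Union>C" "y \<in> \<Union>C"
      then obtain P P' where P: "P \<in> C" "x \<in> P" "P' \<in> C" "y \<in> P'" by blast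
      moreover have "P \<subseteq> P' \<or> P' \<subseteq> P" using C(2) P unfolding subset.chain_def by blast
      ultimately obtain P'' where "P'' \<in> C" "x \<in> P''" "y \<in> P''" by blast
      then show "x + y \<in> \<Union>C" using id(1) unfolding ring_ideal_def by blast
    qed
    moreover have "J \<subseteq> \<Union>C" using C(1) id(2) by blast
    ultimately show ?thesis using id(3) unfolding \<A>_def by blast
  qed
  moreover have "J \<in> \<A>" using assms unfolding \<A>_def by blast
  ultimately obtain P where P: "P \<in> \<A>" "\<forall>X\<in>\<A>. P \<subseteq> X \<longrightarrow> X = P"
    using subset_Zorn_nonempty[of \<A>] by blast
  show ?thesis
  proof (rule that)
    show "ring_ideal A P" "J \<subseteq> P" "1 \<notin> P" using P(1) unfolding \<A>_def by auto
    fix J' assume "ring_ideal A J'" "P \<subseteq> J'" "1 \<notin> J'"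
    then have "J' \<in> \<A>" using P(1) unfolding \<A>_def by auto
    then show "J' = P" using P(2) \<open>P \<subseteq> J'\<close> by blast
  qed
qed

lemma ring_ideal_field: "ring_ideal R J \<longleftrightarrow> ideal_of R J"
  unfolding ring_ideal_def ideal_of_def by simp

lemma inverse_mem_if_not_in_maximal_ideal:
  assumes "is_subring R" "local_ring R" "maximal_ideal R m" "x \<in> R" "x \<notin> m"
  shows "inverse x \<in> R"
proof (rule ccontr)
  assume inv: "inverse x \<notin> R"
  define J where "J = (\<lambda>r. x * r) ` R"
  have one: "1 \<in> R" using assms(1) unfolding is_subring_def by blast
  have "ring_ideal R J"
    unfolding ring_ideal_def
  proof (intro conjI ballI)
    show "J \<subseteq> R" using assms(1,4) unfolding J_def is_subring_def by blast
    show "0 \<in> J"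
      using assms(1) unfolding J_def is_subring_def by (intro image_eqI[of _ _ 0]) auto
    fix a b assume "a \<in> J" "b \<in> J"
    then obtain c d where cd: "c \<in> R" "a = x * c" "d \<in> R" "b = x * d" unfolding J_def by blast
    then have "c + d \<in> R" using assms(1) unfolding is_subring_def by blast
    then show "a + b \<in> J" using cd unfolding J_def by (intro image_eqI[of _ _ "c + d"]) (simp_all add: distrib_left)
  next
    fix r a assume ra: "r \<in> R" "a \<in> J"
    then obtain c where c: "c \<in> R" "a = x * c" unfolding J_def by blast
    then have "r * c \<in> R" using assms(1) ra(1) unfolding is_subring_def by blast
    then show "r * a \<in> J" using c unfolding J_def by (intro image_eqI[of _ _ "r * c"]) (simp_all add: mult_ac)
  qed
  moreover have "1 \<notin> J"
  proof
    assume "1 \<in> J"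
    then obtain r where "r \<in> R" "x * r = 1" unfolding J_def by auto
    then have "inverse x = r" by (metis inverse_unique)
    then show False using inv \<open>r \<in> R\<close> by simp
  qed
  ultimately obtain P where P: "ring_ideal R P" "J \<subseteq> P" "1 \<notin> P"
    "\<And>J'. ring_ideal R J' \<Longrightarrow> P \<subseteq> J' \<Longrightarrow> 1 \<notin> J' \<Longrightarrow> J' = P"
    using ring_ideal_maximal[of R J] one by blast
  have full: "J' = R" if "ring_ideal R J'" "1 \<in> J'" for J'
    using that unfolding ring_ideal_def by (metis mult_1_right subsetI subset_antisym)
  have "maximal_ideal R P"
    unfolding maximal_ideal_def
  proof (intro conjI allI impI)
    show "ideal_of R P" using P(1) by (simp add: ring_ideal_field)
    show "P \<noteq> R" using P(3) one by blast
    fix J' assume "ideal_of R J' \<and> P \<subseteq> J'"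
    then show "J' = P \<or> J' = R" using P(4) full by (metis ring_ideal_field)
  qed
  then have "P = m" using assms(2,3) unfolding local_ring_def by blast
  moreover have "x \<in> J" using one unfolding J_def by force
  ultimately show False using P(2) assms(5) by blast
qed

lemma one_notin_maximal_ideal:
  assumes "maximal_ideal R m"
  shows "1 \<notin> m"
  using assms unfolding maximal_ideal_def ideal_of_def by (metis mult_1_right subsetI subset_antisym)

text \<open>Locality is recorded as invertibility outside \<open>m\<close>, the form in which it is
  applied. Residue characteristic zero is still allowed here.\<close>

locale local_subring =
  fixes R m :: "'a::field_char_0 set"
  assumes subring: "is_subring R"
    and ideal: "ideal_of R m"
    and one_notin: "1 \<notin> m"
    and inverse_in: "x \<in> R \<Longrightarrow> x \<notin> m \<Longrightarrow> inverse x \<in> R"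
begin

lemma R_zero: "0 \<in> R" and R_one: "1 \<in> R"
  and R_add: "x \<in> R \<Longrightarrow> y \<in> R \<Longrightarrow> x + y \<in> R"
  and R_mult: "x \<in> R \<Longrightarrow> y \<in> R \<Longrightarrow> x * y \<in> R"
  and R_minus: "x \<in> R \<Longrightarrow> - x \<in> R"
  using subring unfolding is_subring_def by blast+

lemma R_subgroup: "add_group R"
  by (rule is_subring_add_group[OF subring])

lemma R_power: "x \<in> R \<Longrightarrow> x ^ k \<in> R"
  by (induction k) (auto simp: R_one R_mult)

lemma R_of_int: "of_int z \<in> R"
  using add_group_of_int_mult[OF R_subgroup R_one, of z] by simp

lemma R_of_nat: "of_nat k \<in> R"
  using R_of_int[of "int k"] by simp

lemma m_in_R: "x \<in> m \<Longrightarrow> x \<in> R"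
  and m_zero: "0 \<in> m"
  and m_add: "x \<in> m \<Longrightarrow> y \<in> m \<Longrightarrow> x + y \<in> m"
  and m_mult: "r \<in> R \<Longrightarrow> x \<in> m \<Longrightarrow> r * x \<in> m"
  using ideal unfolding ideal_of_def by blast+

lemma m_subgroup: "add_group m"
  unfolding add_group_def
proof (intro conjI ballI)
  fix x y assume "x \<in> m" "y \<in> m"
  then have "x + (- 1) * y \<in> m" by (intro m_add m_mult R_minus R_one)
  then show "x - y \<in> m" by simp
qed (rule m_zero)

lemma not_in_m_if_inverse:
  assumes "x \<noteq> 0" "inverse x \<in> R"
  shows "x \<notin> m"
proof
  assume "x \<in> m"
  then have "inverse x * x \<in> m" using assms(2) by (rule m_mult[rotated])
  then show False using one_notin assms(1) by simp
qed

lemma not_in_m_mult: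
  assumes "x \<in> R" "x \<notin> m" "y \<in> R" "y \<notin> m"
  shows "x * y \<notin> m"
proof -
  have "x \<noteq> 0" "y \<noteq> 0" using assms m_zero by auto
  moreover have "inverse (x * y) \<in> R" using inverse_in assms by (simp add: R_mult)
  ultimately show ?thesis using not_in_m_if_inverse by simp
qed

end

locale local_number_ring = local_subring R m for R m :: "'a::field_char_0 set" +
  fixes p :: nat and B :: "'a set"
  assumes finite_B: "finite B"
    and R_in_span: "R \<subseteq> Q.span B"
    and prime_p: "prime p"
    and p_in_m: "of_nat p \<in> m"

text \<open>The least positive integer in \<open>m\<close> is prime, since a product lies in
  \<open>m\<close> only if a factor does.\<close>

lemma (in local_subring) residue_characteristic:
  assumes "0 < n" "of_nat n \<in> m"
  obtains p where "prime p" "of_nat p \<in> m"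
proof -
  define p where "p = (LEAST n. 0 < n \<and> (of_nat n :: 'a) \<in> m)"
  have p: "0 < p" "of_nat p \<in> m"
    using LeastI[of "\<lambda>n. 0 < n \<and> (of_nat n :: 'a) \<in> m" n] assms unfolding p_def by auto
  have least: "p \<le> k" if "0 < k" "of_nat k \<in> m" for k
    using that unfolding p_def by (intro Least_le) auto
  have "p \<noteq> 1" using p one_notin by auto
  have "prime p"
    unfolding prime_nat_iff
  proof (intro conjI allI impI)
    show "1 < p" using p(1) \<open>p \<noteq> 1\<close> by simp
    fix a assume "a dvd p"
    then obtain b where ab: "p = a * b" by auto
    then have "of_nat a * of_nat b \<in> m" using p(2) by simp
    then consider "of_nat a \<in> m" | "of_nat b \<in> m" using not_in_m_mult R_of_nat by blast
    then show "a = 1 \<or> a = p"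
    proof cases
      case 1
      then have "p \<le> a" using least p(1) ab by (intro least) auto
      then show ?thesis using ab p(1) by (metis dvd_imp_le \<open>a dvd p\<close> le_antisym)
    next
      case 2
      then have "p \<le> b" using p(1) ab by (intro least) auto
      then have "b = p" using ab p(1) by (metis dvd_imp_le dvd_triv_right le_antisym)
      then show ?thesis using ab p(1) by simp
    qed
  qed
  then show ?thesis using that p(2) by blast
qed

subsection \<open>Rational linear dependence\<close>

text \<open>Clearing denominators and dividing by the gcd keeps a rational relation nontrivial
  modulo \<open>p\<close>.\<close>

lemma primitive_scaling:
  fixes c :: "'i \<Rightarrow> rat" and p :: int
  assumes "finite I" "\<exists>i\<in>I. c i \<noteq> 0" "p > 1"
  obtains l d where "\<And>i. i \<in> I \<Longrightarrow> of_int (d i) = l * c i" "\<exists>i\<in>I. \<not> p dvd d i"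
proof -
  obtain D :: int where D: "D > 0" "\<And>x. x \<in> c ` I \<Longrightarrow> of_int D * x \<in> \<int>"
    using common_denominator[of "c ` I"] assms(1) by auto
  define e where "e i = \<lfloor>of_int D * c i\<rfloor>" for i
  have e: "of_int (e i) = of_int D * c i" if "i \<in> I" for i
    using D(2)[of "c i"] that unfolding e_def by auto
  define g where "g = Gcd (e ` I)"
  have g: "g \<noteq> 0"
  proof
    assume "g = 0"
    then have "\<forall>i\<in>I. e i = 0" unfolding g_def by auto
    then show False using e assms(2) D(1) by force
  qed
  define d where "d i = e i div g" for i
  have d: "e i = g * d i" if "i \<in> I" for i
    using that unfolding d_def g_def by simp
  have "\<exists>i\<in>I. \<not> p dvd d i"
  proof (rule ccontr)
    assume "\<not> (\<exists>i\<in>I. \<not> p dvd d i)"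
    then have "g * p dvd a" if "a \<in> e ` I" for a using d that by auto
    then have "g * p dvd g" unfolding g_def by (intro Gcd_greatest)
    then have "p dvd 1" using g by (metis dvd_mult_cancel_left mult.right_neutral)
    then show False using assms(3) by (simp add: zdvd1_eq)
  qed
  moreover have "of_int (d i) = of_int D / of_int g * c i" if "i \<in> I" for i
    using e[OF that] d[OF that] g by (simp add: field_simps)
  ultimately show ?thesis using that by blast
qed

lemma rat_dependent_family:
  fixes v :: "'i \<Rightarrow> 'a::field_char_0"
  assumes "finite B" "finite I" "card B < card I" "v ` I \<subseteq> Q.span B"
  obtains c where "\<exists>i\<in>I. c i \<noteq> 0" "(\<Sum>i\<in>I. of_rat (c i) * v i) = 0"
proof (cases "inj_on v I")
  case True
  have "Q.dependent (v ` I)"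
  proof (rule ccontr)
    assume "\<not> Q.dependent (v ` I)"
    then have "card (v ` I) \<le> card B" using Q.independent_span_bound[OF assms(1) _ assms(4)] by blast
    then show False using True assms(3) by (simp add: card_image)
  qed
  then obtain u where u: "\<exists>x\<in>v ` I. u x \<noteq> 0" "(\<Sum>x\<in>v ` I. rat_scale (u x) x) = 0"
    using Q.dependent_finite[of "v ` I"] assms(2) by auto
  have "(\<Sum>i\<in>I. of_rat (u (v i)) * v i) = 0"
    using u(2) by (simp add: sum.reindex[OF True] rat_scale_def)
  then show ?thesis using that[of "u \<circ> v"] u(1) by auto
next
  case False
  then obtain i j where ij: "i \<in> I" "j \<in> I" "i \<noteq> j" "v i = v j" unfolding inj_on_def by blast
  \<comment> \<open>\<open>Q.dependent\<close> concerns sets and does not see repetitions, so a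
    repeated vector gets the relation \<open>v i - v j = 0\<close>.\<close>
  let ?c = "\<lambda>k. if k = i then 1 else if k = j then - 1 else (0::rat)"
  have "(\<Sum>k\<in>I. of_rat (?c k) * v k) = (\<Sum>k\<in>{i, j}. of_rat (?c k) * v k)"
    using ij(1,2) assms(2) by (intro sum.mono_neutral_right) auto
  also have "\<dots> = 0" using ij(3,4) by simp
  finally have "(\<Sum>k\<in>I. of_rat (?c k) * v k) = 0" .
  moreover have "\<exists>k\<in>I. ?c k \<noteq> 0" using ij(1) by (intro bexI[of _ i]) auto
  ultimately show ?thesis using that[of ?c] by blast
qed

lemma integer_dependent_family:
  fixes v :: "'i \<Rightarrow> 'a::field_char_0" and p :: int
  assumes "finite B" "finite I" "card B < card I" "v ` I \<subseteq> Q.span B" "p > 1"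
  obtains d :: "'i \<Rightarrow> int" where "\<exists>i\<in>I. \<not> p dvd d i" "(\<Sum>i\<in>I. of_int (d i) * v i) = 0"
proof -
  obtain c where c: "\<exists>i\<in>I. c i \<noteq> 0" "(\<Sum>i\<in>I. of_rat (c i) * v i) = 0"
    by (rule rat_dependent_family[OF assms(1-4)]) (rule that)
  obtain l d where d: "\<And>i. i \<in> I \<Longrightarrow> of_int (d i) = l * c i" "\<exists>i\<in>I. \<not> p dvd d i"
    by (rule primitive_scaling[OF assms(2) c(1) assms(5)]) (rule that)
  have "of_int (d i) = (of_rat l * of_rat (c i) :: 'a)" if "i \<in> I" for i
    using d(1)[OF that] by (metis of_rat_mult of_rat_of_int_eq)
  then have "(\<Sum>i\<in>I. of_int (d i) * v i) = of_rat l * (\<Sum>i\<in>I. of_rat (c i) * v i)"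
    by (simp add: sum_distrib_left mult.assoc)
  then have "(\<Sum>i\<in>I. of_int (d i) * v i) = 0" using c(2) by simp
  with d(2) show ?thesis by (rule that)
qed

text \<open>\<open>M\<close> need not be finitely generated, as the integers localised at
  \<open>p\<close> show. A set independent in \<open>M / p M\<close> is rationally independent,
  because a rational relation could be scaled to one that is nontrivial modulo \<open>p\<close>.
  Hence its size is at most \<open>card B\<close>, and a maximal such set spans
  \<open>M / p M\<close>.\<close>

lemma fin_mod_prime_multiple:
  fixes M :: "'a::field_char_0 set" and p :: nat
  assumes "finite B" "add_group M" "M \<subseteq> Q.span B" "prime p"
  shows "fin_mod M ((\<lambda>x. of_nat p * x) ` M)"
proof -
  let ?pM = "(\<lambda>x. of_nat p * x) ` M"
  have p1: "int p > 1" using assms(4) prime_gt_1_nat by simp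
  have pM: "add_group ?pM" by (rule add_group_mult_image[OF assms(2)])
  define indep where "indep F \<longleftrightarrow> finite F \<and> F \<subseteq> M \<and>
    (\<forall>c::'a \<Rightarrow> int. (\<Sum>f\<in>F. of_int (c f) * f) \<in> ?pM \<longrightarrow> (\<forall>f\<in>F. int p dvd c f))" for F
  have bound: "card F \<le> card B" if F: "indep F" for F
  proof (rule ccontr)
    assume "\<not> card F \<le> card B"
    moreover have "id ` F \<subseteq> Q.span B" "finite F" using F assms(3) unfolding indep_def by auto
    ultimately obtain d :: "'a \<Rightarrow> int" where
      "\<exists>f\<in>F. \<not> int p dvd d f" "(\<Sum>f\<in>F. of_int (d f) * id f) = 0"
      using integer_dependent_family[OF assms(1), of F id "int p"] p1 by auto
    then show False using F add_groupD(1)[OF pM] unfolding indep_def by auto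
  qed
  have "indep {}" unfolding indep_def by simp
  then obtain F where F: "indep F" and max: "\<And>F'. indep F' \<Longrightarrow> card F' \<le> card F"
    using ex_has_greatest_nat[of indep "{}" card "Suc (card B)"] bound by (metis le_imp_less_Suc)
  have finF: "finite F" and FM: "F \<subseteq> M" using F unfolding indep_def by auto
  have comb: "(\<Sum>f\<in>F. of_int (c f) * f) \<in> M" for c
    using FM by (intro add_group_sum add_group_of_int_mult assms(2)) auto
  have span: "\<exists>e::'a \<Rightarrow> int. x - (\<Sum>f\<in>F. of_int (e f) * f) \<in> ?pM" if x: "x \<in> M" for x
  proof (cases "x \<in> F")
    case True
    have "(\<Sum>f\<in>F. of_int (if f = x then 1 else 0) * f) = (\<Sum>f\<in>F. if f = x then x else 0)"
      by (intro sum.cong) auto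
    also have "\<dots> = x" using True finF by simp
    finally show ?thesis using add_groupD(1)[OF pM] by (metis diff_self)
  next
    case False
    have "\<not> indep (insert x F)" using max[of "insert x F"] finF False by auto
    then obtain c :: "'a \<Rightarrow> int" where c: "(\<Sum>f\<in>insert x F. of_int (c f) * f) \<in> ?pM"
      "\<not> (\<forall>f\<in>insert x F. int p dvd c f)"
      using finF FM x unfolding indep_def by auto
    have cx: "of_int (c x) * x + (\<Sum>f\<in>F. of_int (c f) * f) \<in> ?pM" using c(1) finF False by simp
    have "\<not> int p dvd c x"
    proof
      assume "int p dvd c x"
      then obtain z where "c x = int p * z" by auto
      then have "of_int (c x) * x = of_nat p * (of_int z * x)" by simp
      then have "of_int (c x) * x \<in> ?pM" using add_group_of_int_mult[OF assms(2) x, of z] by blast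
      from add_groupD(2)[OF pM cx this] have "(\<Sum>f\<in>F. of_int (c f) * f) \<in> ?pM" by simp
      then have "\<forall>f\<in>F. int p dvd c f" using F unfolding indep_def by blast
      then show False using c(2) \<open>int p dvd c x\<close> by blast
    qed
    then have "coprime (c x) (int p)"
      using assms(4) prime_imp_coprime[of "int p" "c x"] by (simp add: coprime_commute)
    then obtain a b where ab: "a * c x + b * int p = 1" by (metis bezout_int coprime_imp_gcd_eq_1)
    have "of_int (a * c x + b * int p) * x = x" using ab by simp
    then have "x - (\<Sum>f\<in>F. of_int (- (a * c f)) * f) =
        of_int a * (of_int (c x) * x + (\<Sum>f\<in>F. of_int (c f) * f)) + of_nat p * (of_int b * x)"
      by (simp add: algebra_simps sum_distrib_left sum_negf)
    moreover have "of_int a * (of_int (c x) * x + (\<Sum>f\<in>F. of_int (c f) * f)) \<in> ?pM"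
      by (rule add_group_of_int_mult[OF pM cx])
    moreover have "of_nat p * (of_int b * x) \<in> ?pM"
      using add_group_of_int_mult[OF assms(2) x, of b] by blast
    ultimately have "x - (\<Sum>f\<in>F. of_int (- (a * c f)) * f) \<in> ?pM"
      by (simp only: add_groupD(4)[OF pM])
    then show ?thesis by (rule exI[of _ "\<lambda>f. - (a * c f)"])
  qed
  define reps where "reps = (\<lambda>e. \<Sum>f\<in>F. of_int (e f) * f) ` (F \<rightarrow>\<^sub>E {0..<int p})"
  have "finite reps" unfolding reps_def by (intro finite_imageI finite_PiE finF) auto
  moreover have "\<exists>r\<in>reps. x - r \<in> ?pM" if x: "x \<in> M" for x
  proof -
    obtain e :: "'a \<Rightarrow> int" where e: "x - (\<Sum>f\<in>F. of_int (e f) * f) \<in> ?pM" using span[OF x] by blast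
    define e' where "e' = restrict (\<lambda>f. e f mod int p) F"
    have "of_int (e f) * f - of_int (e' f) * f = of_nat p * (of_int (e f div int p) * f)" if "f \<in> F" for f
    proof -
      have "e f = e' f + int p * (e f div int p)" using that by (simp add: e'_def)
      then have "(of_int (e f) :: 'a) = of_int (e' f) + of_nat p * of_int (e f div int p)"
        by (metis of_int_add of_int_mult of_int_of_nat_eq)
      then show ?thesis by (simp add: algebra_simps)
    qed
    then have "(\<Sum>f\<in>F. of_int (e f) * f) - (\<Sum>f\<in>F. of_int (e' f) * f) =
        of_nat p * (\<Sum>f\<in>F. of_int (e f div int p) * f)"
      by (simp add: sum_subtractf[symmetric] sum_distrib_left)
    then have "(\<Sum>f\<in>F. of_int (e f) * f) - (\<Sum>f\<in>F. of_int (e' f) * f) \<in> ?pM"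
      using imageI[OF comb, of "\<lambda>x. of_nat p * x"] by simp
    from add_groupD(4)[OF pM e this]
    have "x - (\<Sum>f\<in>F. of_int (e' f) * f) \<in> ?pM" by simp
    moreover have "(\<Sum>f\<in>F. of_int (e' f) * f) \<in> reps"
      unfolding reps_def e'_def using p1 by (intro imageI) auto
    ultimately show ?thesis by blast
  qed
  ultimately show ?thesis unfolding fin_mod_def by blast
qed

subsection \<open>The conductor of the normalization\<close>

text \<open>Kronecker's argument: if \<open>c\<^sub>0 + c\<^sub>1 x + \<dots> + c\<^sub>N x^N = 0\<close> then multiplication by the tail
  \<open>c\<^sub>j + c\<^sub>j\<^sub>+\<^sub>1 x + \<dots>\<close> preserves the group generated by \<open>1, x, \<dots>, x^(N-1)\<close>.\<close>

lemma (in field_basis) relation_tail_bdd_powers: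
  assumes "x \<in> K" "(\<Sum>i\<le>N. of_int (c i) * x ^ i) = 0"
  shows "(\<Sum>i=j..N. of_int (c i) * x ^ (i - j)) \<in> bdd_powers"
proof (cases "1 \<le> j \<and> j \<le> N")
  case False
  \<comment> \<open>For \<open>j = 0\<close> the tail is the whole relation, and for
    \<open>j > N\<close> it is empty.\<close>
  then have "(\<Sum>i=j..N. of_int (c i) * x ^ (i - j)) = 0"
    using assms(2) by (cases "j = 0") (auto simp: atMost_atLeast0)
  then show ?thesis using of_int_bdd_powers[of 0] by simp
next
  case True
  then have j: "1 \<le> j" "j \<le> N" by auto
  define e where "e = (\<Sum>i=j..N. of_int (c i) * x ^ (i - j))"
  define W where "W = (\<lambda>q. poly q x) ` coeffs_lt N \<int>"
  have Z: "add_group (\<int> :: 'a set)" by (simp add: add_group_def)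
  have W: "add_group W"
    unfolding add_group_def
  proof (intro conjI ballI)
    note sub = add_groupD[OF add_group_coeffs_in(2)[OF Z, of N]]
    show "0 \<in> W" using sub(1) unfolding W_def by (intro image_eqI[of _ _ 0]) auto
    fix a b assume "a \<in> W" "b \<in> W"
    then obtain q r where "a = poly q x" "b = poly r x" "q \<in> coeffs_lt N \<int>" "r \<in> coeffs_lt N \<int>"
      unfolding W_def by auto
    then show "a - b \<in> W" using sub(2) unfolding W_def by (intro image_eqI[of _ _ "q - r"]) auto
  qed
  have pow: "x ^ i \<in> W" if "i < N" for i
    unfolding W_def using that
    by (intro image_eqI[of _ _ "monom 1 i"]) (auto simp: poly_monom coeffs_lt_def coeffs_in_def)
  have e_pow: "x ^ i * e \<in> W" if i: "i < N" for i
  proof (cases "i < j")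
    case True
    have "x ^ i * e = (\<Sum>l=j..N. of_int (c l) * x ^ (i + (l - j)))"
      unfolding e_def sum_distrib_left by (intro sum.cong refl) (simp only: power_add mult_ac)
    also have "\<dots> \<in> W"
      using True i j(2) by (intro add_group_sum[OF W] add_group_of_int_mult[OF W] pow) auto
    finally show ?thesis .
  next
    case False
    have "x ^ j * e = (\<Sum>l=j..N. of_int (c l) * x ^ l)"
      unfolding e_def sum_distrib_left
      by (intro sum.cong) (auto simp: mult.left_commute[of "x ^ j"] power_add[symmetric])
    moreover have "(\<Sum>l\<le>N. of_int (c l) * x ^ l) =
        (\<Sum>l<j. of_int (c l) * x ^ l) + (\<Sum>l=j..N. of_int (c l) * x ^ l)"
      using j(2) by (subst sum.union_disjoint[symmetric]) (auto intro!: sum.cong)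
    \<comment> \<open>For \<open>i >= j\<close> the exponents of the shifted tail may leave the
      range below \<open>N\<close>; the relation replaces it by the negative of the terms below
      \<open>j\<close>.\<close>
    ultimately have ej: "x ^ j * e = - (\<Sum>l<j. of_int (c l) * x ^ l)"
      using assms(2) by (simp add: eq_neg_iff_add_eq_0 add.commute)
    have "x ^ i * e = x ^ (i - j) * (x ^ j * e)"
      using False by (simp add: mult.assoc[symmetric] power_add[symmetric])
    also have "\<dots> = (\<Sum>l<j. of_int (- c l) * x ^ (i - j + l))"
      unfolding ej by (simp add: sum_distrib_left power_add mult_ac sum_negf)
    also have "\<dots> \<in> W"
      using False i by (intro add_group_sum[OF W] add_group_of_int_mult[OF W] pow) auto
    finally show ?thesis .
  qed
  have e_W: "w * e \<in> W" if w: "w \<in> W" for w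
  proof -
    obtain q where q: "w = poly q x" "q \<in> coeffs_lt N \<int>" using w unfolding W_def by auto
    have "w * e = (\<Sum>i\<le>degree q. coeff q i * (x ^ i * e))"
      unfolding q(1) poly_altdef by (simp add: sum_distrib_right mult.assoc)
    also have "\<dots> \<in> W" by (rule sum_int_coeffs_in_subgroup[OF W q(2) e_pow])
    finally show ?thesis .
  qed
  have powers: "e ^ k \<in> W" for k
  proof (induction k)
    case 0
    show ?case using pow[of 0] j by simp
  next
    case (Suc k)
    then show ?case using e_W[OF Suc.IH] by (simp add: mult.commute)
  qed
  obtain C where C: "C > 0" "(\<lambda>i. x ^ i) ` {..<N} \<subseteq> lat C"
    using finite_in_some_lattice[of "(\<lambda>i. x ^ i) ` {..<N}"] power_in_K[OF assms(1)] by auto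
  have "w \<in> lat C" if w: "w \<in> W" for w
  proof -
    obtain q where q: "w = poly q x" "q \<in> coeffs_lt N \<int>" using w unfolding W_def by auto
    show ?thesis
      unfolding q(1) poly_altdef
      by (rule sum_int_coeffs_in_subgroup[OF add_group_lattice q(2)]) (use C(2) in auto)
  qed
  then have "e \<in> bdd_powers" using powers C(1) unfolding bdd_powers_def by blast
  then show ?thesis unfolding e_def .
qed

section \<open>Integer relations satisfied by elements of \<open>R\<close>\<close>

lemma int_poly_root_nonzero_constant:
  fixes x :: "'a::field_char_0"
  assumes "q \<in> coeffs_in \<int>" "q \<noteq> 0" "poly q x = 0" "x \<noteq> 0"
  shows "\<exists>r. r \<in> coeffs_in \<int> \<and> coeff r 0 \<noteq> 0 \<and> poly r x = 0"
  using assms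
proof (induction q)
  case 0
  then show ?case by simp
next
  case (pCons a q)
  show ?case
  proof (cases "a = 0")
    case True
    have "coeff q i \<in> \<int>" for i
      using pCons.prems(1) unfolding coeffs_in_def by (auto dest: spec[of _ "Suc i"])
    then show ?thesis using pCons True by (auto simp: coeffs_in_def)
  next
    case False
    then show ?thesis using pCons.prems by (intro exI[of _ "pCons a q"]) auto
  qed
qed

lemma (in local_subring) int_poly_root:
  assumes "finite B" "R \<subseteq> Q.span B" "x \<in> R"
  obtains q where "q \<in> coeffs_in \<int>" "q \<noteq> 0" "poly q x = 0"
proof -
  have "(\<lambda>i. x ^ i) ` {..card B} \<subseteq> Q.span B" using assms(2) R_power[OF assms(3)] by auto
  \<comment> \<open>The modulus 2 merely guarantees a nonzero coefficient.\<close>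
  then obtain c :: "nat \<Rightarrow> int" where c: "\<exists>i\<in>{..card B}. \<not> 2 dvd c i"
    "(\<Sum>i\<in>{..card B}. of_int (c i) * x ^ i) = 0"
    using integer_dependent_family[OF assms(1), of "{..card B}" "\<lambda>i. x ^ i" 2] by auto
  define q :: "'a poly" where "q = (\<Sum>i\<le>card B. monom (of_int (c i)) i)"
  have coeff_q: "coeff q i = (if i \<le> card B then of_int (c i) else 0)" for i
    unfolding q_def by (simp add: coeff_sum_monom)
  have "q \<in> coeffs_in \<int>" by (simp add: coeffs_in_def coeff_q)
  moreover have "q \<noteq> 0"
  proof
    assume "q = 0"
    then have "(of_int (c i) :: 'a) = 0" if "i \<le> card B" for i using coeff_q[of i] that by simp
    then show False using c(1) by force
  qed
  moreover have "poly q x = 0" using c(2) unfolding q_def by (simp add: poly_sum poly_monom)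
  ultimately show ?thesis by (rule that)
qed

text \<open>In an integer relation with nonzero constant term, that term is up to sign
  \<open>x\<close> times a polynomial in \<open>x\<close>. Consequently every nonzero ideal of
  \<open>R\<close> contains a nonzero integer.\<close>

lemma (in local_subring) divides_nonzero_int:
  assumes "finite B" "R \<subseteq> Q.span B" "x \<in> R" "x \<noteq> 0"
  obtains z :: int and y where "z \<noteq> 0" "y \<in> R" "x * y = of_int z"
proof -
  obtain q where q: "q \<in> coeffs_in \<int>" "q \<noteq> 0" "poly q x = 0"
    by (rule int_poly_root[OF assms(1-3)]) (rule that)
  then obtain r where r: "r \<in> coeffs_in \<int>" "coeff r 0 \<noteq> 0" "poly r x = 0"
    using int_poly_root_nonzero_constant assms(4) by blast
  obtain a s where as: "r = pCons a s" by (rule pCons_cases)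
  have "coeff r 0 \<in> \<int>" using r(1) by (simp add: coeffs_in_def)
  then obtain z where z: "a = of_int z" using as by (auto elim: Ints_cases)
  have "coeff s i \<in> R" for i
  proof -
    have "coeff s i \<in> \<int>" using r(1) as unfolding coeffs_in_def by (auto dest: spec[of _ "Suc i"])
    then show ?thesis using R_of_int by (auto elim: Ints_cases)
  qed
  then have "poly s x \<in> R"
    unfolding poly_altdef using R_power[OF assms(3)]
    by (intro add_group_sum[OF R_subgroup]) (simp add: R_mult)
  moreover have "x * (- poly s x) = of_int z" using r(3) as z by (simp add: add_eq_0_iff)
  moreover have "z \<noteq> 0" using r(2) as z by auto
  ultimately show ?thesis using that R_minus by blast
qed

context local_number_ring begin

lemma p_gt_1: "int p > 1"
  using prime_p prime_gt_1_nat by simp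

lemma of_int_notin_m:
  assumes "\<not> int p dvd u"
  shows "of_int u \<notin> m"
proof
  assume u: "of_int u \<in> m"
  have "coprime u (int p)"
    using assms prime_p prime_imp_coprime[of "int p" u] by (simp add: coprime_commute)
  then obtain a b where "a * u + b * int p = 1" by (metis bezout_int coprime_imp_gcd_eq_1)
  then have "of_int a * of_int u + of_int b * of_nat p = (1 :: 'a)"
    by (metis of_int_1 of_int_add of_int_mult of_int_of_nat_eq)
  moreover have "of_int a * of_int u + of_int b * of_nat p \<in> m"
    by (intro m_add m_mult R_of_int u p_in_m)
  ultimately show False using one_notin by simp
qed

lemma nonzero_int_decomp:
  assumes "z \<noteq> 0"
  obtains k u where "z = int p ^ k * u" "\<not> int p dvd u"
proof -
  have "\<not> is_unit (int p)" using p_gt_1 by simp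
  then obtain u where "z = int p ^ multiplicity (int p) z * u" "\<not> int p dvd u"
    using multiplicity_decompose'[of z "int p"] assms by metis
  then show ?thesis by (rule that)
qed

text \<open>Primitivity at \<open>p\<close> makes some coefficient a unit of \<open>R\<close>, which
  Kronecker's argument needs.\<close>

lemma int_relation:
  assumes "x \<in> R"
  obtains N and c :: "nat \<Rightarrow> int" where
    "(\<Sum>i\<le>N. of_int (c i) * x ^ i) = 0" "\<exists>i\<le>N. \<not> int p dvd c i"
proof -
  have "(\<lambda>i. x ^ i) ` {..card B} \<subseteq> Q.span B" using R_in_span R_power[OF assms] by auto
  then obtain d :: "nat \<Rightarrow> int" where "\<exists>i\<in>{..card B}. \<not> int p dvd d i"
    "(\<Sum>i\<in>{..card B}. of_int (d i) * x ^ i) = 0"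
    using integer_dependent_family[OF finite_B, of "{..card B}" "\<lambda>i. x ^ i" "int p"] p_gt_1 by auto
  then show ?thesis using that by auto
qed

text \<open>Integers prime to \<open>p\<close> are units of \<open>R\<close>, so a nonzero integer
  divisible by \<open>x\<close> can be replaced by a power of \<open>p\<close>; inverting
  \<open>p\<close> in \<open>R\<close> therefore gives the whole field of fractions.\<close>

lemma divides_power_p:
  assumes "x \<in> R" "x \<noteq> 0"
  obtains k y where "y \<in> R" "x * y = of_nat p ^ k"
proof -
  obtain z :: int and y where y: "z \<noteq> 0" "y \<in> R" "x * y = of_int z"
    by (rule divides_nonzero_int[OF finite_B R_in_span assms]) (rule that)
  obtain k u where ku: "z = int p ^ k * u" "\<not> int p dvd u" using nonzero_int_decomp[OF y(1)] by metis
  have "(of_int u :: 'a) \<noteq> 0" using ku y(1) by auto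
  then have "(x * y) * inverse (of_int u) = of_nat p ^ k" using y(3) ku(1) by simp
  then have "x * (y * inverse (of_int u)) = of_nat p ^ k" by (simp only: mult.assoc)
  moreover have "y * inverse (of_int u) \<in> R"
    by (intro R_mult y inverse_in R_of_int of_int_notin_m ku)
  ultimately show ?thesis using that by blast
qed

lemma span_denominator:
  assumes "x \<in> Q.span R"
  obtains N :: int where "N > 0" "of_int N * x \<in> R"
proof -
  have "\<exists>N::int. N > 0 \<and> of_int N * x \<in> R"
    using assms
  proof (rule Q.span_induct)
    show "\<exists>N::int. N > 0 \<and> of_int N * y \<in> R" if "y \<in> R" for y
      using that by (intro exI[of _ 1]) auto
    show "Q.subspace (Collect (\<lambda>x. \<exists>N::int. N > 0 \<and> of_int N * x \<in> R))"
    proof (rule Q.subspaceI)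
      show "0 \<in> Collect (\<lambda>x. \<exists>N::int. N > 0 \<and> of_int N * x \<in> R)"
        using R_zero by (auto intro: exI[of _ 1])
      fix x y assume "x \<in> Collect (\<lambda>x. \<exists>N::int. N > 0 \<and> of_int N * x \<in> R)"
        "y \<in> Collect (\<lambda>x. \<exists>N::int. N > 0 \<and> of_int N * x \<in> R)"
      then obtain N L :: int where NL: "N > 0" "of_int N * x \<in> R" "L > 0" "of_int L * y \<in> R" by blast
      have "of_int (N * L) * (x + y) = of_int L * (of_int N * x) + of_int N * (of_int L * y)"
        by (simp add: algebra_simps)
      also have "\<dots> \<in> R" by (intro R_add R_mult R_of_int NL)
      finally show "x + y \<in> Collect (\<lambda>x. \<exists>N::int. N > 0 \<and> of_int N * x \<in> R)"
        using NL by (intro CollectI exI[of _ "N * L"]) simp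
    next
      fix r :: rat and x assume "x \<in> Collect (\<lambda>x. \<exists>N::int. N > 0 \<and> of_int N * x \<in> R)"
      then obtain N :: int where N: "N > 0" "of_int N * x \<in> R" by blast
      obtain a b :: int where ab: "b > 0" "r = of_int a / of_int b"
        by (metis quotient_of_denom_pos quotient_of_div surj_pair)
      have "of_int (N * b) * rat_scale r x = of_int a * (of_int N * x)"
        using ab by (simp add: rat_scale_def of_rat_divide)
      also have "\<dots> \<in> R" by (intro R_mult R_of_int N)
      finally show "rat_scale r x \<in> Collect (\<lambda>x. \<exists>N::int. N > 0 \<and> of_int N * x \<in> R)"
        using N ab by (intro CollectI exI[of _ "N * b"]) simp
    qed
  qed
  then show ?thesis using that by blast
qed

lemma span_R_if_multiple:
  assumes "y \<in> R" "N \<noteq> (0::int)" "of_int N * x = y"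
  shows "x \<in> Q.span R"
proof -
  have "x = rat_scale (1 / of_int N) y" using assms by (auto simp: rat_scale_def of_rat_divide)
  then show ?thesis using Q.span_scale[OF Q.span_base[OF assms(1)]] by metis
qed

text \<open>The basis is taken inside \<open>R\<close>, so that integer combinations of it stay in
  \<open>R\<close>. Its span is closed under inverses because every nonzero element of
  \<open>R\<close> divides a power of \<open>p\<close>.\<close>

lemma basis_in_R:
  obtains Bs where "Bs \<subseteq> R" "field_basis Bs" "Q.span Bs = Q.span R"
proof -
  obtain Bs where Bs: "Bs \<subseteq> R" "\<not> Q.dependent Bs" "R \<subseteq> Q.span Bs"
    by (rule Q.maximal_independent_subset) (rule that)
  have span: "Q.span Bs = Q.span R"
    using Bs by (metis Q.span_mono Q.span_span subset_antisym)
  have "field_basis Bs"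
  proof
    show "\<not> Q.dependent Bs" by (rule Bs(2))
    show "finite Bs" using Q.independent_span_bound[OF finite_B Bs(2)] Bs(1) R_in_span by blast
    show "1 \<in> Q.span Bs" using Bs(3) R_one by blast
    show "x * y \<in> Q.span Bs" if xy: "x \<in> Q.span Bs" "y \<in> Q.span Bs" for x y
    proof -
      obtain N :: int where N: "N > 0" "of_int N * x \<in> R" using span_denominator xy(1) span by metis
      obtain L :: int where L: "L > 0" "of_int L * y \<in> R" using span_denominator xy(2) span by metis
      show ?thesis
        unfolding span
        by (rule span_R_if_multiple[OF R_mult[OF N(2) L(2)], of "N * L"]) (use N L in auto)
    qed
    show "inverse x \<in> Q.span Bs" if x: "x \<in> Q.span Bs" for x
    proof (cases "x = 0")
      case True
      then show ?thesis using Q.span_zero by simp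
    next
      case False
      obtain N :: int where N: "N > 0" "of_int N * x \<in> R" using span_denominator x span by metis
      then obtain k y where y: "y \<in> R" "of_int N * x * y = of_nat p ^ k"
        using divides_power_p[OF N(2)] False by (metis mult_eq_0_iff of_int_eq_0_iff less_irrefl)
      have "of_int (int p ^ k) * inverse x = of_int N * x * y * inverse x" using y(2) by simp
      also have "\<dots> = of_int N * y" using False by simp
      finally show ?thesis
        unfolding span using p_gt_1
        by (intro span_R_if_multiple[OF R_mult[OF R_of_int[of N] y(1)], of "int p ^ k"]) auto
    qed
  qed
  then show ?thesis using that Bs(1) span by blast
qed

lemma frac_field_in_span:
  assumes "x \<in> frac_field R"
  shows "x \<in> Q.span R"
proof -
  obtain Bs where Bs: "Bs \<subseteq> R" "field_basis Bs" "Q.span Bs = Q.span R"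
    by (rule basis_in_R) (rule that)
  interpret F: field_basis Bs by (rule Bs(2))
  obtain a b where ab: "a \<in> R" "b \<in> R" "x = a / b" using assms unfolding frac_field_def by auto
  have "a * inverse b \<in> Q.span Bs"
    using ab Bs(3) by (intro F.mult_span F.inverse_span) (auto intro: Q.span_base)
  then show ?thesis using ab(3) Bs(3) by (simp add: divide_inverse)
qed

text \<open>The tails satisfy \<open>e j = c j + x * e (j + 1)\<close> and start with
  \<open>e 0 = 0\<close>. If all \<open>e (j + 1)\<close> lay in \<open>m\<close>, every
  \<open>c j\<close> would, contradicting primitivity. A tail outside \<open>m\<close> is the
  denominator: it and its product with \<open>x\<close>, namely \<open>e j - c j\<close>, are
  algebraic integers.\<close>

lemma unit_denominator:
  assumes "field_basis Bs" "Q.span Bs = Q.span R" "x \<in> R"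
  obtains d where "d \<in> R" "d \<notin> m" "d \<in> field_basis.bdd_powers Bs" "d * x \<in> field_basis.bdd_powers Bs"
proof -
  interpret F: field_basis Bs by (rule assms(1))
  have xK: "x \<in> Q.span Bs" using assms(2,3) Q.span_base by blast
  obtain N c where c: "(\<Sum>i\<le>N. of_int (c i) * x ^ i) = 0" "\<exists>i\<le>N. \<not> int p dvd c i"
    by (rule int_relation[OF assms(3)]) (rule that)
  define e where "e j = (\<Sum>i=j..N. of_int (c i) * x ^ (i - j))" for j
  have rec: "e j = of_int (c j) + x * e (Suc j)" if "j \<le> N" for j
  proof -
    have "e j = of_int (c j) + (\<Sum>i=Suc j..N. of_int (c i) * x ^ (i - j))"
      using that unfolding e_def by (simp add: sum.atLeast_Suc_atMost)
    also have "(\<Sum>i=Suc j..N. of_int (c i) * x ^ (i - j)) = x * e (Suc j)"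
      unfolding e_def sum_distrib_left
      by (intro sum.cong) (auto simp: Suc_diff_Suc simp flip: power_Suc)
    finally show ?thesis .
  qed
  have e0: "e 0 = 0" using c(1) by (simp add: e_def atMost_atLeast0)
  have eO: "e j \<in> F.bdd_powers" for j
    unfolding e_def by (rule F.relation_tail_bdd_powers[OF xK c(1)])
  have eR: "e j \<in> R" for j
    unfolding e_def by (intro add_group_sum[OF R_subgroup] R_mult R_of_int R_power assms(3))
  have "\<exists>j\<le>N. e (Suc j) \<notin> m"
  proof (rule ccontr)
    assume "\<not> (\<exists>j\<le>N. e (Suc j) \<notin> m)"
    then have em: "e (Suc j) \<in> m" if "j \<le> N" for j using that by blast
    have em': "e j \<in> m" if "j \<le> N" for j
      using em[of "j - 1"] e0 m_zero that by (cases j) auto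
    have "of_int (c j) \<in> m" if "j \<le> N" for j
      using add_groupD(2)[OF m_subgroup em'[OF that] m_mult[OF assms(3) em[OF that]]] rec[OF that]
      by simp
    then show False using c(2) of_int_notin_m by blast
  qed
  then obtain j where j: "j \<le> N" "e (Suc j) \<notin> m" by blast
  have "e (Suc j) * x = e j - of_int (c j)" using rec[OF j(1)] by (simp add: mult.commute)
  also have "\<dots> \<in> F.bdd_powers"
    by (intro add_groupD(2)[OF is_subring_add_group[OF F.is_subring_bdd_powers]]
        eO F.of_int_bdd_powers)
  finally show ?thesis using that[OF eR j(2) eO] by blast
qed

text \<open>The tail \<open>c (n - 1) + c n * x\<close> of a relation of degree \<open>n\<close> is
  an algebraic integer, hence so is \<open>c n * x\<close>: the leading coefficient is a
  denominator.\<close>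

lemma integer_denominator:
  assumes "field_basis Bs" "Q.span Bs = Q.span R" "x \<in> R"
  shows "\<exists>c::int. c \<noteq> 0 \<and> of_int c * x \<in> field_basis.bdd_powers Bs"
proof -
  interpret F: field_basis Bs by (rule assms(1))
  have xK: "x \<in> Q.span Bs" using assms(2,3) Q.span_base by blast
  obtain q where q: "q \<in> coeffs_in \<int>" "q \<noteq> 0" "poly q x = 0"
    by (rule int_poly_root[OF finite_B R_in_span assms(3)]) (rule that)
  have "\<forall>i. \<exists>z. coeff q i = of_int z" using q(1) unfolding coeffs_in_def by (auto elim: Ints_cases)
  then obtain c where c: "\<And>i. coeff q i = of_int (c i)" by metis
  define n where "n = degree q"
  have rel: "(\<Sum>i\<le>n. of_int (c i) * x ^ i) = 0" using q(3) by (simp add: poly_altdef c n_def)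
  have cn: "c n \<noteq> 0" using q(2) c[of n] by (auto simp: n_def)
  have n1: "n \<ge> 1"
  proof (rule ccontr)
    assume "\<not> n \<ge> 1"
    then have "n = 0" by simp
    then show False using rel cn by simp
  qed
  have "{n - 1..n} = {n - 1, n}" using n1 by auto
  then have "(\<Sum>i=n - 1..n. of_int (c i) * x ^ (i - (n - 1))) = of_int (c (n - 1)) + of_int (c n) * x"
    using n1 by simp
  then have "of_int (c (n - 1)) + of_int (c n) * x \<in> F.bdd_powers"
    using F.relation_tail_bdd_powers[OF xK rel, of "n - 1"] by simp
  then have "of_int (c n) * x \<in> F.bdd_powers"
    using add_groupD(2)[OF is_subring_add_group[OF F.is_subring_bdd_powers] _
        F.of_int_bdd_powers[of "c (n - 1)"], of "of_int (c (n - 1)) + of_int (c n) * x"] by simp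
  then show ?thesis using cn by blast
qed

text \<open>\<open>M\<close> is the exponent of \<open>p\<close> in the denominator \<open>N\<close>
  of a lattice containing all algebraic integers; the rest of \<open>N\<close> is a unit of
  \<open>R\<close>. An element \<open>s\<close> of the normalization becomes an algebraic integer
  after multiplication by a unit \<open>D\<close> of \<open>R\<close>, which depends on
  \<open>s\<close> but does not affect \<open>M\<close>.\<close>

lemma conductor:
  obtains M where "\<And>s. s \<in> normalization R \<Longrightarrow> of_nat p ^ M * s \<in> R"
proof -
  obtain Bs where Bs: "Bs \<subseteq> R" "field_basis Bs" "Q.span Bs = Q.span R"
    by (rule basis_in_R) (rule that)
  interpret F: field_basis Bs by (rule Bs(2))
  note O = F.is_subring_bdd_powers
  have O_mult: "x * y \<in> F.bdd_powers" if "x \<in> F.bdd_powers" "y \<in> F.bdd_powers" for x y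
    using O that unfolding is_subring_def by blast
  have O_one: "1 \<in> F.bdd_powers" using O unfolding is_subring_def by blast
  have O_power: "x ^ k \<in> F.bdd_powers" if "x \<in> F.bdd_powers" for x k
    by (induction k) (auto simp: O_one O_mult that)
  obtain N where N: "N > 0" "F.bdd_powers \<subseteq> F.lat N"
    using F.bdd_powers_in_lat integer_denominator[OF Bs(2,3)] Bs(1) by (metis subsetD)
  obtain M u where Mu: "N = int p ^ M * u" "\<not> int p dvd u"
    using nonzero_int_decomp[of N] N(1) by (metis less_irrefl)
  have u0: "(of_int u :: 'a) \<noteq> 0" using Mu N(1) by auto
  have bp: "of_nat p ^ M * x \<in> R" if x: "x \<in> F.bdd_powers" for x
  proof -
    have xl: "x \<in> F.lat N" using x N(2) by blast
    have "of_rat (of_int N * F.rep x b) * b \<in> R" if "b \<in> Bs" for b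
    proof -
      obtain z where "of_int N * F.rep x b = of_int z" using F.lat_rep[OF xl] by (auto elim: Ints_cases)
      then have "of_rat (of_int N * F.rep x b) = (of_int z :: 'a)" by simp
      then show ?thesis using that Bs(1) by (auto intro!: R_mult R_of_int)
    qed
    then have "(\<Sum>b\<in>Bs. of_rat (of_int N * F.rep x b) * b) \<in> R"
      by (rule add_group_sum[OF R_subgroup])
    also have "(\<Sum>b\<in>Bs. of_rat (of_int N * F.rep x b) * b) = of_int N * (\<Sum>b\<in>Bs. of_rat (F.rep x b) * b)"
      by (simp add: sum_distrib_left of_rat_mult mult.assoc)
    finally have "of_int N * x \<in> R" unfolding F.sum_rep[OF F.lat_in_K[OF xl]] .
    then have "inverse (of_int u) * (of_int N * x) \<in> R"
      by (rule R_mult[OF inverse_in[OF R_of_int of_int_notin_m[OF Mu(2)]]])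
    moreover have "inverse (of_int u) * (of_int N * x) = of_nat p ^ M * x"
      using u0 by (simp add: Mu field_simps)
    ultimately show ?thesis by simp
  qed
  have "of_nat p ^ M * s \<in> R" if s: "s \<in> normalization R" for s
  proof -
    obtain f where f: "lead_coeff f = 1" "\<And>i. coeff f i \<in> R" "poly f s = 0" "s \<in> frac_field R"
      using s unfolding normalization_def by auto
    have sK: "s \<in> Q.span Bs" using frac_field_in_span[OF f(4)] Bs(3) by simp
    define n where "n = degree f"
    have "\<forall>i. \<exists>d. d \<in> R \<and> d \<notin> m \<and> d \<in> F.bdd_powers \<and> d * coeff f i \<in> F.bdd_powers"
    proof
      fix i show "\<exists>d. d \<in> R \<and> d \<notin> m \<and> d \<in> F.bdd_powers \<and> d * coeff f i \<in> F.bdd_powers"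
        by (rule unit_denominator[OF Bs(2,3) f(2)[of i]]) blast
    qed
    from choice[OF this] obtain d where
      d: "\<And>i. d i \<in> R \<and> d i \<notin> m \<and> d i \<in> F.bdd_powers \<and> d i * coeff f i \<in> F.bdd_powers"
      by blast
    have prod: "(\<Prod>i\<in>I. d i) \<in> R \<and> (\<Prod>i\<in>I. d i) \<notin> m \<and> (\<Prod>i\<in>I. d i) \<in> F.bdd_powers"
      if "finite I" for I
      using that by (induction I) (use d in \<open>auto simp: R_one one_notin O_one R_mult not_in_m_mult O_mult\<close>)
    define D where "D = (\<Prod>i\<le>n. d i)"
    have D: "D \<in> R" "D \<notin> m" "D \<in> F.bdd_powers" using prod[of "{..n}"] unfolding D_def by auto
    have D0: "D \<noteq> 0" using D(2) m_zero by auto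
    have Dc: "D * coeff f i \<in> F.bdd_powers" for i
    proof (cases "i \<le> n")
      case True
      then have "D = d i * (\<Prod>i\<in>{..n} - {i}. d i)" unfolding D_def by (simp add: prod.remove)
      then have "D * coeff f i = (\<Prod>i\<in>{..n} - {i}. d i) * (d i * coeff f i)" by (simp add: mult_ac)
      moreover have "(\<Prod>i\<in>{..n} - {i}. d i) * (d i * coeff f i) \<in> F.bdd_powers"
        by (rule O_mult) (use prod[of "{..n} - {i}"] d in auto)
      ultimately show ?thesis by (simp only:)
    next
      case False
      then show ?thesis using F.of_int_bdd_powers[of 0] by (simp add: n_def coeff_eq_0)
    qed
    \<comment> \<open>\<open>D ^ n\<close> times \<open>f\<close> at \<open>X / D\<close>: monic
      with root \<open>D * s\<close>, and every lower coefficient carries a factor \<open>D\<close>,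
      which makes it an algebraic integer.\<close>
    define g where "g = (\<Sum>i\<le>n. monom (coeff f i * D ^ (n - i)) i)"
    have cg: "coeff g i = (if i \<le> n then coeff f i * D ^ (n - i) else 0)" for i
      unfolding g_def by (simp add: coeff_sum_monom)
    have "degree g \<le> n" by (rule degree_le) (simp add: cg)
    moreover have "coeff g n = 1" using f(1) by (simp add: cg n_def)
    ultimately have "lead_coeff g = 1" by (metis le_antisym le_degree one_neq_zero)
    moreover have "g \<in> coeffs_in F.bdd_powers"
    proof -
      have "coeff g i \<in> F.bdd_powers" for i
      proof (cases "i < n")
        case True
        then have "coeff g i = (D * coeff f i) * D ^ (n - i - 1)"
          by (simp add: cg mult_ac flip: power_Suc) (simp add: Suc_diff_Suc)
        then show ?thesis using O_mult[OF Dc O_power[OF D(3)]] by simp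
      next
        case False
        then show ?thesis
          using cg[of i] f(1) O_one F.of_int_bdd_powers[of 0] by (cases "i = n") (auto simp: n_def)
      qed
      then show ?thesis by (simp add: coeffs_in_def)
    qed
    moreover have "poly g (D * s) = 0"
    proof -
      have "poly g (D * s) = (\<Sum>i\<le>n. D ^ n * (coeff f i * s ^ i))"
        unfolding g_def poly_sum poly_monom
      proof (intro sum.cong refl)
        fix i assume "i \<in> {..n}"
        then have "D ^ n = D ^ (n - i) * D ^ i" by (simp flip: power_add)
        then show "coeff f i * D ^ (n - i) * (D * s) ^ i = D ^ n * (coeff f i * s ^ i)"
          by (simp add: power_mult_distrib mult_ac)
      qed
      also have "\<dots> = D ^ n * poly f s" by (simp add: sum_distrib_left poly_altdef n_def)
      finally show ?thesis using f(3) by simp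
    qed
    moreover have "D * s \<in> Q.span Bs"
      using D(1) Bs(3) sK by (intro F.mult_span) (auto intro: Q.span_base)
    ultimately have "D * s \<in> F.bdd_powers" by (rule F.bdd_powers_integrally_closed)
    then have "inverse D * (of_nat p ^ M * (D * s)) \<in> R"
      by (intro R_mult[OF inverse_in[OF D(1,2)]] bp)
    then show ?thesis using D0 by (simp add: field_simps)
  qed
  then show ?thesis by (rule that)
qed

end

subsection \<open>Products of ideals and modules\<close>

lemma ideal_mult_zero: "0 \<in> ideal_mult_set J M"
  unfolding ideal_mult_set_def by (auto intro!: exI[of _ "0::nat"])

lemma ideal_mult_add_product:
  assumes "x \<in> ideal_mult_set J M" "a \<in> J" "b \<in> M"
  shows "x + a * b \<in> ideal_mult_set J M"
proof -
  obtain n :: nat and f g where x: "x = (\<Sum>i<n. f i * g i)" "\<forall>i<n. f i \<in> J \<and> g i \<in> M"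
    using assms(1) unfolding ideal_mult_set_def by auto
  have "x + a * b = (\<Sum>i<Suc n. (f(n := a)) i * (g(n := b)) i)" using x(1) by simp
  moreover have "\<forall>i<Suc n. (f(n := a)) i \<in> J \<and> (g(n := b)) i \<in> M"
    using x(2) assms(2,3) by (auto simp: less_Suc_eq)
  ultimately show ?thesis unfolding ideal_mult_set_def by blast
qed

lemma ideal_mult_product: "a \<in> J \<Longrightarrow> b \<in> M \<Longrightarrow> a * b \<in> ideal_mult_set J M"
  using ideal_mult_add_product[OF ideal_mult_zero] by force

lemma ideal_mult_add:
  assumes "x \<in> ideal_mult_set J M" "y \<in> ideal_mult_set J M"
  shows "x + y \<in> ideal_mult_set J M"
proof -
  obtain n :: nat and f g where y: "y = (\<Sum>i<n. f i * g i)" "\<forall>i<n. f i \<in> J \<and> g i \<in> M"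
    using assms(2) unfolding ideal_mult_set_def by auto
  have "x + (\<Sum>i<k. f i * g i) \<in> ideal_mult_set J M" if "k \<le> n" for k
    using that
  proof (induction k)
    case 0
    show ?case using assms(1) by simp
  next
    case (Suc k)
    then show ?case
      using ideal_mult_add_product[of "x + (\<Sum>i<k. f i * g i)" J M "f k" "g k"] y(2)
      by (simp add: add.assoc)
  qed
  then show ?thesis using y(1) by simp
qed

lemma ideal_mult_smult:
  assumes "x \<in> ideal_mult_set J M" "\<And>y. y \<in> M \<Longrightarrow> r * y \<in> M"
  shows "r * x \<in> ideal_mult_set J M"
proof -
  obtain n :: nat and f g where x: "x = (\<Sum>i<n. f i * g i)" "\<forall>i<n. f i \<in> J \<and> g i \<in> M"
    using assms(1) unfolding ideal_mult_set_def by auto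
  have "r * x = (\<Sum>i<n. f i * (r * g i))" unfolding x(1) by (simp add: sum_distrib_left mult_ac)
  moreover have "\<forall>i<n. f i \<in> J \<and> r * g i \<in> M" using x(2) assms(2) by blast
  ultimately show ?thesis
    unfolding ideal_mult_set_def
    by (intro CollectI exI[of _ n] exI[of _ f] exI[of _ "\<lambda>i. r * g i"]) simp
qed

lemma add_group_ideal_mult_set:
  assumes "add_group M"
  shows "add_group (ideal_mult_set J M)"
  unfolding add_group_def
proof (intro conjI ballI)
  show "0 \<in> ideal_mult_set J M" by (rule ideal_mult_zero)
  fix x y assume xy: "x \<in> ideal_mult_set J M" "y \<in> ideal_mult_set J M"
  have "(- 1) * y \<in> ideal_mult_set J M"
    by (rule ideal_mult_smult[OF xy(2)]) (simp add: add_groupD(3)[OF assms])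
  then show "x - y \<in> ideal_mult_set J M" using ideal_mult_add[OF xy(1)] by fastforce
qed

lemma ideal_mult_subset:
  assumes "add_group P" "\<And>a b. a \<in> J \<Longrightarrow> b \<in> M \<Longrightarrow> a * b \<in> P"
  shows "ideal_mult_set J M \<subseteq> P"
  unfolding ideal_mult_set_def by (auto intro!: add_group_sum[OF assms(1)] assms(2))

subsection \<open>The normalization of a local number ring\<close>

context local_number_ring begin

abbreviation "S \<equiv> normalization R"

lemma fin_mod_R_power_p: "fin_mod R ((\<lambda>x. of_nat p ^ k * x) ` R)"
  by (rule fin_mod_power_multiple[OF R_subgroup
        fin_mod_prime_multiple[OF finite_B R_subgroup R_in_span prime_p]])

lemma p_power_nonzero: "(of_nat p :: 'a) ^ k \<noteq> 0"
  using prime_gt_0_nat[OF prime_p] by simp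

lemma power_p_mono:
  assumes "of_nat p ^ k * x \<in> R" "k \<le> l"
  shows "of_nat p ^ l * x \<in> R"
proof -
  have "of_nat p ^ (l - k) * (of_nat p ^ k * x) \<in> R" by (intro R_mult[OF _ assms(1)] R_power R_of_nat)
  then show ?thesis using assms(2) by (simp add: mult.assoc[symmetric] power_add[symmetric])
qed

lemma frac_field_denominator:
  assumes "x \<in> frac_field R"
  obtains k where "of_nat p ^ k * x \<in> R"
proof -
  obtain a b where ab: "a \<in> R" "b \<in> R" "b \<noteq> 0" "x = a / b" using assms unfolding frac_field_def by auto
  obtain k y where y: "y \<in> R" "b * y = of_nat p ^ k"
    by (rule divides_power_p[OF ab(2,3)]) (rule that)
  have "of_nat p ^ k * x = a * y" unfolding y(2)[symmetric] ab(4) using ab(3) by simp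
  then show ?thesis using that R_mult[OF ab(1) y(1)] by metis
qed

lemma frac_fieldI:
  assumes "of_nat p ^ k * x \<in> R"
  shows "x \<in> frac_field R"
proof -
  have "x = (of_nat p ^ k * x) / of_nat p ^ k" using p_power_nonzero by simp
  then show ?thesis
    using assms p_power_nonzero R_power[OF R_of_nat] unfolding frac_field_def by blast
qed

text \<open>Integrality from bounded powers by pigeonhole: \<open>x^j - x^i \<in> R\<close> for some \<open>i < j\<close>.\<close>

lemma S_iff_bdd_powers:
  "x \<in> S \<longleftrightarrow> (\<exists>k. \<forall>j. of_nat p ^ k * x ^ j \<in> R)"
proof
  assume "x \<in> S"
  then obtain f where f: "lead_coeff f = 1" "\<And>i. coeff f i \<in> R" "poly f x = 0" "x \<in> frac_field R"
    unfolding normalization_def by auto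
  obtain l where l: "of_nat p ^ l * x \<in> R" by (rule frac_field_denominator[OF f(4)]) (rule that)
  \<comment> \<open>Powers of \<open>x\<close> up to the degree of \<open>f\<close> are cleared by
    one power of \<open>p\<close>; all others reduce to them modulo \<open>f\<close>.\<close>
  have small: "of_nat p ^ (l * degree f) * x ^ i \<in> R" if "i \<le> degree f" for i
  proof (rule power_p_mono)
    show "of_nat p ^ (l * i) * x ^ i \<in> R"
      using R_power[OF l, of i] by (simp add: power_mult_distrib power_mult)
  qed (use that in simp)
  have "of_nat p ^ (l * degree f) * x ^ j \<in> R" for j
  proof -
    define q where "q = monom 1 j mod f"
    have "q \<in> coeffs_in R"
      unfolding q_def
      by (rule conjunct2[OF coeffs_in_div_mod[OF f(1) R_subgroup]])
        (use f(2) in \<open>auto simp: coeffs_in_def R_one R_zero R_mult\<close>)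
    moreover have "degree q \<le> degree f"
      unfolding q_def using degree_mod_less[of f "monom 1 j"] f(1) by force
    ultimately have "(\<Sum>i\<le>degree q. coeff q i * (of_nat p ^ (l * degree f) * x ^ i)) \<in> R"
      by (intro add_group_sum[OF R_subgroup] R_mult small) (auto simp: coeffs_in_def)
    moreover have "(\<Sum>i\<le>degree q. coeff q i * (of_nat p ^ (l * degree f) * x ^ i)) =
        of_nat p ^ (l * degree f) * poly q x"
      by (simp add: poly_altdef sum_distrib_left mult_ac)
    moreover have "poly q x = x ^ j"
      unfolding q_def using poly_mod_root[OF f(3)] by (simp add: poly_monom)
    ultimately show ?thesis by simp
  qed
  then show "\<exists>k. \<forall>j. of_nat p ^ k * x ^ j \<in> R" by blast
next
  assume "\<exists>k. \<forall>j. of_nat p ^ k * x ^ j \<in> R"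
  then obtain k where k: "\<And>j. of_nat p ^ k * x ^ j \<in> R" by blast
  \<comment> \<open>Multiplication by \<open>p ^ k\<close> embeds \<open>A\<close> into
    \<open>R\<close> and takes \<open>R\<close> to \<open>p ^ k R\<close>, so finiteness of
    \<open>R / p ^ k R\<close> gives that of \<open>A / R\<close>.\<close>
  define A where "A = {y. of_nat p ^ k * y \<in> R}"
  have "fin_mod A R"
  proof -
    obtain F where F: "finite F" "\<And>x. x \<in> R \<Longrightarrow> \<exists>f\<in>F. x - f \<in> (\<lambda>x. of_nat p ^ k * x) ` R"
      using fin_mod_R_power_p[of k] unfolding fin_mod_def by auto
    have "\<exists>f\<in>(\<lambda>f. f / of_nat p ^ k) ` F. y - f \<in> R" if y: "y \<in> A" for y
    proof -
      obtain f where f: "f \<in> F" "of_nat p ^ k * y - f \<in> (\<lambda>x. of_nat p ^ k * x) ` R"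
        using F(2) y unfolding A_def by blast
      then obtain r where r: "r \<in> R" "of_nat p ^ k * y - f = of_nat p ^ k * r" by auto
      have "y - f / of_nat p ^ k = r"
        using r(2) p_power_nonzero[of k] by (simp add: field_simps)
      then show ?thesis using r(1) f(1) by blast
    qed
    then show ?thesis using F(1) unfolding fin_mod_def
      by (intro exI[of _ "(\<lambda>f. f / of_nat p ^ k) ` F"]) auto
  qed
  then obtain i j where ij: "i < j" "x ^ j - x ^ i \<in> R"
    using fin_mod_pigeonhole[OF _ R_subgroup, of A "\<lambda>j. x ^ j"] k unfolding A_def by auto
  define r where "r = x ^ j - x ^ i"
  define f where "f = monom 1 j - monom 1 i - [:r:]"
  have cf: "coeff f l = (if l = j then 1 else 0) - (if l = i then 1 else 0) - (if l = 0 then r else 0)" for l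
    unfolding f_def by (auto simp: coeff_pCons split: nat.splits)
  have "degree f \<le> j" by (rule degree_le) (use ij in \<open>auto simp: cf\<close>)
  moreover have "coeff f j = 1" using ij by (simp add: cf)
  ultimately have "lead_coeff f = 1" by (metis le_antisym le_degree one_neq_zero)
  moreover have "coeff f l \<in> R" for l
  proof -
    have "(if l = j then 1 else 0) \<in> R" "(if l = i then 1 else 0) \<in> R" "(if l = 0 then r else 0) \<in> R"
      using ij(2) R_one R_zero by (auto simp: r_def)
    then show ?thesis unfolding cf by (intro add_groupD(2)[OF R_subgroup])
  qed
  moreover have "poly f x = 0" by (simp add: f_def poly_monom r_def)
  moreover have "x \<in> frac_field R" using frac_fieldI[of k x] k[of 1] by simp
  ultimately show "x \<in> S" unfolding normalization_def by blast
qed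

lemma R_subset_S: "R \<subseteq> S"
  using R_power by (auto simp: S_iff_bdd_powers intro!: exI[of _ 0])

lemma is_subring_S: "is_subring S"
proof -
  have minus: "- x \<in> S" if "x \<in> S" for x
  proof -
    obtain k where k: "\<And>j. of_nat p ^ k * x ^ j \<in> R" using \<open>x \<in> S\<close> S_iff_bdd_powers by blast
    have "of_nat p ^ k * (- x) ^ j = (- 1) ^ j * (of_nat p ^ k * x ^ j)" for j
      by (simp add: power_minus[of x] mult_ac)
    moreover have "(- 1) ^ j * (of_nat p ^ k * x ^ j) \<in> R" for j
      by (intro R_mult[OF _ k] R_power R_minus R_one)
    ultimately show ?thesis using S_iff_bdd_powers by metis
  qed
  moreover have "x + y \<in> S \<and> x * y \<in> S" if xy: "x \<in> S" "y \<in> S" for x y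
  proof -
    obtain k where k: "\<And>j. of_nat p ^ k * x ^ j \<in> R" using xy(1) S_iff_bdd_powers by blast
    obtain l where l: "\<And>j. of_nat p ^ l * y ^ j \<in> R" using xy(2) S_iff_bdd_powers by blast
    have "of_nat p ^ (k + l) * (x * y) ^ j \<in> R" for j
      using R_mult[OF k[of j] l[of j]] by (simp add: power_mult_distrib power_add mult_ac)
    moreover have "of_nat p ^ (k + l) * (x + y) ^ j \<in> R" for j
    proof -
      have "of_nat p ^ (k + l) * (x + y) ^ j =
          (\<Sum>i\<le>j. of_nat (j choose i) * ((of_nat p ^ k * x ^ i) * (of_nat p ^ l * y ^ (j - i))))"
        by (simp add: binomial_ring sum_distrib_left power_add mult_ac)
      also have "\<dots> \<in> R" by (intro add_group_sum[OF R_subgroup] R_mult[OF R_of_nat R_mult[OF k l]])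
      finally show ?thesis .
    qed
    ultimately show ?thesis using S_iff_bdd_powers by blast
  qed
  ultimately show ?thesis using R_subset_S R_zero R_one unfolding is_subring_def by blast
qed

lemma S_zero: "0 \<in> S" and S_one: "1 \<in> S"
  and S_add: "x \<in> S \<Longrightarrow> y \<in> S \<Longrightarrow> x + y \<in> S"
  and S_mult: "x \<in> S \<Longrightarrow> y \<in> S \<Longrightarrow> x * y \<in> S"
  and S_minus: "x \<in> S \<Longrightarrow> - x \<in> S"
  using is_subring_S unfolding is_subring_def by blast+

lemma S_subgroup: "add_group S"
  by (rule is_subring_add_group[OF is_subring_S])

lemma S_power: "x \<in> S \<Longrightarrow> x ^ k \<in> S"
  by (induction k) (auto simp: S_one S_mult)

lemma p_in_S: "of_nat p \<in> S"
  using R_subset_S R_of_nat by blast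

section \<open>The finite ring \<open>S / p S\<close>\<close>

definition pS :: "'a set" where
  "pS = (\<lambda>x. of_nat p * x) ` S"

lemma fin_mod_S_pS: "fin_mod S pS"
proof -
  have "Q.span R \<subseteq> Q.span B" by (rule Q.span_minimal[OF R_in_span Q.subspace_span])
  then have "S \<subseteq> Q.span B" using frac_field_in_span unfolding normalization_def by blast
  then show ?thesis unfolding pS_def by (rule fin_mod_prime_multiple[OF finite_B S_subgroup _ prime_p])
qed

lemma pS_mult: "s \<in> S \<Longrightarrow> x \<in> pS \<Longrightarrow> s * x \<in> pS"
  unfolding pS_def using S_mult by (auto simp: mult.left_commute[of s])

lemma pS_subgroup: "add_group pS"
  unfolding pS_def by (rule add_group_mult_image[OF S_subgroup])

text \<open>\<open>p\<close> lies in the Jacobson radical of the normalization: by the conductor, some partial product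
  of the geometric series for \<open>(1 - p s)\<^sup>-\<^sup>1\<close> brings \<open>1 - p s\<close> into \<open>1 + p R\<close>.\<close>

lemma inverse_one_minus_p_mult:
  assumes s: "s \<in> S"
  shows "1 - of_nat p * s \<noteq> 0" "inverse (1 - of_nat p * s) \<in> S"
proof -
  obtain M where M: "\<And>s. s \<in> S \<Longrightarrow> of_nat p ^ M * s \<in> R" by (rule conductor) (rule that)
  define v where "v = 1 - of_nat p * s"
  define g where "g = (\<Sum>i\<le>M. (of_nat p * s) ^ i)"
  define w where "w = of_nat p * (of_nat p ^ M * s ^ Suc M)"
  have vg: "v * g = 1 - w"
    unfolding v_def g_def w_def using sum_gp_basic[of "of_nat p * s" M]
    by (simp add: power_mult_distrib mult_ac)
  have wm: "w \<in> m"
    unfolding w_def using m_mult[OF M[OF S_power[OF s, of "Suc M"]] p_in_m] by (simp add: mult.commute)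
  have "1 - w \<notin> m"
    using add_groupD(4)[OF m_subgroup _ wm, of "1 - w"] one_notin by auto
  moreover have "1 - w \<in> R" using add_groupD(2)[OF R_subgroup R_one m_in_R[OF wm]] .
  ultimately have u: "inverse (1 - w) \<in> R" "1 - w \<noteq> 0" using inverse_in m_zero by auto
  show v0: "1 - of_nat p * s \<noteq> 0" using vg u(2) unfolding v_def by auto
  have "g \<in> S" unfolding g_def by (intro add_group_sum[OF S_subgroup] S_power S_mult p_in_S s)
  then have "g * inverse (1 - w) \<in> S" using u(1) R_subset_S S_mult by blast
  moreover have "v * (g * inverse (1 - w)) = 1" using vg u(2) by (simp add: mult.assoc[symmetric])
  then have "inverse v = g * inverse (1 - w)" by (rule inverse_unique)
  ultimately show "inverse (1 - of_nat p * s) \<in> S" by (simp add: v_def)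
qed

text \<open>Elements nilpotent modulo \<open>p\<close> on \<open>y\<close> are killed, one after the other, by passing to multiples of \<open>y\<close>.\<close>

lemma kill_nilpotents:
  assumes "finite F" "F \<subseteq> S" "y \<in> S" "y \<notin> pS" "\<And>h. h \<in> F \<Longrightarrow> \<exists>a. y * h ^ a \<in> pS"
  shows "\<exists>s\<in>S. s * y \<notin> pS \<and> (\<forall>h\<in>F. s * y * h \<in> pS)"
  using assms(1,2,5)
proof (induction F)
  case empty
  then show ?case using assms(4) S_one by (intro bexI[of _ 1]) auto
next
  case (insert h F)
  obtain s where s: "s \<in> S" "s * y \<notin> pS" "\<And>h. h \<in> F \<Longrightarrow> s * y * h \<in> pS"
    using insert.IH insert.prems by auto
  have h: "h \<in> S" using insert.prems by auto
  obtain a where "y * h ^ a \<in> pS" using insert.prems by blast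
  then have "s * y * h ^ a \<in> pS" using pS_mult[OF s(1)] by (simp add: mult.assoc)
  then have ex: "\<exists>a. s * y * h ^ a \<in> pS" by blast
  define a where "a = (LEAST a. s * y * h ^ a \<in> pS)"
  have a: "s * y * h ^ a \<in> pS" unfolding a_def by (rule LeastI_ex[OF ex])
  have a0: "a \<noteq> 0"
  proof
    assume "a = 0"
    then show False using a s(2) by simp
  qed
  then have less: "s * y * h ^ (a - 1) \<notin> pS"
    unfolding a_def using not_less_Least[of "a - 1" "\<lambda>a. s * y * h ^ a \<in> pS"] by (simp add: a_def)
  show ?case
  proof (intro bexI[of _ "s * h ^ (a - 1)"] conjI ballI)
    show "s * h ^ (a - 1) \<in> S" using s h S_mult S_power by auto
    show "s * h ^ (a - 1) * y \<notin> pS" using less by (simp add: mult_ac)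
    fix k assume k: "k \<in> insert h F"
    show "s * h ^ (a - 1) * y * k \<in> pS"
    proof (cases "k = h")
      case True
      have "s * h ^ (a - 1) * y * h = s * y * (h * h ^ (a - 1))" by (simp add: mult_ac)
      also have "h * h ^ (a - 1) = h ^ a" using a0 by (simp flip: power_Suc)
      finally show ?thesis using a by (simp only: True)
    next
      case False
      then have "h ^ (a - 1) * (s * y * k) \<in> pS" using k by (intro pS_mult[OF S_power[OF h]] s(3)) auto
      then show ?thesis by (simp add: mult_ac)
    qed
  qed
qed

text \<open>In a finite ring such as \<open>S / p S\<close> a proper ideal has a nonzero
  annihilator. For each representative \<open>h\<close> of \<open>H\<close> two powers agree, so
  \<open>h\<close> becomes nilpotent on multiples of \<open>1 - h ^ Suc (b h)\<close>; the product
  \<open>y\<close> of these factors is 1 modulo \<open>H\<close> and hence nonzero modulo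
  \<open>p\<close>. Then \<open>kill_nilpotents\<close> turns nilpotency into annihilation.\<close>

lemma proper_ideal_annihilator:
  assumes H: "add_group H" "H \<subseteq> S" "\<And>s h. s \<in> S \<Longrightarrow> h \<in> H \<Longrightarrow> s * h \<in> H"
    and p: "of_nat p \<in> H" and one: "1 \<notin> H"
  obtains y where "y \<in> S" "y \<notin> pS" "\<And>h. h \<in> H \<Longrightarrow> y * h \<in> pS"
proof -
  have pS_H: "pS \<subseteq> H" unfolding pS_def using H(3)[OF _ p] by (auto simp: mult.commute)
  have "fin_mod H pS" by (rule fin_mod_mono[OF fin_mod_S_pS H(2)]) simp
  from fin_mod_has_index[OF pS_subgroup this] obtain n where "has_index H pS n" .
  then obtain T where trans: "transversal H pS T" unfolding has_index_def by blast
  then have T: "T \<subseteq> H" "finite T" by (simp_all add: transversal_def)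
  have cover: "\<exists>t\<in>T. x - t \<in> pS" if "x \<in> H" for x
    using trans that unfolding transversal_def by blast
  have "\<exists>a b. h ^ a * (1 - h ^ Suc b) \<in> pS" if h: "h \<in> H" for h
  proof -
    obtain i j where ij: "i < j" "h ^ j - h ^ i \<in> pS"
      using fin_mod_pigeonhole[OF fin_mod_S_pS pS_subgroup, of "\<lambda>j. h ^ j"] S_power H(2) h by blast
    then obtain b where b: "j = i + Suc b" using less_imp_Suc_add by auto
    have "- (h ^ j - h ^ i) \<in> pS" by (rule add_groupD(3)[OF pS_subgroup ij(2)])
    moreover have "- (h ^ j - h ^ i) = h ^ i * (1 - h ^ Suc b)"
      by (simp add: b power_add right_diff_distrib)
    ultimately show ?thesis by metis
  qed
  then obtain a b where ab: "\<And>h. h \<in> H \<Longrightarrow> h ^ a h * (1 - h ^ Suc (b h)) \<in> pS" by metis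
  define y where "y = (\<Prod>h\<in>T. 1 - h ^ Suc (b h))"
  have pow_H: "h ^ Suc k \<in> H" if "h \<in> H" for h k
    using that H(2) H(3)[OF S_power[of h k] that] by (auto simp: mult.commute)
  have fS: "1 - h ^ Suc (b h) \<in> S" if "h \<in> H" for h
    using that H(2) pow_H by (intro add_groupD(2)[OF S_subgroup] S_one) auto
  have prodS: "(\<Prod>h\<in>T'. 1 - h ^ Suc (b h)) \<in> S" if "finite T'" "T' \<subseteq> H" for T'
    using that by (induction T') (use fS S_one S_mult in auto)
  have "1 - (\<Prod>h\<in>T'. 1 - h ^ Suc (b h)) \<in> H" if "finite T'" "T' \<subseteq> H" for T'
    using that
  proof (induction T')
    case empty
    then show ?case using add_groupD(1)[OF H(1)] by simp
  next
    case (insert h T')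
    let ?P = "\<Prod>h\<in>T'. 1 - h ^ Suc (b h)"
    have "(1 - ?P) + ?P * h ^ Suc (b h) \<in> H"
      using insert by (intro add_groupD(4)[OF H(1)] H(3) prodS pow_H) auto
    moreover have "1 - (\<Prod>h\<in>insert h T'. 1 - h ^ Suc (b h)) = (1 - ?P) + ?P * h ^ Suc (b h)"
      using insert.hyps by (simp add: algebra_simps)
    ultimately show ?case by metis
  qed
  then have "1 - y \<in> H" unfolding y_def using T by blast
  then have y: "y \<notin> pS" using pS_H one add_groupD(4)[OF H(1), of "1 - y" y] by auto
  have yS: "y \<in> S" unfolding y_def by (rule prodS[OF T(2,1)])
  have "\<exists>a. y * h ^ a \<in> pS" if h: "h \<in> T" for h
  proof -
    have "y = (\<Prod>h\<in>T - {h}. 1 - h ^ Suc (b h)) * (1 - h ^ Suc (b h))"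
      unfolding y_def using prod.remove[OF T(2) h, of "\<lambda>h. 1 - h ^ Suc (b h)"] by (simp only: mult.commute)
    then have "y * h ^ a h = (\<Prod>h\<in>T - {h}. 1 - h ^ Suc (b h)) * (h ^ a h * (1 - h ^ Suc (b h)))"
      by (simp only: mult_ac)
    moreover have "\<dots> \<in> pS" using T h by (intro pS_mult prodS ab) auto
    ultimately show ?thesis by metis
  qed
  then obtain s where s: "s \<in> S" "s * y \<notin> pS" "\<forall>h\<in>T. s * y * h \<in> pS"
    using kill_nilpotents[OF T(2) _ yS y] T(1) H(2) by blast
  have "s * y * h \<in> pS" if h: "h \<in> H" for h
  proof -
    obtain t where t: "t \<in> T" "h - t \<in> pS" using cover[OF h] by blast
    have "s * y * (h - t) \<in> pS" using pS_mult[OF S_mult[OF s(1) yS] t(2)] .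
    from add_groupD(4)[OF pS_subgroup this] s(3) t(1) show ?thesis
      by (metis diff_add_cancel distrib_left)
  qed
  then show ?thesis using that[of "s * y"] S_mult[OF s(1) yS] s(2) by blast
qed

subsection \<open>Invertibility of the extended maximal ideal\<close>

text \<open>The colon module \<open>S : m\<close>, the inverse fractional ideal of
  \<open>m S\<close> once invertibility is known.\<close>

definition inv_m :: "'a set" where
  "inv_m = {y. \<forall>x\<in>m. y * x \<in> S}"

lemma inv_m_subgroup: "add_group inv_m"
  unfolding add_group_def inv_m_def
  using S_zero add_groupD(2)[OF S_subgroup] by (auto simp: left_diff_distrib)

lemma inv_m_smult: "s \<in> S \<Longrightarrow> y \<in> inv_m \<Longrightarrow> s * y \<in> inv_m"
  unfolding inv_m_def by (auto simp: mult.assoc S_mult)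

lemma S_subset_inv_m: "S \<subseteq> inv_m"
  unfolding inv_m_def using S_mult R_subset_S m_in_R by blast

text \<open>If \<open>m * inv_m\<close> were proper, an element \<open>w\<close> outside \<open>S\<close> would map it into \<open>S\<close>, hence map \<open>inv_m\<close>
  into itself; all powers of \<open>w\<close> then lie in \<open>inv_m\<close>, so \<open>w\<close> is integral.\<close>

lemma one_in_m_inv_m: "1 \<in> ideal_mult_set m inv_m"
proof (rule ccontr)
  let ?H = "ideal_mult_set m inv_m"
  assume one: "1 \<notin> ?H"
  have sub: "?H \<subseteq> S"
  proof (rule ideal_mult_subset[OF S_subgroup])
    fix a b assume "a \<in> m" "b \<in> inv_m"
    then have "b * a \<in> S" unfolding inv_m_def by blast
    then show "a * b \<in> S" by (simp only: mult.commute)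
  qed
  have smult: "s * h \<in> ?H" if "s \<in> S" "h \<in> ?H" for s h
    using that by (intro ideal_mult_smult inv_m_smult)
  have "of_nat p * 1 \<in> ?H" using S_one S_subset_inv_m by (intro ideal_mult_product p_in_m) auto
  then have pH: "of_nat p \<in> ?H" by simp
  have "\<exists>y. y \<in> S \<and> y \<notin> pS \<and> (\<forall>h\<in>?H. y * h \<in> pS)"
  proof (rule proper_ideal_annihilator)
    show "add_group ?H" by (rule add_group_ideal_mult_set[OF inv_m_subgroup])
  qed (use sub smult pH one in blast)+
  then obtain y where y: "y \<in> S" "y \<notin> pS" "\<forall>h\<in>?H. y * h \<in> pS" by blast
  \<comment> \<open>\<open>y\<close> annihilates \<open>?H\<close> modulo \<open>p\<close> without
    being divisible by \<open>p\<close>, so \<open>w\<close> is outside \<open>S\<close> yet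
    multiplies \<open>?H\<close> into \<open>S\<close>.\<close>
  define w where "w = y / of_nat p"
  have p0: "(of_nat p :: 'a) \<noteq> 0" using p_power_nonzero[of 1] by simp
  have pw: "of_nat p * w = y" using p0 by (simp add: w_def)
  have wS: "w \<notin> S" using y(2) pw unfolding pS_def by blast
  have wH: "w * h \<in> S" if h: "h \<in> ?H" for h
  proof -
    obtain s where "s \<in> S" "y * h = of_nat p * s" using bspec[OF y(3) h] unfolding pS_def by auto
    then have "w * h = s" using p0 by (simp add: w_def field_simps)
    then show ?thesis using \<open>s \<in> S\<close> by simp
  qed
  have w_inv: "w * v \<in> inv_m" if "v \<in> inv_m" for v
    unfolding inv_m_def
  proof (intro CollectI ballI)
    fix x assume "x \<in> m"
    then have "w * (x * v) \<in> S" using that by (intro wH ideal_mult_product)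
    then show "w * v * x \<in> S" by (simp add: mult_ac)
  qed
  have powers: "w ^ j \<in> inv_m" for j
    by (induction j) (use S_one S_subset_inv_m w_inv in auto)
  obtain M where M: "\<And>s. s \<in> S \<Longrightarrow> of_nat p ^ M * s \<in> R" by (rule conductor) (rule that)
  \<comment> \<open>As \<open>p\<close> is in \<open>m\<close>, one factor \<open>p\<close> brings
    every power of \<open>w\<close> into \<open>S\<close>, and \<open>p ^ M\<close> then brings it
    into \<open>R\<close>.\<close>
  have "of_nat p ^ Suc M * w ^ j \<in> R" for j
  proof -
    have "w ^ j * of_nat p \<in> S" using powers p_in_m unfolding inv_m_def by blast
    from M[OF this] show ?thesis by (simp add: mult_ac)
  qed
  then have "w \<in> S" using S_iff_bdd_powers by blast
  then show False using wS by simp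
qed

end

lemma ring_ideal_add_group:
  assumes "ring_ideal A J" "- 1 \<in> A"
  shows "add_group J"
  unfolding add_group_def
proof (intro conjI ballI)
  show "0 \<in> J" using assms unfolding ring_ideal_def by blast
  fix x y assume "x \<in> J" "y \<in> J"
  moreover from this have "(- 1) * y \<in> J" using assms unfolding ring_ideal_def by blast
  ultimately have "x + (- 1) * y \<in> J" using assms(1) unfolding ring_ideal_def by blast
  then show "x - y \<in> J" by simp
qed

lemma maximal_ring_ideal_prime:
  assumes A: "0 \<in> A" "1 \<in> A" "\<And>a b. a \<in> A \<Longrightarrow> b \<in> A \<Longrightarrow> a + b \<in> A \<and> a * b \<in> A"
    and P: "ring_ideal A P" "\<And>J'. ring_ideal A J' \<Longrightarrow> P \<subseteq> J' \<Longrightarrow> 1 \<notin> J' \<Longrightarrow> J' = P"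
    and xy: "x \<in> A" "y \<in> A" "x * y \<in> P" "x \<notin> P"
  shows "y \<in> P"
proof -
  define J where "J = {c + x * a | c a. c \<in> P \<and> a \<in> A}"
  have P': "P \<subseteq> A" "0 \<in> P" "\<And>c d. c \<in> P \<Longrightarrow> d \<in> P \<Longrightarrow> c + d \<in> P"
    "\<And>r c. r \<in> A \<Longrightarrow> c \<in> P \<Longrightarrow> r * c \<in> P"
    using P(1) unfolding ring_ideal_def by auto
  have J: "c + x * a \<in> J" if "c \<in> P" "a \<in> A" for c a using that unfolding J_def by blast
  have "ring_ideal A J"
    unfolding ring_ideal_def
  proof (intro conjI ballI)
    show "J \<subseteq> A" using P'(1) A(3) xy(1) unfolding J_def by auto
    show "0 \<in> J" using J[OF P'(2) A(1)] by simp
    fix c d assume "c \<in> J" "d \<in> J"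
    then obtain c1 c2 d1 d2 where *: "c1 \<in> P" "c2 \<in> A" "d1 \<in> P" "d2 \<in> A" "c = c1 + x * c2" "d = d1 + x * d2"
      unfolding J_def by blast
    have "c + d = (c1 + d1) + x * (c2 + d2)" using * by (simp add: algebra_simps)
    moreover have "(c1 + d1) + x * (c2 + d2) \<in> J" using * P'(3) A(3) by (intro J) auto
    ultimately show "c + d \<in> J" by (simp only:)
  next
    fix r c assume r: "r \<in> A" and "c \<in> J"
    then obtain c1 c2 where *: "c1 \<in> P" "c2 \<in> A" "c = c1 + x * c2" unfolding J_def by blast
    have "r * c = r * c1 + x * (r * c2)" using * by (simp add: algebra_simps)
    moreover have "r * c1 + x * (r * c2) \<in> J" using * P'(4) A(3) r by (intro J) auto
    ultimately show "r * c \<in> J" by (simp only:)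
  qed
  moreover have "P \<subseteq> J" using J[OF _ A(1)] J[OF _ A(1)] J A(1) by fastforce
  moreover have "J \<noteq> P" using J[OF P'(2) A(2)] xy(4) by auto
  ultimately have "1 \<in> J" using P(2) by blast
  then obtain c a where ca: "c \<in> P" "a \<in> A" "1 = c + x * a" unfolding J_def by blast
  have "y = y * (c + x * a)" using ca(3) by simp
  also have "\<dots> = y * c + a * (x * y)" by (simp add: algebra_simps)
  also have "\<dots> \<in> P" using P'(3,4) ca xy by blast
  finally show ?thesis .
qed

subsection \<open>A unimodular multiple of a content polynomial\<close>

context local_number_ring begin

abbreviation "SX \<equiv> coeffs_in S"

lemma SX_mult: "q \<in> SX \<Longrightarrow> r \<in> SX \<Longrightarrow> q * r \<in> SX"
  by (rule is_subring_coeffs_in_mult[OF is_subring_S])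

lemmas SX_subgroup = add_group_coeffs_in(1)[OF S_subgroup]

lemma monom_in_SX: "s \<in> S \<Longrightarrow> monom s i \<in> SX"
  using S_zero by (auto simp: coeffs_in_def)

lemma const_in_SX: "s \<in> S \<Longrightarrow> [:s:] \<in> SX"
  using monom_in_SX[of s 0] by (simp add: monom_0)

lemma one_in_SX: "1 \<in> SX" "- 1 \<in> SX"
  using const_in_SX[OF S_one] const_in_SX[OF S_minus[OF S_one]] by (simp_all add: one_pCons)

lemma coeffs_in_pS_in_ideal:
  assumes P: "ring_ideal SX P" and pP: "[:of_nat p:] \<in> P" and q: "q \<in> coeffs_in pS"
  shows "q \<in> P"
proof -
  define w where "w = Polynomial.smult (inverse (of_nat p)) q"
  have p0: "(of_nat p :: 'a) \<noteq> 0" using p_power_nonzero[of 1] by simp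
  have "coeff w i \<in> S" for i
  proof -
    obtain s where "s \<in> S" "coeff q i = of_nat p * s"
      using q unfolding coeffs_in_def pS_def by auto
    then show ?thesis using p0 by (simp add: w_def mult.assoc[symmetric])
  qed
  then have "w \<in> SX" by (simp add: coeffs_in_def)
  moreover have "q = w * [:of_nat p:]" using p0 by (simp add: w_def)
  ultimately show ?thesis using P pP unfolding ring_ideal_def by blast
qed

text \<open>Modulo a prime ideal containing \<open>p\<close> and all \<open>t * y\<close>, the last coefficient of \<open>t\<close> whose
  multiples do not all vanish becomes invertible, so \<open>X\<close> is algebraic of degree less than \<open>g\<close>.\<close>

lemma monic_in_prime_ideal:
  fixes a b :: "nat \<Rightarrow> 'a"
  assumes ab: "\<And>i. i < g \<Longrightarrow> a i \<in> m \<and> b i \<in> inv_m" "(\<Sum>i<g. a i * b i) = 1"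
    and P: "ring_ideal SX P" "1 \<notin> P"
    and prime: "\<And>x y. x \<in> SX \<Longrightarrow> y \<in> SX \<Longrightarrow> x * y \<in> P \<Longrightarrow> x \<notin> P \<Longrightarrow> y \<in> P"
    and pP: "[:of_nat p:] \<in> P"
    and tP: "\<And>y. y \<in> coeffs_in inv_m \<Longrightarrow> (\<Sum>i<g. monom (a i) i) * y \<in> P"
  obtains f where "lead_coeff f = 1" "f \<in> SX" "f \<in> P" "degree f < g"
proof -
  have Pgrp: "add_group P" by (rule ring_ideal_add_group[OF P(1) one_in_SX(2)])
  have Pmult: "r * x \<in> P" if "r \<in> SX" "x \<in> P" for r x using P(1) that unfolding ring_ideal_def by blast
  have abS: "a i * y \<in> S" if "i < g" "y \<in> inv_m" for i y
    using ab(1)[OF that(1)] that(2) unfolding inv_m_def by (auto simp: mult.commute[of "a i"])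
  \<comment> \<open>Positions whose coefficient does not vanish modulo \<open>P\<close> on all of
    \<open>inv_m\<close>; there is one because the \<open>a i * b i\<close> sum to 1.\<close>
  define I where "I = {i. i < g \<and> (\<exists>y\<in>inv_m. [:a i * y:] \<notin> P)}"
  have "I \<noteq> {}"
  proof
    assume "I = {}"
    then have "[:a i * b i:] \<in> P" if "i < g" for i using ab(1)[OF that] that unfolding I_def by blast
    then have "(\<Sum>i<g. [:a i * b i:]) \<in> P" by (intro add_group_sum[OF Pgrp]) auto
    moreover have "(\<Sum>i<g. [:a i * b i:]) = [:\<Sum>i<g. a i * b i:]"
      by (induction g) auto
    ultimately show False using ab(2) P(2) by (simp add: one_pCons)
  qed
  moreover have finI: "finite I" unfolding I_def by simp
  ultimately have "Max I \<in> I" by (intro Max_in)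
  define i where "i = Max I"
  have i: "i \<in> I" unfolding i_def by fact
  have ig: "i < g" using i unfolding I_def by blast
  have above: "[:a l * y:] \<in> P" if "i < l" "l < g" "y \<in> inv_m" for l y
  proof (rule ccontr)
    assume "[:a l * y:] \<notin> P"
    then have "l \<in> I" using that unfolding I_def by blast
    then have "l \<le> i" unfolding i_def using finI by (rule Max_ge[rotated])
    then show False using that(1) by simp
  qed
  obtain y where y: "y \<in> inv_m" "[:a i * y:] \<notin> P" using i unfolding I_def by blast
  define c where "c = a i * y"
  have cS: "c \<in> S" unfolding c_def by (rule abS[OF ig y(1)])
  have cP: "[:c ^ k:] \<notin> P" for k
  proof (induction k)
    case 0
    then show ?case using P(2) by (simp add: one_pCons)
  next
    case (Suc k)
    then show ?case
      using prime[of "[:c ^ k:]" "[:c:]"] y(2) const_in_SX cS S_power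
      by (auto simp: c_def mult.commute)
  qed
  obtain u v where uv: "u < v" "c ^ v - c ^ u \<in> pS"
    using fin_mod_pigeonhole[OF fin_mod_S_pS pS_subgroup, of "\<lambda>j. c ^ j"] S_power[OF cS] by blast
  obtain k where k: "v = u + Suc k" using uv(1) less_imp_Suc_add by auto
  have "[:c ^ v - c ^ u:] \<in> P"
  proof (rule coeffs_in_pS_in_ideal[OF P(1) pP])
    show "[:c ^ v - c ^ u:] \<in> coeffs_in pS"
      using uv(2) add_groupD(1)[OF pS_subgroup]
      by (auto simp: coeffs_in_def coeff_pCons split: nat.splits)
  qed
  moreover have "[:c ^ v - c ^ u:] = [:c ^ u:] * [:c ^ Suc k - 1:]"
    by (simp add: k power_add algebra_simps)
  ultimately have ck: "[:c ^ Suc k - 1:] \<in> P"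
    using prime[of "[:c ^ u:]" "[:c ^ Suc k - 1:]"] cP const_in_SX S_power[OF cS]
      add_groupD(2)[OF S_subgroup] S_one by metis
  \<comment> \<open>\<open>c ^ Suc k\<close> is 1 modulo \<open>P\<close>, so \<open>d\<close>
    inverts \<open>c\<close> there.\<close>
  define d where "d = c ^ k"
  have dS: "d \<in> S" unfolding d_def by (rule S_power[OF cS])
  \<comment> \<open>Modulo \<open>P\<close> this is \<open>d * y * t\<close>, with \<open>t\<close>
    the polynomial with coefficients \<open>a l\<close>: terms above the last position
    \<open>i\<close> vanish and the one at \<open>i\<close> becomes \<open>X ^ i\<close>.\<close>
  define f where "f = monom 1 i + (\<Sum>l<i. monom (a l * y * d) l)"
  have cf: "coeff f l = (if l = i then 1 else if l < i then a l * y * d else 0)" for l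
    by (simp add: f_def coeff_sum_monom)
  have deg: "degree f \<le> i" by (rule degree_le) (simp add: cf)
  have "coeff f i = 1" by (simp add: cf)
  then have lc: "lead_coeff f = 1" using deg by (metis le_antisym le_degree one_neq_zero)
  have fS: "f \<in> SX"
    using ig abS[OF _ y(1)] dS S_one S_zero S_mult by (auto simp: coeffs_in_def cf)
  have "[:y:] \<in> coeffs_in inv_m"
    using y(1) add_groupD(1)[OF inv_m_subgroup] by (auto simp: coeffs_in_def coeff_pCons split: nat.splits)
  then have "[:d:] * ((\<Sum>l<g. monom (a l) l) * [:y:]) \<in> P"
    by (intro Pmult const_in_SX dS tP)
  also have "[:d:] * ((\<Sum>l<g. monom (a l) l) * [:y:]) = (\<Sum>l<g. monom (a l * y * d) l)"
    by (simp add: sum_distrib_left sum_distrib_right smult_monom mult_ac smult_sum2)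
  also have "(\<Sum>l<g. monom (a l * y * d) l) =
      (\<Sum>l<i. monom (a l * y * d) l) + monom (c * d) i + (\<Sum>l=Suc i..<g. monom (a l * y * d) l)"
  proof -
    have "{..<g} = {..<Suc i} \<union> {Suc i..<g}" using ig by auto
    then have "(\<Sum>l<g. monom (a l * y * d) l) =
        (\<Sum>l\<in>{..<Suc i} \<union> {Suc i..<g}. monom (a l * y * d) l)" by (simp only:)
    also have "\<dots> = (\<Sum>l<Suc i. monom (a l * y * d) l) + (\<Sum>l=Suc i..<g. monom (a l * y * d) l)"
      by (rule sum.union_disjoint) auto
    finally show ?thesis by (simp add: c_def)
  qed
  finally have sumP: "(\<Sum>l<i. monom (a l * y * d) l) + monom (c * d) i +
      (\<Sum>l=Suc i..<g. monom (a l * y * d) l) \<in> P" .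
  have "monom (a l * y * d) l \<in> P" if "l \<in> {Suc i..<g}" for l
  proof -
    have "monom d l * [:a l * y:] \<in> P"
      using that by (intro Pmult monom_in_SX dS above y(1)) auto
    then show ?thesis by (simp add: smult_monom mult_ac)
  qed
  then have "(\<Sum>l=Suc i..<g. monom (a l * y * d) l) \<in> P" by (rule add_group_sum[OF Pgrp])
  from add_groupD(2)[OF Pgrp sumP this]
  have 1: "(\<Sum>l<i. monom (a l * y * d) l) + monom (c * d) i \<in> P" by simp
  have "monom 1 i * [:c ^ Suc k - 1:] \<in> P" by (intro Pmult monom_in_SX S_one ck)
  then have 2: "monom (c * d) i - monom 1 i \<in> P"
    by (simp add: smult_monom d_def diff_monom)
  have "f \<in> P" using add_groupD(2)[OF Pgrp 1 2] by (simp add: f_def add.commute)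
  then show ?thesis using that lc fS deg ig by (meson le_less_trans)
qed

text \<open>Modulo \<open>P\<close> every power of \<open>X\<close> reduces to degree below
  \<open>g\<close>, with coefficients that matter only modulo \<open>p\<close>, so
  \<open>card U\<close> bounds the number of residues. The bound does not depend on
  \<open>P\<close>, which allows the polynomial of \<open>unimodular_combination\<close> to be fixed
  before \<open>P\<close> is known.\<close>

lemma monom_congruent_in_prime_ideal:
  assumes P: "ring_ideal SX P" "1 \<notin> P" and pP: "[:of_nat p:] \<in> P"
    and f: "lead_coeff f = 1" "f \<in> SX" "f \<in> P" "degree f < g"
    and U: "transversal (coeffs_lt g S) (coeffs_lt g pS) U"
  obtains u v where "u < v" "v \<le> card U" "monom 1 v - monom 1 u \<in> P"
proof -
  have Pgrp: "add_group P" by (rule ring_ideal_add_group[OF P(1) one_in_SX(2)])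
  have f0: "degree f \<noteq> 0"
  proof
    assume "degree f = 0"
    then have "f = 1" using f(1) by (auto elim!: degree_eq_zeroE)
    then show False using f(3) P(2) by simp
  qed
  have dm: "monom 1 j div f \<in> SX \<and> monom 1 j mod f \<in> SX" for j
    by (rule coeffs_in_div_mod[OF f(1) S_subgroup _ monom_in_SX[OF S_one]])
      (use f(2) S_mult in \<open>auto simp: coeffs_in_def\<close>)
  have "\<exists>h\<in>U. monom 1 j - h \<in> P" for j
  proof -
    have "degree (monom 1 j mod f) < degree f"
      using degree_mod_less[of f "monom 1 j"] f0 by fastforce
    then have "monom 1 j mod f \<in> coeffs_lt g S"
      using dm[of j] f(4) by (auto simp: coeffs_lt_def coeff_eq_0)
    then obtain h where h: "h \<in> U" "monom 1 j mod f - h \<in> coeffs_lt g pS"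
      using U unfolding transversal_def by blast
    have "monom 1 j mod f - h \<in> P"
      using h(2) by (intro coeffs_in_pS_in_ideal[OF P(1) pP]) (simp add: coeffs_lt_def)
    moreover have "(monom 1 j div f) * f \<in> P" using dm[of j] f(3) P(1) unfolding ring_ideal_def by blast
    ultimately have "(monom 1 j div f) * f + (monom 1 j mod f - h) \<in> P" by (intro add_groupD(4)[OF Pgrp])
    moreover have "(monom 1 j div f) * f + (monom 1 j mod f - h) = monom 1 j - h"
      by (simp add: add_diff_eq)
    ultimately show ?thesis using h(1) by metis
  qed
  then obtain h where h: "\<And>j. h j \<in> U \<and> monom 1 j - h j \<in> P" by metis
  have "\<not> inj_on h {..card U}"
  proof
    assume "inj_on h {..card U}"
    then have "card {..card U} \<le> card U"
      using h U unfolding transversal_def by (intro card_inj_on_le[of h]) auto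
    then show False by simp
  qed
  then obtain i j where ij: "i \<le> card U" "j \<le> card U" "i \<noteq> j" "h i = h j" unfolding inj_on_def by auto
  have d: "monom 1 v - monom 1 u \<in> P" if "h u = h v" for u v
    using add_groupD(2)[OF Pgrp, of "monom 1 v - h v" "monom 1 u - h u"] h[of u] h[of v] that by simp
  show ?thesis
  proof (cases "i < j")
    case True
    then show ?thesis using that[of i j] ij d[of i j] by auto
  next
    case False
    then show ?thesis using that[of j i] ij d[of j i] by auto
  qed
qed

text \<open>Nakayama's lemma for the \<open>S\<close>-module \<open>SX / J\<close>, which is
  generated by the powers of \<open>X\<close> below \<open>degree f\<close> and equals
  \<open>p\<close> times itself. Generators are removed from the top: \<open>X ^ k\<close> is
  \<open>p\<close> times a combination of powers up to \<open>k\<close>, and the factor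
  \<open>1 - p * s\<close> that collects in front of \<open>X ^ k\<close> is a unit of
  \<open>S\<close>.\<close>

lemma eliminate_generators:
  assumes J: "ring_ideal SX J" and f: "lead_coeff f = 1" "f \<in> SX" "f \<in> J"
    and e: "1 - [:of_nat p:] * w \<in> J" "w \<in> SX"
  shows "1 \<in> J"
proof -
  have Jgrp: "add_group J" by (rule ring_ideal_add_group[OF J one_in_SX(2)])
  have Jmult: "r * x \<in> J" if "r \<in> SX" "x \<in> J" for r x using J that unfolding ring_ideal_def by blast
  have "\<forall>q\<in>SX. \<exists>r\<in>coeffs_lt k S. q - r \<in> J" if "k \<le> degree f" for k
    using that
  proof (induction k rule: inc_induct)
    case base
    show ?case
    proof
      fix q assume q: "q \<in> SX"
      have dm: "q div f \<in> SX \<and> q mod f \<in> SX"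
        by (rule coeffs_in_div_mod[OF f(1) S_subgroup _ q]) (use f(2) S_mult in \<open>auto simp: coeffs_in_def\<close>)
      have "coeff (q mod f) i = 0" if "degree f \<le> i" for i
      proof (cases "q mod f = 0")
        case False
        then have "degree (q mod f) < i" using degree_mod_less[of f q] f(1) that by fastforce
        then show ?thesis by (rule coeff_eq_0)
      qed simp
      then have "q mod f \<in> coeffs_lt (degree f) S" using dm by (simp add: coeffs_lt_def)
      moreover have "q - q mod f \<in> J"
        using Jmult[OF conjunct1[OF dm] f(3)] by (simp add: minus_mod_eq_div_mult)
      ultimately show "\<exists>r\<in>coeffs_lt (degree f) S. q - r \<in> J" by blast
    qed
  next
    case (step k)
    have split: "\<exists>s r'. s \<in> S \<and> r' \<in> coeffs_lt k S \<and> r = r' + monom s k"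
      if r: "r \<in> coeffs_lt (Suc k) S" for r
    proof (intro exI conjI)
      let ?s = "coeff r k"
      show "?s \<in> S" using r by (simp add: coeffs_lt_def coeffs_in_def)
      show "r = (r - monom ?s k) + monom ?s k" by simp
      have "coeff r i = 0" if "k < i" for i using r that by (simp add: coeffs_lt_def)
      then show "r - monom ?s k \<in> coeffs_lt k S"
        using r S_zero by (auto simp: coeffs_lt_def coeffs_in_def Suc_le_eq le_less)
    qed
    have Xk: "monom 1 k \<in> SX" by (rule monom_in_SX[OF S_one])
    obtain r where r: "r \<in> coeffs_lt (Suc k) S" "monom 1 k * w - r \<in> J"
      using step.IH SX_mult[OF Xk e(2)] by blast
    obtain s r' where sr: "s \<in> S" "r' \<in> coeffs_lt k S" "r = r' + monom s k" using split[OF r(1)] by blast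
    define v where "v = inverse (1 - of_nat p * s)"
    have v: "v \<in> S" "v * (1 - of_nat p * s) = 1"
      unfolding v_def using inverse_one_minus_p_mult[OF sr(1)] by auto
    define r0 where "r0 = [:v * of_nat p:] * r'"
    have r0: "r0 \<in> coeffs_lt k S"
      using sr(2) S_mult[OF S_mult[OF v(1) p_in_S]] unfolding r0_def
      by (auto simp: coeffs_lt_def coeffs_in_def)
    have "monom 1 k * (1 - [:of_nat p:] * w) + [:of_nat p:] * (monom 1 k * w - r) \<in> J"
      by (intro add_groupD(4)[OF Jgrp] Jmult Xk e(1) r(2) const_in_SX p_in_S)
    moreover have "monom 1 k * (1 - [:of_nat p:] * w) + [:of_nat p:] * (monom 1 k * w - r) =
        monom 1 k - [:of_nat p:] * r"
      by (simp add: algebra_simps)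
    ultimately have "[:v:] * (monom 1 k - [:of_nat p:] * r) \<in> J"
      using Jmult[OF const_in_SX[OF v(1)]] by metis
    moreover have "[:v:] * (monom 1 k - [:of_nat p:] * r) = monom 1 k - r0"
    proof -
      have "monom v k - monom (v * (of_nat p * s)) k = monom (v * (1 - of_nat p * s)) k"
        by (simp add: right_diff_distrib diff_monom)
      then have one: "monom v k - monom (v * (of_nat p * s)) k = monom 1 k" using v(2) by simp
      have "[:v:] * (monom 1 k - [:of_nat p:] * r) = (monom v k - monom (v * (of_nat p * s)) k) - r0"
        unfolding r0_def sr(3)
        by (simp add: smult_monom smult_diff_right smult_add_right mult.assoc)
      then show ?thesis by (simp only: one)
    qed
    ultimately have key: "monom 1 k - r0 \<in> J" by simp
    show ?case
    proof
      fix q assume "q \<in> SX"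
      then obtain r1 where r1: "r1 \<in> coeffs_lt (Suc k) S" "q - r1 \<in> J" using step.IH by blast
      obtain s1 r1' where s1: "s1 \<in> S" "r1' \<in> coeffs_lt k S" "r1 = r1' + monom s1 k"
        using split[OF r1(1)] by blast
      have "(q - r1) + [:s1:] * (monom 1 k - r0) \<in> J"
        by (intro add_groupD(4)[OF Jgrp] r1(2) Jmult const_in_SX s1(1) key)
      moreover have "(q - r1) + [:s1:] * (monom 1 k - r0) = q - (r1' + [:s1:] * r0)"
        by (simp add: s1(3) smult_monom smult_diff_right)
      moreover have "[:s1:] * r0 \<in> coeffs_lt k S"
        using r0 s1(1) S_mult by (auto simp: coeffs_lt_def coeffs_in_def)
      then have "r1' + [:s1:] * r0 \<in> coeffs_lt k S"
        by (intro add_groupD(4)[OF add_group_coeffs_in(2)[OF S_subgroup]] s1(2))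
      ultimately show "\<exists>r\<in>coeffs_lt k S. q - r \<in> J" by metis
    qed
  qed
  from this[of 0] obtain r where "r \<in> coeffs_lt 0 S" "1 - r \<in> J" using one_in_SX(1) by auto
  moreover from this have "r = 0" by (simp add: coeffs_lt_def poly_eq_iff)
  ultimately show ?thesis by simp
qed

end

text \<open>Builds ideals by adding one family of multiples at a time. \<open>Y\<close> may lie
  outside \<open>A\<close>, as for coefficients in the fractional ideal \<open>inv_m\<close>; only
  the products \<open>t * y\<close> have to be in \<open>A\<close>.\<close>

lemma ring_ideal_plus:
  assumes "ring_ideal A J" "\<And>x y. x \<in> A \<Longrightarrow> y \<in> A \<Longrightarrow> x + y \<in> A"
    and Y: "add_group Y" "\<And>r y. r \<in> A \<Longrightarrow> y \<in> Y \<Longrightarrow> r * y \<in> Y" "\<And>y. y \<in> Y \<Longrightarrow> t * y \<in> A"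
  shows "ring_ideal A {t * y + e | y e. y \<in> Y \<and> e \<in> J}" (is "ring_ideal A ?J")
proof -
  have J: "J \<subseteq> A" "0 \<in> J" "\<And>c d. c \<in> J \<Longrightarrow> d \<in> J \<Longrightarrow> c + d \<in> J"
    "\<And>r c. r \<in> A \<Longrightarrow> c \<in> J \<Longrightarrow> r * c \<in> J"
    using assms(1) unfolding ring_ideal_def by auto
  show ?thesis
    unfolding ring_ideal_def
  proof (intro conjI ballI)
    show "?J \<subseteq> A" using assms(2) J(1) Y(3) by blast
    have "t * 0 + 0 \<in> ?J" using J(2) add_groupD(1)[OF Y(1)] by blast
    then show "0 \<in> ?J" by simp
    fix c d assume "c \<in> ?J" "d \<in> ?J"
    then obtain y1 e1 y2 e2 where *: "y1 \<in> Y" "e1 \<in> J" "y2 \<in> Y" "e2 \<in> J" "c = t * y1 + e1" "d = t * y2 + e2"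
      by blast
    have "c + d = t * (y1 + y2) + (e1 + e2)" using * by (simp add: algebra_simps)
    then show "c + d \<in> ?J" using * J(3) add_groupD(4)[OF Y(1)] by blast
  next
    fix r c assume r: "r \<in> A" and "c \<in> ?J"
    then obtain y e where *: "y \<in> Y" "e \<in> J" "c = t * y + e" by blast
    have "r * c = t * (r * y) + r * e" using * by (simp add: algebra_simps)
    then show "r * c \<in> ?J" using * J(4)[OF r] Y(2)[OF r] by blast
  qed
qed

context local_number_ring begin

text \<open>The exponents make \<open>f\<close> congruent to \<open>1\<close> wherever two powers \<open>X^u\<close>, \<open>X^v\<close> with
  \<open>u < v \<le> Q\<close> coincide.\<close>

lemma unimodular_combination:
  obtains t y z f where "t \<in> coeffs_in m" "y \<in> coeffs_in inv_m" "z \<in> SX"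
    "lead_coeff f = 1" "f \<in> coeffs_in \<int>" "0 < degree f" "t * y + f * z = 1"
proof -
  obtain g :: nat and a b where ab: "(\<Sum>i<g. a i * b i) = 1" "\<forall>i<g. a i \<in> m \<and> b i \<in> inv_m"
    using one_in_m_inv_m unfolding ideal_mult_set_def by auto
  obtain n where n: "has_index S pS n" by (rule fin_mod_has_index[OF pS_subgroup fin_mod_S_pS]) (rule that)
  obtain U where U: "transversal (coeffs_lt g S) (coeffs_lt g pS) U"
    using has_index_coeffs_lt[OF n S_zero add_groupD(1)[OF pS_subgroup], of g]
    unfolding has_index_def by blast
  \<comment> \<open>\<open>Q\<close> bounds the exponents of coinciding powers of \<open>X\<close>,
    and \<open>v - u\<close> divides \<open>fact Q\<close> whenever \<open>u < v\<close> and
    \<open>v\<close> is at most \<open>Q\<close>.\<close>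
  define Q where "Q = card U"
  define N where "N = Q + fact Q"
  have N: "Q < N" by (simp add: N_def)
  define f :: "'a poly" where "f = monom 1 N - monom 1 Q + 1"
  have cf: "coeff f l = (if l = N then 1 else 0) - (if l = Q then 1 else 0) + (if l = 0 then 1 else 0)" for l
    by (auto simp: f_def)
  have deg: "degree f \<le> N" by (rule degree_le) (use N in \<open>auto simp: cf\<close>)
  have "coeff f N = 1" using N by (simp add: cf)
  then have degN: "degree f = N" using deg by (metis le_antisym le_degree one_neq_zero)
  then have lc: "lead_coeff f = 1" using \<open>coeff f N = 1\<close> by simp
  have fZ: "f \<in> coeffs_in \<int>" by (auto simp: coeffs_in_def cf)
  have fS: "f \<in> SX"
    using fZ R_of_int R_subset_S by (auto simp: coeffs_in_def elim!: Ints_cases) (metis Ints_cases subsetD)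
  define t where "t = (\<Sum>i<g. monom (a i) i)"
  have ct: "coeff t l = (if l < g then a l else 0)" for l
    unfolding t_def by (simp add: coeff_sum_monom)
  have tm: "t \<in> coeffs_in m" using ab(2) m_zero by (auto simp: coeffs_in_def ct)
  note NX = add_group_coeffs_in(1)[OF inv_m_subgroup]
  have NX_mult: "r * y \<in> coeffs_in inv_m" if "r \<in> SX" "y \<in> coeffs_in inv_m" for r y
    by (rule coeffs_in_mult[OF _ _ _ that])
      (auto intro: add_groupD[OF inv_m_subgroup] inv_m_smult)
  have m_inv: "x * y \<in> S" if "x \<in> m" "y \<in> inv_m" for x y
    using that unfolding inv_m_def by (auto simp: mult.commute[of x])
  have tNX: "t * y \<in> SX" if "y \<in> coeffs_in inv_m" for y
    by (rule coeffs_in_mult[OF S_zero S_add m_inv tm that])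
  have SX_add: "x + y \<in> SX" if "x \<in> SX" "y \<in> SX" for x y
    using add_groupD(4)[OF SX_subgroup] that by blast
  \<comment> \<open>The ideal \<open>t inv_m[X] + f S[X]\<close>, in the nested form that
    \<open>ring_ideal_plus\<close> produces from \<open>{0}\<close>.\<close>
  define J where "J = {t * y + e | y e. y \<in> coeffs_in inv_m \<and> e \<in> {f * z + e | z e. z \<in> SX \<and> e \<in> {0}}}"
  have zero_ideal: "ring_ideal SX {0}"
    using add_groupD(1)[OF SX_subgroup] by (simp add: ring_ideal_def)
  have J: "ring_ideal SX J"
    unfolding J_def
    by (intro ring_ideal_plus zero_ideal SX_add SX_subgroup SX_mult fS NX NX_mult tNX)
  have zeroX: "0 \<in> coeffs_in inv_m" "0 \<in> SX" using add_groupD(1)[OF NX] add_groupD(1)[OF SX_subgroup] by auto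
  have tJ: "t * y \<in> J" if "y \<in> coeffs_in inv_m" for y
  proof -
    have "t * y + (f * 0 + 0) \<in> J" using that zeroX unfolding J_def by blast
    then show ?thesis by simp
  qed
  have fJ: "f \<in> J"
  proof -
    have "t * 0 + (f * 1 + 0) \<in> J" using one_in_SX(1) zeroX unfolding J_def by blast
    then show ?thesis by simp
  qed
  \<comment> \<open>With \<open>p\<close> added, only prime ideals containing \<open>p\<close> have
    to be excluded, and there the coefficients live in quotients of the finite ring
    \<open>S / p S\<close>; afterwards \<open>eliminate_generators\<close> removes \<open>p\<close>
    again.\<close>
  define J' where "J' = {[:of_nat p:] * w + e | w e. w \<in> SX \<and> e \<in> J}"
  have J': "ring_ideal SX J'"
    unfolding J'_def
    by (intro ring_ideal_plus J SX_add SX_subgroup SX_mult const_in_SX p_in_S)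
  have JJ': "J \<subseteq> J'"
  proof
    fix e assume "e \<in> J"
    then have "[:of_nat p:] * 0 + e \<in> J'" using zeroX unfolding J'_def by blast
    then show "e \<in> J'" by simp
  qed
  have pJ': "[:of_nat p:] \<in> J'"
  proof -
    have "[:of_nat p:] * 1 + 0 \<in> J'"
      using one_in_SX(1) J unfolding J'_def ring_ideal_def by blast
    then show ?thesis by simp
  qed
  have "1 \<in> J'"
  proof (rule ccontr)
    assume "1 \<notin> J'"
    obtain P where P: "ring_ideal SX P" "J' \<subseteq> P" "1 \<notin> P"
      "\<And>J''. ring_ideal SX J'' \<Longrightarrow> P \<subseteq> J'' \<Longrightarrow> 1 \<notin> J'' \<Longrightarrow> J'' = P"
      by (rule ring_ideal_maximal[OF J' \<open>1 \<notin> J'\<close> one_in_SX(1)]) (rule that)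
    have prime: "y \<in> P" if "x \<in> SX" "y \<in> SX" "x * y \<in> P" "x \<notin> P" for x y
      by (rule maximal_ring_ideal_prime[OF zeroX(2) one_in_SX(1) _ P(1,4) that])
        (auto intro: SX_add SX_mult)
    have Pgrp: "add_group P" by (rule ring_ideal_add_group[OF P(1) one_in_SX(2)])
    have Pmult: "monom 1 i * x \<in> P" if "x \<in> P" for i x
      using P(1) that monom_in_SX[OF S_one] unfolding ring_ideal_def by blast
    have pP: "[:of_nat p:] \<in> P" using pJ' P(2) by blast
    have tP: "(\<Sum>i<g. monom (a i) i) * y \<in> P" if "y \<in> coeffs_in inv_m" for y
      using tJ[OF that] JJ' P(2) unfolding t_def by blast
    have ab': "a i \<in> m \<and> b i \<in> inv_m" if "i < g" for i using ab(2) that by blast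
    obtain h where h: "lead_coeff h = 1" "h \<in> SX" "h \<in> P" "degree h < g"
      by (rule monic_in_prime_ideal[OF ab' ab(1) P(1,3) prime pP tP]) (blast intro: that)+
    obtain u v where uv: "u < v" "v \<le> card U" "monom 1 v - monom 1 u \<in> P"
      by (rule monom_congruent_in_prime_ideal[OF P(1,3) pP h U]) (rule that)
    have iter: "monom 1 (u + (v - u) * e) - monom 1 u \<in> P" for e
    proof (induction e)
      case 0
      then show ?case using add_groupD(1)[OF Pgrp] by simp
    next
      case (Suc e)
      have "monom 1 ((v - u) * e) * (monom 1 v - monom 1 u) + (monom 1 (u + (v - u) * e) - monom 1 u) \<in> P"
        by (intro add_groupD(4)[OF Pgrp] Pmult uv Suc.IH)
      moreover have "monom 1 ((v - u) * e) * (monom 1 v - monom 1 u) + (monom 1 (u + (v - u) * e) - monom 1 u) =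
          (monom 1 ((v - u) * e + v) - monom 1 u :: 'a poly)"
        by (simp add: right_diff_distrib mult_monom add.commute)
      moreover have "(v - u) * e + v = u + (v - u) * Suc e" using uv(1) by simp
      ultimately show ?case by simp
    qed
    note uv = uv[folded Q_def]
    have "v - u dvd fact Q" using uv by (intro dvd_fact) auto
    then obtain e where e: "fact Q = (v - u) * e" by auto
    \<comment> \<open>Shifting by \<open>Q - u\<close> makes \<open>X ^ N\<close> and
      \<open>X ^ Q\<close> congruent, so \<open>f\<close> is 1 modulo \<open>P\<close>.\<close>
    have "monom 1 (Q - u) * (monom 1 (u + (v - u) * e) - monom 1 u) \<in> P" by (intro Pmult iter)
    moreover have "monom 1 (Q - u) * (monom 1 (u + (v - u) * e) - monom 1 u) = (monom 1 N - monom 1 Q :: 'a poly)"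
      using uv by (simp add: right_diff_distrib mult_monom N_def e)
    ultimately have "monom 1 N - monom 1 Q \<in> P" by simp
    moreover have "f \<in> P" using fJ JJ' P(2) by blast
    ultimately have "f - (monom 1 N - monom 1 Q) \<in> P" by (rule add_groupD(2)[OF Pgrp, rotated])
    then show False using P(3) by (simp add: f_def)
  qed
  then obtain w e where we: "1 = [:of_nat p:] * w + e" "w \<in> SX" "e \<in> J" unfolding J'_def by blast
  have "1 - [:of_nat p:] * w = e" unfolding we(1) by simp
  then have "1 \<in> J" using eliminate_generators[OF J lc fS fJ _ we(2)] we(3) by simp
  then obtain y z where "y \<in> coeffs_in inv_m" "z \<in> SX" "1 = t * y + (f * z + 0)" unfolding J_def by blast
  then show ?thesis using that[OF tm _ _ lc fZ] degN N by (metis add_0_right gr_implies_not0 neq0_conv)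
qed

section \<open>Comparison of the two indices modulo \<open>f\<close>\<close>

text \<open>Multiplication by \<open>t\<close> modulo \<open>f\<close> on polynomials of degree less than \<open>N\<close> has the same index on
  \<open>I\<close>- as on \<open>S\<close>-coefficients; it maps onto the \<open>m S\<close>-coefficients and into the \<open>m I\<close>-coefficients.\<close>

lemma index_le:
  assumes I: "ideal_of R I" "I \<noteq> {0}"
  obtains a b where "has_index I (ideal_mult_set m I) a" "has_index S (ideal_mult_set m S) b" "a \<le> b"
proof -
  let ?mI = "ideal_mult_set m I" and ?mS = "ideal_mult_set m S"
  have I': "I \<subseteq> R" "0 \<in> I" "\<And>r x. r \<in> R \<Longrightarrow> x \<in> I \<Longrightarrow> r * x \<in> I"
    and I_add: "\<And>x y. x \<in> I \<Longrightarrow> y \<in> I \<Longrightarrow> x + y \<in> I"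
    using I(1) unfolding ideal_of_def by auto
  have Igrp: "add_group I"
    unfolding add_group_def
  proof (intro conjI ballI I'(2))
    fix x y assume "x \<in> I" "y \<in> I"
    then have "x + (- 1) * y \<in> I" by (intro I_add I'(3) R_minus R_one)
    then show "x - y \<in> I" by simp
  qed
  have mIgrp: "add_group ?mI" and mSgrp: "add_group ?mS"
    by (intro add_group_ideal_mult_set Igrp S_subgroup)+
  have mI_I: "?mI \<subseteq> I" by (rule ideal_mult_subset[OF Igrp]) (auto intro: I'(3) m_in_R)
  have mS_S: "?mS \<subseteq> S"
    by (rule ideal_mult_subset[OF S_subgroup]) (use R_subset_S m_in_R S_mult in blast)
  have IS: "I \<subseteq> S" using I'(1) R_subset_S by blast
  obtain M where M: "\<And>s. s \<in> S \<Longrightarrow> of_nat p ^ M * s \<in> R" by (rule conductor) (rule that)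
  obtain x where x: "x \<in> I" "x \<noteq> 0" using I(2) I'(2) by blast
  obtain k y where ky: "y \<in> R" "x * y = of_nat p ^ k"
    by (rule divides_power_p[of x]) (use x I'(1) that in auto)
  have pkI: "of_nat p ^ k \<in> I" using I'(3)[OF ky(1) x(1)] ky(2) by (simp add: mult.commute)
  have fin_power: "fin_mod S ((\<lambda>x. of_nat p ^ l * x) ` S)" for l
    using fin_mod_power_multiple[OF S_subgroup] fin_mod_S_pS unfolding pS_def by blast
  \<comment> \<open>\<open>I\<close> contains a power of \<open>p\<close>, so together with the
    conductor it contains all multiples of \<open>S\<close> by a higher one.\<close>
  have in_I: "of_nat p ^ (k + M) * s \<in> I" if "s \<in> S" for s
    using I'(3)[OF M[OF that] pkI] by (simp add: power_add mult_ac)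
  have in_mI: "of_nat p ^ Suc (k + M) * s \<in> ?mI" if "s \<in> S" for s
    using ideal_mult_product[OF p_in_m in_I[OF that]] by (simp add: mult.assoc)
  have "fin_mod S ?mI"
    by (rule fin_mod_mono[OF fin_power[of "Suc (k + M)"] order_refl]) (use in_mI in blast)
  then have fin: "fin_mod S I" "fin_mod I ?mI" "fin_mod S ?mS"
    using fin_mod_mono[of S ?mI] mI_I IS
      ideal_mult_subset[OF mSgrp, of m I] ideal_mult_product[of _ m _ S] by (blast intro: order_refl)+
  obtain a where a: "has_index I ?mI a" by (rule fin_mod_has_index[OF mIgrp fin(2)]) (rule that)
  obtain b where b: "has_index S ?mS b" by (rule fin_mod_has_index[OF mSgrp fin(3)]) (rule that)
  obtain c where c: "has_index S I c" by (rule fin_mod_has_index[OF Igrp fin(1)]) (rule that)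
  obtain t y z f where tyzf: "t \<in> coeffs_in m" "y \<in> coeffs_in inv_m" "z \<in> SX"
    "lead_coeff f = 1" "f \<in> coeffs_in \<int>" "0 < degree f" "t * y + f * z = 1"
    by (rule unimodular_combination) (rule that)
  define N where "N = degree f"
  define \<phi> where "\<phi> q = (t * q) mod f" for q
  have modf: "q mod f \<in> coeffs_lt N M" if "q \<in> coeffs_in M" "add_group M" for q M
  proof -
    have "q mod f \<in> coeffs_in M"
    proof (rule conjunct2[OF coeffs_in_div_mod[OF tyzf(4) that(2) _ that(1)]])
      fix i x assume "x \<in> M"
      moreover obtain k where "coeff f i = of_int k"
        using tyzf(5) unfolding coeffs_in_def by (blast elim: Ints_cases)
      ultimately show "coeff f i * x \<in> M" using add_group_of_int_mult[OF that(2)] by simp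
    qed
    moreover have "degree (q mod f) < N" using degree_mod_less[of f q] tyzf(6) unfolding N_def by fastforce
    then have "coeff (q mod f) i = 0" if "N \<le> i" for i using that by (intro coeff_eq_0) simp
    ultimately show ?thesis by (simp add: coeffs_lt_def)
  qed
  have \<phi>_in: "\<phi> q \<in> coeffs_lt N (ideal_mult_set m M)" if "q \<in> coeffs_lt N M" "add_group M" for q M
  proof -
    have "t * q \<in> coeffs_in (ideal_mult_set m M)"
      using that by (intro coeffs_in_mult[OF _ _ _ tyzf(1), of _ M])
        (auto intro: ideal_mult_zero ideal_mult_add ideal_mult_product simp: coeffs_lt_def)
    then show ?thesis unfolding \<phi>_def by (intro modf add_group_ideal_mult_set that(2))
  qed
  have \<phi>_diff: "\<phi> (q - r) = \<phi> q - \<phi> r" for q r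
    unfolding \<phi>_def by (simp add: right_diff_distrib poly_mod_diff_left)
  have deg: "degree q < N \<or> q = 0" if "\<And>i. N \<le> i \<Longrightarrow> coeff q i = 0" for q :: "'a poly"
    using that tyzf(6) by (metis leading_coeff_0_iff not_le)
  have inj: "inj_on \<phi> (coeffs_lt N S)"
  proof (rule inj_onI)
    fix q r assume qr: "q \<in> coeffs_lt N S" "r \<in> coeffs_lt N S" "\<phi> q = \<phi> r"
    then have "f dvd t * (q - r)" using \<phi>_diff[of q r] unfolding \<phi>_def by (simp add: mod_eq_0_iff_dvd)
    \<comment> \<open>\<open>y\<close> inverts \<open>t\<close> modulo \<open>f\<close>;
      divisibility is over the field, so coefficients of \<open>y\<close> outside \<open>S\<close>
      do no harm.\<close>
    then have "f dvd y * (t * (q - r)) + f * (z * (q - r))" by simp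
    also have "y * (t * (q - r)) + f * (z * (q - r)) = (t * y + f * z) * (q - r)"
      by (simp add: algebra_simps)
    finally have "f dvd q - r" unfolding tyzf(7) by simp
    moreover have "degree (q - r) < N \<or> q - r = 0" using qr by (intro deg) (auto simp: coeffs_lt_def)
    ultimately have "q - r = 0" unfolding N_def by (meson dvd_imp_degree_le not_le)
    then show "q = r" by simp
  qed
  have onto: "\<phi> ` coeffs_lt N S = coeffs_lt N ?mS"
  proof
    show "\<phi> ` coeffs_lt N S \<subseteq> coeffs_lt N ?mS" using \<phi>_in S_subgroup by blast
    \<comment> \<open>The preimage of \<open>w\<close> is \<open>y * w\<close> modulo
      \<open>f\<close>; its coefficients lie in \<open>S\<close> because \<open>inv_m\<close>
      multiplies \<open>m S\<close> into \<open>S\<close>.\<close>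
    show "coeffs_lt N ?mS \<subseteq> \<phi> ` coeffs_lt N S"
    proof
      fix w assume w: "w \<in> coeffs_lt N ?mS"
      have "v * x \<in> S" if v: "v \<in> inv_m" and x: "x \<in> ?mS" for v x
      proof -
        obtain n :: nat and c d where cd: "x = (\<Sum>i<n. c i * d i)" "\<forall>i<n. c i \<in> m \<and> d i \<in> S"
          using x unfolding ideal_mult_set_def by auto
        have "v * x = (\<Sum>i<n. (v * c i) * d i)" unfolding cd(1) by (simp add: sum_distrib_left mult.assoc)
        also have "\<dots> \<in> S"
          using cd(2) v unfolding inv_m_def
          by (intro add_group_sum[OF S_subgroup] S_mult[of "v * c i" for i]) auto
        finally show ?thesis .
      qed
      then have "y * w \<in> SX"
        using w by (intro coeffs_in_mult[OF S_zero S_add _ tyzf(2), of ?mS]) (auto simp: coeffs_lt_def)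
      then have "(y * w) mod f \<in> coeffs_lt N S" by (intro modf S_subgroup)
      moreover have "\<phi> ((y * w) mod f) = w"
      proof -
        have "\<phi> ((y * w) mod f) = (t * (y * w)) mod f" unfolding \<phi>_def by (simp add: mod_mult_right_eq)
        also have "t * (y * w) = (t * y) * w" by (simp only: mult.assoc)
        also have "t * y = 1 - f * z" using tyzf(7) by (simp add: eq_diff_eq)
        also have "(1 - f * z) * w = w + f * (- (z * w))" by (simp add: algebra_simps)
        also have "\<dots> mod f = w mod f" by (rule mod_mult_self2)
        also have "\<dots> = w" using deg[of w] w unfolding N_def by (auto simp: coeffs_lt_def mod_poly_less)
        finally show ?thesis .
      qed
      ultimately show "w \<in> \<phi> ` coeffs_lt N S" by force
    qed
  qed
  let ?GI = "coeffs_lt N I" and ?GS = "coeffs_lt N S"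
  note G = add_group_coeffs_in(2)
  have GI_GS: "?GI \<subseteq> ?GS" using IS unfolding coeffs_lt_def coeffs_in_def by blast
  have \<phi>grp: "add_group (\<phi> ` ?GI)"
    unfolding add_group_def
  proof (intro conjI ballI)
    show "0 \<in> \<phi> ` ?GI" using add_groupD(1)[OF G[OF Igrp]] by (intro image_eqI[of _ _ 0]) (auto simp: \<phi>_def)
    fix q r assume "q \<in> \<phi> ` ?GI" "r \<in> \<phi> ` ?GI"
    then obtain q' r' where *: "q' \<in> ?GI" "r' \<in> ?GI" "q = \<phi> q'" "r = \<phi> r'" by blast
    have "q' - r' \<in> ?GI" by (rule add_groupD(2)[OF G[OF Igrp] *(1,2)])
    then show "q - r \<in> \<phi> ` ?GI" using * \<phi>_diff by (intro image_eqI[of _ _ "q' - r'"]) auto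
  qed
  have GmS_GS: "coeffs_lt N ?mS \<subseteq> ?GS" using mS_S unfolding coeffs_lt_def coeffs_in_def by blast
  have \<phi>GI: "\<phi> ` ?GI \<subseteq> coeffs_lt N ?mI" using \<phi>_in Igrp by blast
  have GmI_GI: "coeffs_lt N ?mI \<subseteq> ?GI" using mI_I unfolding coeffs_lt_def coeffs_in_def by blast
  have i1: "has_index ?GS ?GI (c ^ N)" by (rule has_index_coeffs_lt[OF c S_zero I'(2)])
  have i2: "has_index ?GS (coeffs_lt N ?mS) (b ^ N)"
    by (rule has_index_coeffs_lt[OF b S_zero ideal_mult_zero])
  have i3: "has_index ?GI (coeffs_lt N ?mI) (a ^ N)"
    by (rule has_index_coeffs_lt[OF a I'(2) ideal_mult_zero])
  have "has_index (\<phi> ` ?GS) (\<phi> ` ?GI) (c ^ N)"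
    by (rule has_index_image[OF i1 inj GI_GS G[OF S_subgroup] \<phi>_diff])
  \<comment> \<open>The index of the image of \<open>?GI\<close> in \<open>?GS\<close> is computed
    along two chains, through the image of \<open>?GS\<close> here and through \<open>?GI\<close>
    below; cancelling the positive factor \<open>c ^ N\<close> leaves
    \<open>d = b ^ N\<close>.\<close>
  then have i4: "has_index ?GS (\<phi> ` ?GI) (b ^ N * c ^ N)"
    using onto GI_GS i2 by (intro has_index_trans[OF G[OF S_subgroup] G[OF mSgrp] \<phi>grp _ GmS_GS i2]) auto
  have "fin_mod ?GI (\<phi> ` ?GI)"
    by (rule fin_mod_mono[OF has_index_fin_mod[OF i4] GI_GS order_refl])
  then obtain d where d: "has_index ?GI (\<phi> ` ?GI) d" using fin_mod_has_index[OF \<phi>grp] by blast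
  have "has_index ?GS (\<phi> ` ?GI) (c ^ N * d)"
    by (rule has_index_trans[OF G[OF S_subgroup] G[OF Igrp] \<phi>grp _ GI_GS i1 d]) (use \<phi>GI GmI_GI in blast)
  then have "c ^ N * d = b ^ N * c ^ N" using has_index_unique[OF \<phi>grp _ i4] by blast
  moreover have "0 < c" using has_index_pos[OF c S_zero] .
  ultimately have "d = b ^ N" by simp
  moreover have "a ^ N \<le> d" by (rule has_index_antimono[OF G[OF mIgrp] d i3 \<phi>GI])
  ultimately have "a ^ N \<le> b ^ N" by simp
  then have "a \<le> b" using tyzf(6) power_mono_iff[of a b N] unfolding N_def by simp
  then show ?thesis using that a b by blast
qed

end

subsection \<open>Numbers of generators\<close>

definition residually_spans :: "'a::field set \<Rightarrow> 'a set \<Rightarrow> 'a set \<Rightarrow> 'a set \<Rightarrow> bool" where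
  "residually_spans R m M X \<longleftrightarrow> finite X \<and> X \<subseteq> M \<and>
    M \<subseteq> {x + y | x y. x \<in> R_span R X \<and> y \<in> ideal_mult_set m M}"

text \<open>Infinite dimensions are included: if \<open>M'\<close> has no finite spanning set, the
  infimum on the right runs over the empty set and is infinite.\<close>

lemma residue_dim_mono:
  assumes "\<And>X. residually_spans R m M' X \<Longrightarrow> \<exists>Y. residually_spans R m M Y \<and> card Y \<le> card X"
  shows "residue_dim R m M \<le> residue_dim R m M'"
  unfolding residue_dim_def residually_spans_def[symmetric]
proof (rule Inf_greatest)
  fix e assume "e \<in> {enat (card X) | X. residually_spans R m M' X}"
  then obtain X where X: "e = enat (card X)" "residually_spans R m M' X" by blast
  obtain Y where Y: "residually_spans R m M Y" "card Y \<le> card X" using assms[OF X(2)] by blast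
  have "enat (card Y) \<in> {enat (card X) | X. residually_spans R m M X}" using Y(1) by blast
  then show "Inf {enat (card X) | X. residually_spans R m M X} \<le> e"
    by (rule Inf_lower2) (simp add: X(1) Y(2))
qed

lemma residually_spans_zero: "residually_spans R m {0} {}"
  unfolding residually_spans_def R_span_def using ideal_mult_zero by auto

context local_subring begin

text \<open>Coefficients of a combination matter only modulo \<open>m\<close>, so those from a
  transversal of \<open>R\<close> modulo \<open>m\<close> already cover \<open>M\<close> modulo
  \<open>m M\<close>.\<close>

lemma index_le_power_card:
  assumes M: "add_group M" "\<And>r x. r \<in> R \<Longrightarrow> x \<in> M \<Longrightarrow> r * x \<in> M"
    and q: "has_index R m q" and b: "has_index M (ideal_mult_set m M) b"
    and X: "residually_spans R m M X"
  shows "b \<le> q ^ card X"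
proof -
  let ?mM = "ideal_mult_set m M"
  have mM: "add_group ?mM" by (rule add_group_ideal_mult_set[OF M(1)])
  obtain T where T: "transversal R m T" "card T = q" using q unfolding has_index_def by blast
  have T': "T \<subseteq> R" "finite T" using T(1) by (simp_all add: transversal_def)
  have X': "finite X" "X \<subseteq> M" "M \<subseteq> {x + y | x y. x \<in> R_span R X \<and> y \<in> ?mM}"
    using X unfolding residually_spans_def by auto
  define F where "F = (\<lambda>c. \<Sum>s\<in>X. c s * s) ` (X \<rightarrow>\<^sub>E T)"
  have fin: "finite (X \<rightarrow>\<^sub>E T)" using X'(1) T'(2) by (intro finite_PiE) auto
  have "\<exists>f\<in>F. x - f \<in> ?mM" if x: "x \<in> M" for x
  proof -
    obtain w y where wy: "x = w + y" "w \<in> R_span R X" "y \<in> ?mM" using X'(3) x by blast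
    obtain c where c: "w = (\<Sum>s\<in>X. c s * s)" "\<forall>s\<in>X. c s \<in> R" using wy(2) unfolding R_span_def by blast
    have "\<forall>s\<in>X. \<exists>t. t \<in> T \<and> c s - t \<in> m" using c(2) T(1) unfolding transversal_def by blast
    from bchoice[OF this] obtain t where t: "\<forall>s\<in>X. t s \<in> T \<and> c s - t s \<in> m" by blast
    have "x - (\<Sum>s\<in>X. t s * s) = (\<Sum>s\<in>X. (c s - t s) * s) + y"
      unfolding wy(1) c(1) by (simp add: left_diff_distrib sum_subtractf)
    also have "\<dots> \<in> ?mM"
      using t X'(2) wy(3)
      by (intro add_groupD(4)[OF mM] add_group_sum[OF mM] ideal_mult_product) auto
    finally have "x - (\<Sum>s\<in>X. restrict t X s * s) \<in> ?mM" by (simp cong: sum.cong)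
    moreover have "(\<Sum>s\<in>X. restrict t X s * s) \<in> F" unfolding F_def using t by (intro imageI) auto
    ultimately show ?thesis by blast
  qed
  then have "b \<le> card F" using fin by (intro has_index_le_card[OF mM b]) (auto simp: F_def)
  also have "\<dots> \<le> card (X \<rightarrow>\<^sub>E T)" unfolding F_def by (rule card_image_le[OF fin])
  also have "\<dots> = q ^ card X" using X'(1) T(2) by (simp add: card_PiE)
  finally show ?thesis .
qed

text \<open>A maximal set whose images in \<open>M / m M\<close> are linearly independent spans; independence makes
  the \<open>q ^ card X\<close> combinations with coefficients in a transversal pairwise incongruent.\<close>

lemma residually_spanning_set:
  assumes M: "add_group M" "\<And>r x. r \<in> R \<Longrightarrow> x \<in> M \<Longrightarrow> r * x \<in> M"
    and q: "has_index R m q" and a: "has_index M (ideal_mult_set m M) a"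
  obtains X where "residually_spans R m M X" "q ^ card X \<le> a" "1 < q"
proof -
  let ?mM = "ideal_mult_set m M"
  have mM: "add_group ?mM" by (rule add_group_ideal_mult_set[OF M(1)])
  obtain T where T: "transversal R m T" "card T = q" using q unfolding has_index_def by blast
  have T': "T \<subseteq> R" "finite T" using T(1) by (simp_all add: transversal_def)
  have q1: "1 < q"
  proof -
    obtain u where u: "u \<in> T" "0 - u \<in> m" using T(1) R_zero unfolding transversal_def by blast
    obtain v where v: "v \<in> T" "1 - v \<in> m" using T(1) R_one unfolding transversal_def by blast
    have "u \<noteq> v"
    proof
      assume "u = v"
      then have "1 \<in> m" using add_groupD(2)[OF m_subgroup v(2) u(2)] by simp
      then show False using one_notin by simp
    qed
    then have "card {u, v} = 2" by simp
    moreover have "card {u, v} \<le> card T" using u v T'(2) by (intro card_mono) auto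
    ultimately show ?thesis using T(2) by simp
  qed
  define indep where "indep X \<longleftrightarrow> finite X \<and> X \<subseteq> M \<and>
    (\<forall>c. (\<forall>s\<in>X. c s \<in> R) \<and> (\<Sum>s\<in>X. c s * s) \<in> ?mM \<longrightarrow> (\<forall>s\<in>X. c s \<in> m))" for X
  have bound: "q ^ card X \<le> a" if X: "indep X" for X
  proof -
    have X': "finite X" "X \<subseteq> M" using X unfolding indep_def by auto
    have coeffs_m: "\<forall>s\<in>X. c s \<in> m" if "\<forall>s\<in>X. c s \<in> R" "(\<Sum>s\<in>X. c s * s) \<in> ?mM" for c
      using X that unfolding indep_def by blast
    let ?\<sigma> = "\<lambda>c. \<Sum>s\<in>X. c s * s"
    have eq: "c = c'" if c: "c \<in> X \<rightarrow>\<^sub>E T" "c' \<in> X \<rightarrow>\<^sub>E T" "?\<sigma> c - ?\<sigma> c' \<in> ?mM" for c c'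
    proof (rule PiE_ext[OF c(1,2)])
      have "?\<sigma> c - ?\<sigma> c' = (\<Sum>s\<in>X. (c s - c' s) * s)" by (simp add: left_diff_distrib sum_subtractf)
      then have "(\<Sum>s\<in>X. (c s - c' s) * s) \<in> ?mM" using c(3) by simp
      moreover have "\<forall>s\<in>X. c s - c' s \<in> R"
        using c(1,2) T'(1) by (intro ballI add_groupD(2)[OF R_subgroup]) auto
      ultimately have d: "\<forall>s\<in>X. c s - c' s \<in> m" by (rule coeffs_m[rotated])
      fix s assume "s \<in> X"
      then show "c s = c' s" using transversal_unique[OF T(1) m_subgroup, of "c s" "c' s"] c(1,2) d by auto
    qed
    have "inj_on ?\<sigma> (X \<rightarrow>\<^sub>E T)"
      using eq add_groupD(1)[OF mM] by (intro inj_onI) auto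
    then have "card (?\<sigma> ` (X \<rightarrow>\<^sub>E T)) = q ^ card X"
      using X'(1) T(2) by (simp add: card_image card_PiE)
    moreover have "card (?\<sigma> ` (X \<rightarrow>\<^sub>E T)) \<le> a"
    proof (rule card_le_has_index[OF mM a])
      show "?\<sigma> ` (X \<rightarrow>\<^sub>E T) \<subseteq> M"
        using X'(2) T'(1) by (auto intro!: add_group_sum[OF M(1)] M(2))
      fix s t assume st: "s \<in> ?\<sigma> ` (X \<rightarrow>\<^sub>E T)" "t \<in> ?\<sigma> ` (X \<rightarrow>\<^sub>E T)" "s - t \<in> ?mM"
      then obtain c c' where c: "c \<in> X \<rightarrow>\<^sub>E T" "s = ?\<sigma> c" "c' \<in> X \<rightarrow>\<^sub>E T" "t = ?\<sigma> c'" by blast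
      then show "s = t" using eq[OF c(1,3)] st(3) by simp
    qed
    ultimately show ?thesis by simp
  qed
  \<comment> \<open>The bound on \<open>q ^ card X\<close> also bounds \<open>card X\<close>, so an
    independent set of greatest size exists.\<close>
  have "card X < Suc a" if "indep X" for X
  proof -
    have "card X < q ^ card X" using q1 by (intro power_gt_expt) auto
    then show ?thesis using bound[OF that] by simp
  qed
  moreover have "indep {}" unfolding indep_def by simp
  ultimately obtain X where X: "indep X" and max: "\<And>Y. indep Y \<Longrightarrow> card Y \<le> card X"
    using ex_has_greatest_nat[of indep "{}" card "Suc a"] by blast
  have X': "finite X" "X \<subseteq> M" using X unfolding indep_def by auto
  have "x \<in> {x + y | x y. x \<in> R_span R X \<and> y \<in> ?mM}" if x: "x \<in> M" for x
  proof (cases "x \<in> X")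
    case True
    have "(\<Sum>s\<in>X. (if s = x then 1 else 0) * s) = (\<Sum>s\<in>X. if s = x then x else 0)"
      by (intro sum.cong) auto
    then have "x = (\<Sum>s\<in>X. (if s = x then 1 else 0) * s)" using True X'(1) by simp
    then have "x \<in> R_span R X"
      unfolding R_span_def using R_zero R_one by (intro CollectI exI[of _ "\<lambda>s. if s = x then 1 else 0"]) simp
    moreover have "x = x + 0" by simp
    ultimately show ?thesis using ideal_mult_zero by blast
  next
    case False
    have "\<not> indep (insert x X)" using max[of "insert x X"] X'(1) False by auto
    then obtain c where c: "\<forall>s\<in>insert x X. c s \<in> R" "(\<Sum>s\<in>insert x X. c s * s) \<in> ?mM"
      "\<not> (\<forall>s\<in>insert x X. c s \<in> m)"
      using X' x unfolding indep_def by auto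
    have cx: "c x * x + (\<Sum>s\<in>X. c s * s) \<in> ?mM" using c(2) X'(1) False by simp
    \<comment> \<open>By maximality \<open>x\<close> occurs in a nontrivial relation; its
      coefficient is a unit of \<open>R\<close>, so the relation can be solved for
      \<open>x\<close>.\<close>
    have "c x \<notin> m"
    proof
      assume cm: "c x \<in> m"
      from add_groupD(2)[OF mM cx ideal_mult_product[OF cm x]]
      have "(\<Sum>s\<in>X. c s * s) \<in> ?mM" by simp
      then have "\<forall>s\<in>X. c s \<in> m" using X c(1) unfolding indep_def by blast
      then show False using c(3) cm by blast
    qed
    then have u: "inverse (c x) \<in> R" "c x \<noteq> 0" using inverse_in c(1) m_zero by auto
    define w where "w = (\<Sum>s\<in>X. - (inverse (c x) * c s) * s)"
    have "inverse (c x) * (c x * x + (\<Sum>s\<in>X. c s * s)) \<in> ?mM"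
      by (rule ideal_mult_smult[OF cx M(2)[OF u(1)]])
    moreover have "inverse (c x) * (c x * x + (\<Sum>s\<in>X. c s * s)) = x - w"
      using u(2) by (simp add: w_def distrib_left sum_distrib_left sum_negf mult.assoc[symmetric])
    ultimately have "x - w \<in> ?mM" by simp
    moreover have "w \<in> R_span R X"
      unfolding R_span_def w_def using u(1) c(1)
      by (intro CollectI exI[of _ "\<lambda>s. - (inverse (c x) * c s)"] conjI refl ballI R_minus R_mult) auto
    moreover have "x = w + (x - w)" by simp
    ultimately show ?thesis by blast
  qed
  then have "residually_spans R m M X" using X' unfolding residually_spans_def by blast
  then show ?thesis using bound[OF X] q1 by (rule that)
qed

end

lemma one_in_normalization:
  fixes R :: "'a::field set"
  assumes "is_subring R"
  shows "1 \<in> normalization R"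
proof -
  have R: "1 \<in> R" "0 \<in> R" "- 1 \<in> R" using assms unfolding is_subring_def by auto
  have "\<forall>i. coeff [:- 1, 1:] i \<in> R" using R by (auto simp: coeff_pCons split: nat.splits)
  moreover have "poly [:- 1, 1:] (1::'a) = 0" "lead_coeff [:- 1, 1 :: 'a:] = 1" by simp_all
  moreover have "1 \<in> frac_field R"
    unfolding frac_field_def using R(1) by (intro CollectI exI[of _ 1] conjI) auto
  ultimately show ?thesis
    unfolding normalization_def by (intro CollectI conjI exI[of _ "[:- 1, 1:]"]) auto
qed

theorem theorem5p5:
  fixes R m I :: "'a::field_char_0 set"
  assumes "number_ring R"
    and "local_ring R"
    and "maximal_ideal R m"
    and "ideal_of R I"
  shows "residue_dim R m I \<le> residue_dim R m (normalization R)"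
proof (rule residue_dim_mono)
  fix X assume X: "residually_spans R m (normalization R) X"
  have sub: "is_subring R" using assms(1) unfolding number_ring_def by blast
  obtain B where B: "finite B" "\<And>x. x \<in> R \<Longrightarrow> \<exists>c. x = (\<Sum>b\<in>B. of_rat (c b) * b)"
    using assms(1) unfolding number_ring_def by blast
  have span: "R \<subseteq> Q.span B"
  proof
    fix x assume "x \<in> R"
    then obtain c where "x = (\<Sum>b\<in>B. rat_scale (c b) b)" using B(2) unfolding rat_scale_def by blast
    then show "x \<in> Q.span B" by (simp add: Q.span_sum Q.span_scale Q.span_base)
  qed
  interpret local_subring R m
  proof
    show "is_subring R" by (rule sub)
    show "ideal_of R m" using assms(3) unfolding maximal_ideal_def by blast
    show "1 \<notin> m" by (rule one_notin_maximal_ideal[OF assms(3)])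
    show "inverse x \<in> R" if "x \<in> R" "x \<notin> m" for x
      by (rule inverse_mem_if_not_in_maximal_ideal[OF sub assms(2,3) that])
  qed
  show "\<exists>Y. residually_spans R m I Y \<and> card Y \<le> card X"
  proof (cases "I = {0}")
    case True
    then show ?thesis using residually_spans_zero[of R m] by (intro exI[of _ "{}"]) simp
  next
    case I0: False
    show ?thesis
    proof (cases "\<exists>n>0. of_nat n \<in> m")
      case True
      then obtain p where p: "prime p" "of_nat p \<in> m" using residue_characteristic by blast
      interpret local_number_ring R m p B
        by unfold_locales (use B(1) span p in auto)
      obtain a b where ab: "has_index I (ideal_mult_set m I) a" "has_index S (ideal_mult_set m S) b" "a \<le> b"
        by (rule index_le[OF assms(4) I0]) (rule that)
      \<comment> \<open>The residue field is finite: \<open>R / p R\<close> is, and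
        \<open>p R\<close> lies in \<open>m\<close>.\<close>
      have "fin_mod R m"
        by (rule fin_mod_mono[OF fin_mod_R_power_p[of 1] order_refl])
          (use p(2) m_mult in \<open>auto simp: mult.commute\<close>)
      then obtain q where q: "has_index R m q" using fin_mod_has_index[OF m_subgroup] by blast
      have "b \<le> q ^ card X"
        by (rule index_le_power_card[OF S_subgroup _ q ab(2) X]) (use R_subset_S S_mult in blast)
      have I: "add_group I" "\<And>r x. r \<in> R \<Longrightarrow> x \<in> I \<Longrightarrow> r * x \<in> I"
        using ring_ideal_add_group[of R I] assms(4) R_minus[OF R_one]
        by (auto simp: ring_ideal_field ideal_of_def)
      have "\<exists>Y. residually_spans R m I Y \<and> q ^ card Y \<le> a \<and> 1 < q"
        by (rule residually_spanning_set[OF I(1) _ q ab(1)]) (use I(2) in blast)+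
      then obtain Y where Y: "residually_spans R m I Y" "q ^ card Y \<le> a" "1 < q" by blast
      have "q ^ card Y \<le> q ^ card X" using Y(2) ab(3) \<open>b \<le> q ^ card X\<close> by linarith
      then have "card Y \<le> card X" using Y(3) by simp
      then show ?thesis using Y(1) by blast
    next
      case False
      \<comment> \<open>Here \<open>m\<close> contains no nonzero integer, while every nonzero
        element of \<open>R\<close> divides one; hence \<open>m\<close> is zero and \<open>R\<close>
        is a field.\<close>
      have field: "x \<notin> m" if x: "x \<in> R" "x \<noteq> 0" for x
      proof
        assume xm: "x \<in> m"
        obtain z :: int and y where zy: "z \<noteq> 0" "y \<in> R" "x * y = of_int z"
          by (rule divides_nonzero_int[OF B(1) span x]) (rule that)
        have "of_int z \<in> m" using m_mult[OF zy(2) xm] zy(3) by (simp add: mult.commute)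
        then have "of_int \<bar>z\<bar> \<in> m" using add_groupD(3)[OF m_subgroup] by (auto simp: abs_if)
        then have "of_nat (nat \<bar>z\<bar>) \<in> m" by simp
        then show False using False zy(1) by (metis zero_less_abs_iff zero_less_nat_eq)
      qed
      obtain x where x: "x \<in> I" "x \<noteq> 0" using I0 assms(4) unfolding ideal_of_def by blast
      have xR: "x \<in> R" using x(1) assms(4) unfolding ideal_of_def by blast
      have "inverse x * x \<in> I"
        using inverse_in[OF xR field[OF xR x(2)]] x(1) assms(4) unfolding ideal_of_def by blast
      then have "1 \<in> I" using x(2) by simp
      moreover have "I \<subseteq> R" using assms(4) unfolding ideal_of_def by blast
      \<comment> \<open>A nonzero ideal of a field is the field itself, so 1 alone spans.\<close>
      moreover have "y \<in> {v + w | v w. v \<in> R_span R {1} \<and> w \<in> ideal_mult_set m I}" if "y \<in> R" for y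
      proof -
        have "y \<in> R_span R {1}"
          unfolding R_span_def using that by (intro CollectI exI[of _ "\<lambda>_. y"]) simp
        moreover have "y = y + 0" by simp
        ultimately show ?thesis using ideal_mult_zero by blast
      qed
      ultimately have "residually_spans R m I {1}" unfolding residually_spans_def by auto
      \<comment> \<open>The normalization contains 1 and its product with \<open>m\<close> is zero,
        so the empty set cannot span it.\<close>
      moreover have "X \<noteq> {}"
      proof
        assume "X = {}"
        then obtain w where w: "1 = 0 + w" "w \<in> ideal_mult_set m (normalization R)"
          using X one_in_normalization[OF sub] unfolding residually_spans_def R_span_def by auto
        have "m \<subseteq> {0}" using field m_in_R by blast
        then have "ideal_mult_set m (normalization R) \<subseteq> {0}"
          by (intro ideal_mult_subset) (auto simp: add_group_def)
        then show False using w by auto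
      qed
      then have "card X \<ge> 1" using X unfolding residually_spans_def by (simp add: Suc_le_eq card_gt_0_iff)
      ultimately show ?thesis by (intro exI[of _ "{1}"]) simp
    qed
  qed
qed

end
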